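(* Let $\mathcal{C},\mathcal{D}$ be triangulated categories and let $S : \mathcal{C} \to \mathcal{D}$ be a spherical functor with right adjoint functor $R : \mathcal{D} \to \mathcal{C}$, twist functor $T_S : \mathcal{D} \to \mathcal{D}$ and cotwist functor $C_S : \mathcal{C} \to \mathcal{C}$. Assume that the essential image of $R$ contains a split-generator of $\mathcal{C}$. Then, for $t \in \mathbb{R}$, $$h_t(T_S) \leq \begin{cases} 0 & (\text{if } h_t(C_S[2]) \leq 0),\\ h_t(C_S[2]) & (\text{if } h_t(C_S[2]) \geq 0).\end{cases}$$
   Context: Standing assumptions: all triangulated categories are linear over a field $\mathbb{K}$, admit a dg enhancement (i.e. are equivalent, as triangulated categories, to $H^0(\mathcal{A})$ for a pretriangulated dg category $\mathcal{A}$), and all exact functors between them admit dg lifts; cones of natural transformations are formed functorially via these. A triangulated category is assumed to have a split-generator whenever the categorical entropy of one of its endofunctors is considered. Split-generator: an object $G$ of a triangulated category $\mathcal{D}$ such that the smallest full triangulated subcategory containing $G$ and closed under taking direct summands is $\mathcal{D}$. Categorical complexity: for objects $E,F$ of $\mathcal{D}$ and $t \in \mathbb{R}$, $\delta_t(E,F)=0$ if $F\cong 0$; otherwise $\delta_t(E,F) \in [0,\infty]$ is the infimum of $\sum_{i=1}^k e^{n_i t}$ over all sequences of integers $(n_1,\dots,n_k)$ for which there exist an object $F'$ and objects $0=A_0,A_1,\dots,A_k = F\oplus F'$ with exact triangles $A_{i-1}\to A_i \to E[n_i] \to A_{i-1}[1]$ for $i=1,\dots,k$. Categorical entropy of an exact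 endofunctor $\Phi$ of $\mathcal{D}$: $h_t(\Phi) = \lim_{n\to\infty}\frac1n\log\delta_t(G,\Phi^nG) \in [-\infty,\infty)$ for a split-generator $G$ (the limit exists and is independent of $G$). Spherical functor: an exact functor $S:\mathcal{C}\to\mathcal{D}$ with right and left adjoints $R,L$ such that (1) the twist functor $T_S=\mathrm{Cone}(SR\xrightarrow{\varepsilon}\mathrm{Id}_\mathcal{D})$ ($\varepsilon$ the counit of $S\dashv R$) is an exact autoequivalence of $\mathcal{D}$; (2) the cotwist functor $C_S=\mathrm{Cone}(\mathrm{Id}_\mathcal{C}\xrightarrow{\eta}RS)[-1]$ ($\eta$ the unit of $S\dashv R$) is an exact autoequivalence of $\mathcal{C}$; (3) $R\cong LT_S[-1]$; (4) $R\cong C_SL[1]$. Here $C_S[2]$ is the composition of $C_S$ with the shift $[2]$. *)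

theory Defs
  imports "HOL-Analysis.Analysis" "HOL-Algebra.Module"
begin

section \<open>Linear categories and functors\<close>

text \<open>
  A category linear over a field \<open>K\<close> has an explicit set of objects and, for any two objects, a
  module of morphisms.  The modules belonging to different pairs of objects may overlap as sets, so
  composition takes the objects as arguments: \<open>Cmp C X Y Z g f\<close> is \<open>g\<close> after \<open>f\<close>, for
  \<open>f : X \<rightarrow> Y\<close> and \<open>g : Y \<rightarrow> Z\<close>.  The ring fields \<open>mult\<close> and \<open>one\<close> of the module records are
  never used.
\<close>

record ('k, 'o, 'm) lincat =
  Ob :: "'o set"
  Mor :: "'o \<Rightarrow> 'o \<Rightarrow> ('k, 'm) module"
  Cmp :: "'o \<Rightarrow> 'o \<Rightarrow> 'o \<Rightarrow> 'm \<Rightarrow> 'm \<Rightarrow> 'm"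
  Idt :: "'o \<Rightarrow> 'm"

abbreviation arr :: "('k, 'o, 'm, 'y) lincat_scheme \<Rightarrow> 'o \<Rightarrow> 'o \<Rightarrow> 'm set" where
  "arr C X Y \<equiv> carrier (Mor C X Y)"

locale linear_category =
  fixes K :: "'k ring" and C :: "('k, 'o, 'm, 'y) lincat_scheme"
  assumes field_K: "field K"
    and module_Mor: "\<And>X Y. \<lbrakk>X \<in> Ob C; Y \<in> Ob C\<rbrakk> \<Longrightarrow> module K (Mor C X Y)"
    and Idt_closed: "\<And>X. X \<in> Ob C \<Longrightarrow> Idt C X \<in> arr C X X"
    and Cmp_closed: "\<And>X Y Z f g. \<lbrakk>X \<in> Ob C; Y \<in> Ob C; Z \<in> Ob C; f \<in> arr C X Y; g \<in> arr C Y Z\<rbrakk>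
      \<Longrightarrow> Cmp C X Y Z g f \<in> arr C X Z"
    and Cmp_Idt_left: "\<And>X Y f. \<lbrakk>X \<in> Ob C; Y \<in> Ob C; f \<in> arr C X Y\<rbrakk>
      \<Longrightarrow> Cmp C X Y Y (Idt C Y) f = f"
    and Cmp_Idt_right: "\<And>X Y f. \<lbrakk>X \<in> Ob C; Y \<in> Ob C; f \<in> arr C X Y\<rbrakk>
      \<Longrightarrow> Cmp C X X Y f (Idt C X) = f"
    and Cmp_assoc: "\<And>W X Y Z f g h.
      \<lbrakk>W \<in> Ob C; X \<in> Ob C; Y \<in> Ob C; Z \<in> Ob C; f \<in> arr C W X; g \<in> arr C X Y; h \<in> arr C Y Z\<rbrakk>
      \<Longrightarrow> Cmp C W Y Z h (Cmp C W X Y g f) = Cmp C W X Z (Cmp C X Y Z h g) f"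
    and Cmp_add_left: "\<And>X Y Z f g g'.
      \<lbrakk>X \<in> Ob C; Y \<in> Ob C; Z \<in> Ob C; f \<in> arr C X Y; g \<in> arr C Y Z; g' \<in> arr C Y Z\<rbrakk>
      \<Longrightarrow> Cmp C X Y Z (g \<oplus>\<^bsub>Mor C Y Z\<^esub> g') f = Cmp C X Y Z g f \<oplus>\<^bsub>Mor C X Z\<^esub> Cmp C X Y Z g' f"
    and Cmp_add_right: "\<And>X Y Z f f' g.
      \<lbrakk>X \<in> Ob C; Y \<in> Ob C; Z \<in> Ob C; f \<in> arr C X Y; f' \<in> arr C X Y; g \<in> arr C Y Z\<rbrakk>
      \<Longrightarrow> Cmp C X Y Z g (f \<oplus>\<^bsub>Mor C X Y\<^esub> f') = Cmp C X Y Z g f \<oplus>\<^bsub>Mor C X Z\<^esub> Cmp C X Y Z g f'"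
    and Cmp_smult_left: "\<And>X Y Z f g a.
      \<lbrakk>X \<in> Ob C; Y \<in> Ob C; Z \<in> Ob C; f \<in> arr C X Y; g \<in> arr C Y Z; a \<in> carrier K\<rbrakk>
      \<Longrightarrow> Cmp C X Y Z (a \<odot>\<^bsub>Mor C Y Z\<^esub> g) f = a \<odot>\<^bsub>Mor C X Z\<^esub> Cmp C X Y Z g f"
    and Cmp_smult_right: "\<And>X Y Z f g a.
      \<lbrakk>X \<in> Ob C; Y \<in> Ob C; Z \<in> Ob C; f \<in> arr C X Y; g \<in> arr C Y Z; a \<in> carrier K\<rbrakk>
      \<Longrightarrow> Cmp C X Y Z g (a \<odot>\<^bsub>Mor C X Y\<^esub> f) = a \<odot>\<^bsub>Mor C X Z\<^esub> Cmp C X Y Z g f"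

definition is_iso :: "('k, 'o, 'm, 'y) lincat_scheme \<Rightarrow> 'o \<Rightarrow> 'o \<Rightarrow> 'm \<Rightarrow> bool" where
  "is_iso C X Y f \<longleftrightarrow> f \<in> arr C X Y \<and>
    (\<exists>g\<in>arr C Y X. Cmp C X Y X g f = Idt C X \<and> Cmp C Y X Y f g = Idt C Y)"

definition iso_objects :: "('k, 'o, 'm, 'y) lincat_scheme \<Rightarrow> 'o \<Rightarrow> 'o \<Rightarrow> bool" where
  "iso_objects C X Y \<longleftrightarrow> X \<in> Ob C \<and> Y \<in> Ob C \<and> (\<exists>f. is_iso C X Y f)"

definition is_zero :: "('k, 'o, 'm, 'y) lincat_scheme \<Rightarrow> 'o \<Rightarrow> bool" where
  "is_zero C Z \<longleftrightarrow> Z \<in> Ob C \<and>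
    (\<forall>X\<in>Ob C. arr C X Z = {\<zero>\<^bsub>Mor C X Z\<^esub>} \<and> arr C Z X = {\<zero>\<^bsub>Mor C Z X\<^esub>})"

definition is_direct_sum :: "('k, 'o, 'm, 'y) lincat_scheme \<Rightarrow> 'o \<Rightarrow> 'o \<Rightarrow> 'o \<Rightarrow> bool" where
  "is_direct_sum C X Y W \<longleftrightarrow> X \<in> Ob C \<and> Y \<in> Ob C \<and> W \<in> Ob C \<and>
    (\<exists>i\<in>arr C X W. \<exists>j\<in>arr C Y W. \<exists>p\<in>arr C W X. \<exists>q\<in>arr C W Y.
      Cmp C X W X p i = Idt C X \<and> Cmp C Y W Y q j = Idt C Y \<and>
      Cmp C Y W X p j = \<zero>\<^bsub>Mor C Y X\<^esub> \<and> Cmp C X W Y q i = \<zero>\<^bsub>Mor C X Y\<^esub> \<and>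
      Cmp C W X W i p \<oplus>\<^bsub>Mor C W W\<^esub> Cmp C W Y W j q = Idt C W)"

record ('o, 'm, 'p, 'n) cfun =
  onOb :: "'o \<Rightarrow> 'p"
  onMor :: "'o \<Rightarrow> 'o \<Rightarrow> 'm \<Rightarrow> 'n"

definition idfun :: "('o, 'm, 'o, 'm) cfun" where
  "idfun = \<lparr>onOb = (\<lambda>X. X), onMor = (\<lambda>X Y f. f)\<rparr>"

definition fcomp :: "('p, 'n, 'q, 'l) cfun \<Rightarrow> ('o, 'm, 'p, 'n) cfun \<Rightarrow> ('o, 'm, 'q, 'l) cfun"
    (infixl \<open>\<circ>\<^sub>F\<close> 55) where
  "G \<circ>\<^sub>F F = \<lparr>onOb = (\<lambda>X. onOb G (onOb F X)),
             onMor = (\<lambda>X Y f. onMor G (onOb F X) (onOb F Y) (onMor F X Y f))\<rparr>"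

locale linear_functor =
  fixes K :: "'k ring" and C :: "('k, 'o, 'm, 'y) lincat_scheme"
    and D :: "('k, 'p, 'n, 'w) lincat_scheme" and F :: "('o, 'm, 'p, 'n) cfun"
  assumes onOb_closed: "\<And>X. X \<in> Ob C \<Longrightarrow> onOb F X \<in> Ob D"
    and onMor_closed: "\<And>X Y f. \<lbrakk>X \<in> Ob C; Y \<in> Ob C; f \<in> arr C X Y\<rbrakk>
      \<Longrightarrow> onMor F X Y f \<in> arr D (onOb F X) (onOb F Y)"
    and onMor_Idt: "\<And>X. X \<in> Ob C \<Longrightarrow> onMor F X X (Idt C X) = Idt D (onOb F X)"
    and onMor_Cmp: "\<And>X Y Z f g. \<lbrakk>X \<in> Ob C; Y \<in> Ob C; Z \<in> Ob C; f \<in> arr C X Y; g \<in> arr C Y Z\<rbrakk>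
      \<Longrightarrow> onMor F X Z (Cmp C X Y Z g f)
          = Cmp D (onOb F X) (onOb F Y) (onOb F Z) (onMor F Y Z g) (onMor F X Y f)"
    and onMor_add: "\<And>X Y f f'. \<lbrakk>X \<in> Ob C; Y \<in> Ob C; f \<in> arr C X Y; f' \<in> arr C X Y\<rbrakk>
      \<Longrightarrow> onMor F X Y (f \<oplus>\<^bsub>Mor C X Y\<^esub> f')
          = onMor F X Y f \<oplus>\<^bsub>Mor D (onOb F X) (onOb F Y)\<^esub> onMor F X Y f'"
    and onMor_smult: "\<And>X Y f a. \<lbrakk>X \<in> Ob C; Y \<in> Ob C; f \<in> arr C X Y; a \<in> carrier K\<rbrakk>
      \<Longrightarrow> onMor F X Y (a \<odot>\<^bsub>Mor C X Y\<^esub> f) = a \<odot>\<^bsub>Mor D (onOb F X) (onOb F Y)\<^esub> onMor F X Y f"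

definition nat_trans :: "('k, 'o, 'm, 'y) lincat_scheme \<Rightarrow> ('k, 'p, 'n, 'w) lincat_scheme \<Rightarrow>
    ('o, 'm, 'p, 'n) cfun \<Rightarrow> ('o, 'm, 'p, 'n) cfun \<Rightarrow> ('o \<Rightarrow> 'n) \<Rightarrow> bool" where
  "nat_trans C D F G \<alpha> \<longleftrightarrow>
    (\<forall>X\<in>Ob C. \<alpha> X \<in> arr D (onOb F X) (onOb G X)) \<and>
    (\<forall>X\<in>Ob C. \<forall>Y\<in>Ob C. \<forall>f\<in>arr C X Y.
      Cmp D (onOb F X) (onOb F Y) (onOb G Y) (\<alpha> Y) (onMor F X Y f)
      = Cmp D (onOb F X) (onOb G X) (onOb G Y) (onMor G X Y f) (\<alpha> X))"

definition nat_iso :: "('k, 'o, 'm, 'y) lincat_scheme \<Rightarrow> ('k, 'p, 'n, 'w) lincat_scheme \<Rightarrow>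
    ('o, 'm, 'p, 'n) cfun \<Rightarrow> ('o, 'm, 'p, 'n) cfun \<Rightarrow> ('o \<Rightarrow> 'n) \<Rightarrow> bool" where
  "nat_iso C D F G \<alpha> \<longleftrightarrow>
    nat_trans C D F G \<alpha> \<and> (\<forall>X\<in>Ob C. is_iso D (onOb F X) (onOb G X) (\<alpha> X))"

definition fun_iso :: "('k, 'o, 'm, 'y) lincat_scheme \<Rightarrow> ('k, 'p, 'n, 'w) lincat_scheme \<Rightarrow>
    ('o, 'm, 'p, 'n) cfun \<Rightarrow> ('o, 'm, 'p, 'n) cfun \<Rightarrow> bool" where
  "fun_iso C D F G \<longleftrightarrow> (\<exists>\<alpha>. nat_iso C D F G \<alpha>)"

definition equivalence :: "'k ring \<Rightarrow> ('k, 'o, 'm, 'y) lincat_scheme \<Rightarrow>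
    ('k, 'p, 'n, 'w) lincat_scheme \<Rightarrow> ('o, 'm, 'p, 'n) cfun \<Rightarrow> bool" where
  "equivalence K C D F \<longleftrightarrow> linear_functor K C D F \<and>
    (\<exists>G. linear_functor K D C G \<and> fun_iso C C (G \<circ>\<^sub>F F) idfun \<and> fun_iso D D (F \<circ>\<^sub>F G) idfun)"

text \<open>\<open>adjunction K C D F G \<eta> \<epsilon>\<close>: \<open>F : C \<rightarrow> D\<close> is left adjoint to \<open>G : D \<rightarrow> C\<close>, with unit \<open>\<eta>\<close> and
  counit \<open>\<epsilon>\<close>.\<close>

definition adjunction :: "'k ring \<Rightarrow> ('k, 'o, 'm, 'y) lincat_scheme \<Rightarrow>
    ('k, 'p, 'n, 'w) lincat_scheme \<Rightarrow> ('o, 'm, 'p, 'n) cfun \<Rightarrow> ('p, 'n, 'o, 'm) cfun \<Rightarrow>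
    ('o \<Rightarrow> 'm) \<Rightarrow> ('p \<Rightarrow> 'n) \<Rightarrow> bool" where
  "adjunction K C D F G \<eta> \<epsilon> \<longleftrightarrow>
    linear_functor K C D F \<and> linear_functor K D C G \<and>
    nat_trans C C idfun (G \<circ>\<^sub>F F) \<eta> \<and> nat_trans D D (F \<circ>\<^sub>F G) idfun \<epsilon> \<and>
    (\<forall>X\<in>Ob C. Cmp D (onOb F X) (onOb F (onOb G (onOb F X))) (onOb F X)
        (\<epsilon> (onOb F X)) (onMor F X (onOb G (onOb F X)) (\<eta> X)) = Idt D (onOb F X)) \<and>
    (\<forall>Y\<in>Ob D. Cmp C (onOb G Y) (onOb G (onOb F (onOb G Y))) (onOb G Y)
        (onMor G (onOb F (onOb G Y)) Y (\<epsilon> Y)) (\<eta> (onOb G Y)) = Idt C (onOb G Y))"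

definition ess_image :: "('k, 'o, 'm, 'y) lincat_scheme \<Rightarrow> ('k, 'p, 'n, 'w) lincat_scheme \<Rightarrow>
    ('o, 'm, 'p, 'n) cfun \<Rightarrow> 'p set" where
  "ess_image C D F = {Y. \<exists>X\<in>Ob C. iso_objects D (onOb F X) Y}"


section \<open>Triangulated categories\<close>

text \<open>The shift \<open>[1]\<close> is an autoequivalence, given together with a quasi-inverse \<open>[-1]\<close>.
  \<open>Tri T X Y Z f g h\<close> says that \<open>X \<rightarrow> Y \<rightarrow> Z \<rightarrow> X[1]\<close>, with maps \<open>f\<close>, \<open>g\<close>, \<open>h\<close>, is an exact triangle.\<close>

record ('k, 'o, 'm) tricat = "('k, 'o, 'm) lincat" +
  Shift :: "('o, 'm, 'o, 'm) cfun"
  Unshift :: "('o, 'm, 'o, 'm) cfun"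
  Tri :: "'o \<Rightarrow> 'o \<Rightarrow> 'o \<Rightarrow> 'm \<Rightarrow> 'm \<Rightarrow> 'm \<Rightarrow> bool"

abbreviation sh :: "('k, 'o, 'm, 'y) tricat_scheme \<Rightarrow> 'o \<Rightarrow> 'o" where
  "sh T X \<equiv> onOb (Shift T) X"

definition tri_iso :: "('k, 'o, 'm, 'y) tricat_scheme \<Rightarrow> 'o \<Rightarrow> 'o \<Rightarrow> 'o \<Rightarrow> 'm \<Rightarrow> 'm \<Rightarrow> 'm \<Rightarrow>
    'o \<Rightarrow> 'o \<Rightarrow> 'o \<Rightarrow> 'm \<Rightarrow> 'm \<Rightarrow> 'm \<Rightarrow> bool" where
  "tri_iso T X Y Z f g h X' Y' Z' f' g' h' \<longleftrightarrow>
    {X, Y, Z, X', Y', Z'} \<subseteq> Ob T \<and>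
    f \<in> arr T X Y \<and> g \<in> arr T Y Z \<and> h \<in> arr T Z (sh T X) \<and>
    f' \<in> arr T X' Y' \<and> g' \<in> arr T Y' Z' \<and> h' \<in> arr T Z' (sh T X') \<and>
    (\<exists>u v w. is_iso T X X' u \<and> is_iso T Y Y' v \<and> is_iso T Z Z' w \<and>
      Cmp T X Y Y' v f = Cmp T X X' Y' f' u \<and>
      Cmp T Y Z Z' w g = Cmp T Y Y' Z' g' v \<and>
      Cmp T Z (sh T X) (sh T X') (onMor (Shift T) X X' u) h = Cmp T Z Z' (sh T X') h' w)"

locale triangulated_category = linear_category K T
  for K :: "'k ring" and T :: "('k, 'o, 'm, 'y) tricat_scheme" +
  assumes ex_zero: "\<exists>Z. is_zero T Z"
    and ex_direct_sum: "\<And>X Y. \<lbrakk>X \<in> Ob T; Y \<in> Ob T\<rbrakk> \<Longrightarrow> \<exists>W. is_direct_sum T X Y W"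
    and linear_Shift: "linear_functor K T T (Shift T)"
    and linear_Unshift: "linear_functor K T T (Unshift T)"
    and Unshift_Shift: "fun_iso T T (Unshift T \<circ>\<^sub>F Shift T) idfun"
    and Shift_Unshift: "fun_iso T T (Shift T \<circ>\<^sub>F Unshift T) idfun"
    and Tri_closed: "\<And>X Y Z f g h. Tri T X Y Z f g h \<Longrightarrow> X \<in> Ob T \<and> Y \<in> Ob T \<and> Z \<in> Ob T \<and>
      f \<in> arr T X Y \<and> g \<in> arr T Y Z \<and> h \<in> arr T Z (sh T X)"
    and TR1_iso: "\<And>X Y Z f g h X' Y' Z' f' g' h'.
      \<lbrakk>Tri T X Y Z f g h; tri_iso T X Y Z f g h X' Y' Z' f' g' h'\<rbrakk> \<Longrightarrow> Tri T X' Y' Z' f' g' h'"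
    and TR1_id: "\<And>X Z. \<lbrakk>X \<in> Ob T; is_zero T Z\<rbrakk>
      \<Longrightarrow> Tri T X X Z (Idt T X) \<zero>\<^bsub>Mor T X Z\<^esub> \<zero>\<^bsub>Mor T Z (sh T X)\<^esub>"
    and TR1_cone: "\<And>X Y f. \<lbrakk>X \<in> Ob T; Y \<in> Ob T; f \<in> arr T X Y\<rbrakk> \<Longrightarrow> \<exists>Z g h. Tri T X Y Z f g h"
    and TR2: "\<And>X Y Z f g h. \<lbrakk>X \<in> Ob T; Y \<in> Ob T; Z \<in> Ob T;
        f \<in> arr T X Y; g \<in> arr T Y Z; h \<in> arr T Z (sh T X)\<rbrakk>
      \<Longrightarrow> Tri T X Y Z f g h \<longleftrightarrow>
          Tri T Y Z (sh T X) g h (\<ominus>\<^bsub>Mor T (sh T X) (sh T Y)\<^esub> onMor (Shift T) X Y f)"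
    and TR3: "\<And>X Y Z f g h X' Y' Z' f' g' h' u v.
      \<lbrakk>Tri T X Y Z f g h; Tri T X' Y' Z' f' g' h'; u \<in> arr T X X'; v \<in> arr T Y Y';
        Cmp T X Y Y' v f = Cmp T X X' Y' f' u\<rbrakk>
      \<Longrightarrow> \<exists>w\<in>arr T Z Z'. Cmp T Y Z Z' w g = Cmp T Y Y' Z' g' v \<and>
          Cmp T Z (sh T X) (sh T X') (onMor (Shift T) X X' u) h = Cmp T Z Z' (sh T X') h' w"
    and TR4: "\<And>X Y Z X' Y' Z' f g j k l i m n.
      \<lbrakk>Tri T X Y Z' f j k; Tri T Y Z X' g l i; Tri T X Z Y' (Cmp T X Y Z g f) m n\<rbrakk>
      \<Longrightarrow> \<exists>u\<in>arr T Z' Y'. \<exists>v\<in>arr T Y' X'.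
          Tri T Z' Y' X' u v (Cmp T X' (sh T Y) (sh T Z') (onMor (Shift T) Y Z' j) i) \<and>
          Cmp T Y Z' Y' u j = Cmp T Y Z Y' m g \<and>
          Cmp T Z' Y' (sh T X) n u = k \<and>
          Cmp T Z Y' X' v m = l \<and>
          Cmp T Y' X' (sh T Y) i v = Cmp T Y' (sh T X) (sh T Y) (onMor (Shift T) X Y f) n"

definition shift_by :: "('k, 'o, 'm, 'y) tricat_scheme \<Rightarrow> int \<Rightarrow> ('o, 'm, 'o, 'm) cfun" where
  "shift_by T n = (if n \<ge> 0 then (fcomp (Shift T) ^^ nat n) idfun
                  else (fcomp (Unshift T) ^^ nat (- n)) idfun)"

definition exact_functor :: "'k ring \<Rightarrow> ('k, 'o, 'm, 'y) tricat_scheme \<Rightarrow>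
    ('k, 'p, 'n, 'w) tricat_scheme \<Rightarrow> ('o, 'm, 'p, 'n) cfun \<Rightarrow> bool" where
  "exact_functor K C D F \<longleftrightarrow> linear_functor K C D F \<and>
    (\<exists>\<theta>. nat_iso C D (F \<circ>\<^sub>F Shift C) (Shift D \<circ>\<^sub>F F) \<theta> \<and>
      (\<forall>X Y Z f g h. Tri C X Y Z f g h \<longrightarrow>
        Tri D (onOb F X) (onOb F Y) (onOb F Z) (onMor F X Y f) (onMor F Y Z g)
          (Cmp D (onOb F Z) (onOb F (sh C X)) (sh D (onOb F X)) (\<theta> X) (onMor F Z (sh C X) h))))"

definition exact_equivalence :: "'k ring \<Rightarrow> ('k, 'o, 'm, 'y) tricat_scheme \<Rightarrow>
    ('k, 'p, 'n, 'w) tricat_scheme \<Rightarrow> ('o, 'm, 'p, 'n) cfun \<Rightarrow> bool" where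
  "exact_equivalence K C D F \<longleftrightarrow> exact_functor K C D F \<and> equivalence K C D F"

text \<open>Full triangulated subcategories closed under direct summands, given by their sets of objects.
  Closure under direct summands includes closure under isomorphism.\<close>

definition thick :: "('k, 'o, 'm, 'y) tricat_scheme \<Rightarrow> 'o set \<Rightarrow> bool" where
  "thick T U \<longleftrightarrow> U \<subseteq> Ob T \<and> {Z. is_zero T Z} \<subseteq> U \<and>
    (\<forall>X\<in>U. onOb (Shift T) X \<in> U \<and> onOb (Unshift T) X \<in> U) \<and>
    (\<forall>X Y Z f g h. Tri T X Y Z f g h \<and> X \<in> U \<and> Y \<in> U \<longrightarrow> Z \<in> U) \<and>
    (\<forall>X X' W. is_direct_sum T X X' W \<and> W \<in> U \<longrightarrow> X \<in> U)"

definition split_generator :: "('k, 'o, 'm, 'y) tricat_scheme \<Rightarrow> 'o \<Rightarrow> bool" where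
  "split_generator T G \<longleftrightarrow> G \<in> Ob T \<and> \<Inter>{U. thick T U \<and> G \<in> U} = Ob T"


section \<open>Categorical complexity and entropy\<close>

definition generation_sequence :: "('k, 'o, 'm, 'y) tricat_scheme \<Rightarrow> 'o \<Rightarrow> 'o \<Rightarrow> int list \<Rightarrow> bool"
  where
  "generation_sequence T E F ns \<longleftrightarrow>
    (\<exists>F' A. is_zero T (A 0) \<and> is_direct_sum T F F' (A (length ns)) \<and>
      (\<forall>i<length ns. \<exists>f g h.
        Tri T (A i) (A (Suc i)) (onOb (shift_by T (ns ! i)) E) f g h))"

definition complexity :: "('k, 'o, 'm, 'y) tricat_scheme \<Rightarrow> real \<Rightarrow> 'o \<Rightarrow> 'o \<Rightarrow> ennreal" where
  "complexity T t E F = (if is_zero T F then 0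
    else (INF ns\<in>{ns. generation_sequence T E F ns}.
            ennreal (\<Sum>n\<leftarrow>ns. exp (real_of_int n * t))))"

definition eln :: "ennreal \<Rightarrow> ereal" where
  "eln x = (if x = 0 then -\<infinity> else if x = \<infinity> then \<infinity> else ereal (ln (enn2real x)))"

text \<open>The common value of the limits over all split-generators.\<close>

definition entropy :: "('k, 'o, 'm, 'y) tricat_scheme \<Rightarrow> real \<Rightarrow> ('o, 'm, 'o, 'm) cfun \<Rightarrow> ereal" where
  "entropy T t \<Phi> = (THE h. \<forall>G. split_generator T G \<longrightarrow>
    (\<lambda>n. eln (complexity T t G ((onOb \<Phi> ^^ n) G)) / ereal (real n)) \<longlonglongrightarrow> h)"


section \<open>Dg categories\<close>

text \<open>\<open>Gr A X Y n\<close> is the degree \<open>n\<close> part of the morphism space \<open>Mor A X Y\<close>, which is the direct sum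
  of these parts, and \<open>Dif A X Y\<close> is the differential, of degree \<open>1\<close>.\<close>

record ('k, 'o, 'm) dgcat = "('k, 'o, 'm) lincat" +
  Gr :: "'o \<Rightarrow> 'o \<Rightarrow> int \<Rightarrow> 'm set"
  Dif :: "'o \<Rightarrow> 'o \<Rightarrow> 'm \<Rightarrow> 'm"

definition signed :: "('k, 'm) module \<Rightarrow> int \<Rightarrow> 'm \<Rightarrow> 'm" where
  "signed M n x = (if even n then x else \<ominus>\<^bsub>M\<^esub> x)"

locale dg_category = linear_category K A
  for K :: "'k ring" and A :: "('k, 'o, 'm, 'y) dgcat_scheme" +
  assumes Gr_submodule: "\<And>X Y n. \<lbrakk>X \<in> Ob A; Y \<in> Ob A\<rbrakk> \<Longrightarrow> submodule (Gr A X Y n) K (Mor A X Y)"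
    and Gr_decomposition: "\<And>X Y f. \<lbrakk>X \<in> Ob A; Y \<in> Ob A; f \<in> arr A X Y\<rbrakk> \<Longrightarrow>
      \<exists>!c. (\<forall>n. c n \<in> Gr A X Y n) \<and> finite {n. c n \<noteq> \<zero>\<^bsub>Mor A X Y\<^esub>} \<and>
           f = (\<Oplus>\<^bsub>Mor A X Y\<^esub>n\<in>{n. c n \<noteq> \<zero>\<^bsub>Mor A X Y\<^esub>}. c n)"
    and Idt_Gr: "\<And>X. X \<in> Ob A \<Longrightarrow> Idt A X \<in> Gr A X X 0"
    and Cmp_Gr: "\<And>X Y Z f g m n.
      \<lbrakk>X \<in> Ob A; Y \<in> Ob A; Z \<in> Ob A; f \<in> Gr A X Y m; g \<in> Gr A Y Z n\<rbrakk>
      \<Longrightarrow> Cmp A X Y Z g f \<in> Gr A X Z (m + n)"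
    and Dif_Gr: "\<And>X Y f n. \<lbrakk>X \<in> Ob A; Y \<in> Ob A; f \<in> Gr A X Y n\<rbrakk> \<Longrightarrow> Dif A X Y f \<in> Gr A X Y (n + 1)"
    and Dif_add: "\<And>X Y f g. \<lbrakk>X \<in> Ob A; Y \<in> Ob A; f \<in> arr A X Y; g \<in> arr A X Y\<rbrakk>
      \<Longrightarrow> Dif A X Y (f \<oplus>\<^bsub>Mor A X Y\<^esub> g) = Dif A X Y f \<oplus>\<^bsub>Mor A X Y\<^esub> Dif A X Y g"
    and Dif_smult: "\<And>X Y f a. \<lbrakk>X \<in> Ob A; Y \<in> Ob A; f \<in> arr A X Y; a \<in> carrier K\<rbrakk>
      \<Longrightarrow> Dif A X Y (a \<odot>\<^bsub>Mor A X Y\<^esub> f) = a \<odot>\<^bsub>Mor A X Y\<^esub> Dif A X Y f"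
    and Dif_Dif: "\<And>X Y f. \<lbrakk>X \<in> Ob A; Y \<in> Ob A; f \<in> arr A X Y\<rbrakk>
      \<Longrightarrow> Dif A X Y (Dif A X Y f) = \<zero>\<^bsub>Mor A X Y\<^esub>"
    and Leibniz: "\<And>X Y Z f g n.
      \<lbrakk>X \<in> Ob A; Y \<in> Ob A; Z \<in> Ob A; f \<in> arr A X Y; g \<in> Gr A Y Z n\<rbrakk>
      \<Longrightarrow> Dif A X Z (Cmp A X Y Z g f)
          = Cmp A X Y Z (Dif A Y Z g) f
            \<oplus>\<^bsub>Mor A X Z\<^esub> signed (Mor A X Z) n (Cmp A X Y Z g (Dif A X Y f))"

definition cyc :: "('k, 'o, 'm, 'y) dgcat_scheme \<Rightarrow> 'o \<Rightarrow> 'o \<Rightarrow> int \<Rightarrow> 'm set" where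
  "cyc A X Y n = {f \<in> Gr A X Y n. Dif A X Y f = \<zero>\<^bsub>Mor A X Y\<^esub>}"

text \<open>The objects below need only represent shifts and cones up to homotopy equivalence in the
  pretriangulated hull.  \<open>Z\<close> represents \<open>X[n]\<close> via \<open>\<sigma> : X \<rightarrow> Z\<close> of degree \<open>-n\<close> and
  \<open>\<tau> : Z \<rightarrow> X\<close> of degree \<open>n\<close>.\<close>

definition is_shift :: "('k, 'o, 'm, 'y) dgcat_scheme \<Rightarrow> int \<Rightarrow> 'o \<Rightarrow> 'o \<Rightarrow> 'm \<Rightarrow> 'm \<Rightarrow> bool" where
  "is_shift A n X Z \<sigma> \<tau> \<longleftrightarrow> X \<in> Ob A \<and> Z \<in> Ob A \<and> \<sigma> \<in> cyc A X Z (- n) \<and> \<tau> \<in> cyc A Z X n \<and>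
    (\<exists>h\<in>Gr A X X (-1). Cmp A X Z X \<tau> \<sigma> = Idt A X \<oplus>\<^bsub>Mor A X X\<^esub> Dif A X X h) \<and>
    (\<exists>h\<in>Gr A Z Z (-1). Cmp A Z X Z \<sigma> \<tau> = Idt A Z \<oplus>\<^bsub>Mor A Z Z\<^esub> Dif A Z Z h)"

text \<open>
  For a closed degree \<open>0\<close> morphism \<open>f : X \<rightarrow> Y\<close>, the cone in the pretriangulated hull is
  \<open>X[1] \<oplus> Y\<close> with differential \<open>(x, y) \<mapsto> (- d x, f x + d y)\<close>.  A closed degree \<open>0\<close> morphism from it
  to \<open>Z\<close> is \<open>(x, y) \<mapsto> s x + i y\<close>, where \<open>s : X \<rightarrow> Z\<close> has degree \<open>-1\<close> and \<open>i : Y \<rightarrow> Z\<close> degree \<open>0\<close>,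
  with \<open>d i = 0\<close> and \<open>d s = i f\<close>; one in the other direction is \<open>z \<mapsto> (p z, q z)\<close>, where
  \<open>p : Z \<rightarrow> X\<close> has degree \<open>1\<close> and \<open>q : Z \<rightarrow> Y\<close> degree \<open>0\<close>, with \<open>d p = 0\<close> and \<open>d q = - f p\<close>.
  The remaining equations say that the two are mutually inverse up to homotopy: \<open>h\<close> is a homotopy
  on \<open>Z\<close>, and \<open>(x, y) \<mapsto> (a x + c y, b x + e y)\<close> one on the cone.
\<close>

definition is_cone :: "('k, 'o, 'm, 'y) dgcat_scheme \<Rightarrow> 'o \<Rightarrow> 'o \<Rightarrow> 'm \<Rightarrow> 'o \<Rightarrow>
    'm \<Rightarrow> 'm \<Rightarrow> 'm \<Rightarrow> 'm \<Rightarrow> bool" where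
  "is_cone A X Y f Z i s p q \<longleftrightarrow>
    X \<in> Ob A \<and> Y \<in> Ob A \<and> Z \<in> Ob A \<and> f \<in> cyc A X Y 0 \<and>
    i \<in> cyc A Y Z 0 \<and> s \<in> Gr A X Z (-1) \<and> Dif A X Z s = Cmp A X Y Z i f \<and>
    p \<in> cyc A Z X 1 \<and> q \<in> Gr A Z Y 0 \<and> Dif A Z Y q = \<ominus>\<^bsub>Mor A Z Y\<^esub> Cmp A Z X Y f p \<and>
    (\<exists>h\<in>Gr A Z Z (-1).
      Cmp A Z X Z s p \<oplus>\<^bsub>Mor A Z Z\<^esub> Cmp A Z Y Z i q = Idt A Z \<oplus>\<^bsub>Mor A Z Z\<^esub> Dif A Z Z h) \<and>
    (\<exists>a\<in>Gr A X X (-1). \<exists>b\<in>Gr A X Y (-2). \<exists>c\<in>Gr A Y X 0. \<exists>e\<in>Gr A Y Y (-1).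
      Cmp A X Z X p s
        = Idt A X \<oplus>\<^bsub>Mor A X X\<^esub> (Cmp A X Y X c f \<ominus>\<^bsub>Mor A X X\<^esub> Dif A X X a) \<and>
      Cmp A Y Z X p i = \<ominus>\<^bsub>Mor A Y X\<^esub> Dif A Y X c \<and>
      Cmp A X Z Y q s
        = (Cmp A X X Y f a \<oplus>\<^bsub>Mor A X Y\<^esub> Cmp A X Y Y e f) \<oplus>\<^bsub>Mor A X Y\<^esub> Dif A X Y b \<and>
      Cmp A Y Z Y q i
        = Idt A Y \<oplus>\<^bsub>Mor A Y Y\<^esub> (Cmp A Y X Y f c \<oplus>\<^bsub>Mor A Y Y\<^esub> Dif A Y Y e))"

locale pretriangulated_dg_category = dg_category K A
  for K :: "'k ring" and A :: "('k, 'o, 'm, 'y) dgcat_scheme" +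
  assumes nonempty: "Ob A \<noteq> {}"
    and ex_shift: "\<And>X n. X \<in> Ob A \<Longrightarrow> \<exists>Z \<sigma> \<tau>. is_shift A n X Z \<sigma> \<tau>"
    and ex_cone: "\<And>X Y f. \<lbrakk>X \<in> Ob A; Y \<in> Ob A; f \<in> cyc A X Y 0\<rbrakk>
      \<Longrightarrow> \<exists>Z i s p q. is_cone A X Y f Z i s p q"


section \<open>The homotopy category\<close>

text \<open>Morphisms of \<open>H0 A\<close> are cohomology classes, that is, sets of closed degree \<open>0\<close> morphisms;
  operations on classes are defined through representatives.\<close>

definition hcls :: "('k, 'o, 'm, 'y) dgcat_scheme \<Rightarrow> 'o \<Rightarrow> 'o \<Rightarrow> 'm \<Rightarrow> 'm set" where
  "hcls A X Y f = {g \<in> cyc A X Y 0. \<exists>h\<in>Gr A X Y (-1). g = f \<oplus>\<^bsub>Mor A X Y\<^esub> Dif A X Y h}"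

definition H0_Mor :: "('k, 'o, 'm, 'y) dgcat_scheme \<Rightarrow> 'o \<Rightarrow> 'o \<Rightarrow> ('k, 'm set) module" where
  "H0_Mor A X Y = \<lparr>carrier = hcls A X Y ` cyc A X Y 0,
    mult = undefined, one = undefined,
    zero = hcls A X Y \<zero>\<^bsub>Mor A X Y\<^esub>,
    add = (\<lambda>U V. \<Union>f\<in>U. \<Union>g\<in>V. hcls A X Y (f \<oplus>\<^bsub>Mor A X Y\<^esub> g)),
    smult = (\<lambda>a U. \<Union>f\<in>U. hcls A X Y (a \<odot>\<^bsub>Mor A X Y\<^esub> f))\<rparr>"

definition shift_choice :: "('k, 'o, 'm, 'y) dgcat_scheme \<Rightarrow> int \<Rightarrow> 'o \<Rightarrow> 'o \<times> 'm \<times> 'm" where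
  "shift_choice A n X = (SOME (Z, \<sigma>, \<tau>). is_shift A n X Z \<sigma> \<tau>)"

definition sh_ob :: "('k, 'o, 'm, 'y) dgcat_scheme \<Rightarrow> int \<Rightarrow> 'o \<Rightarrow> 'o" where
  "sh_ob A n X = fst (shift_choice A n X)"

definition sh_to :: "('k, 'o, 'm, 'y) dgcat_scheme \<Rightarrow> int \<Rightarrow> 'o \<Rightarrow> 'm" where
  "sh_to A n X = fst (snd (shift_choice A n X))"

definition sh_from :: "('k, 'o, 'm, 'y) dgcat_scheme \<Rightarrow> int \<Rightarrow> 'o \<Rightarrow> 'm" where
  "sh_from A n X = snd (snd (shift_choice A n X))"

definition H0_shift :: "('k, 'o, 'm, 'y) dgcat_scheme \<Rightarrow> int \<Rightarrow> ('o, 'm set, 'o, 'm set) cfun" where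
  "H0_shift A n = \<lparr>onOb = sh_ob A n,
    onMor = (\<lambda>X Y U. \<Union>f\<in>U. hcls A (sh_ob A n X) (sh_ob A n Y)
      (Cmp A (sh_ob A n X) X (sh_ob A n Y)
        (Cmp A X Y (sh_ob A n Y) (sh_to A n Y) f) (sh_from A n X)))\<rparr>"

text \<open>The exact triangles of \<open>H0 A\<close> are those isomorphic to a standard triangle
  \<open>X \<rightarrow> Y \<rightarrow> Z \<rightarrow> X[1]\<close> with \<open>Z\<close> a cone of \<open>f : X \<rightarrow> Y\<close>.\<close>

definition H0_base :: "('k, 'o, 'm, 'y) dgcat_scheme \<Rightarrow> ('k, 'o, 'm set) tricat" where
  "H0_base A = \<lparr>Ob = Ob A, Mor = H0_Mor A,
    Cmp = (\<lambda>X Y Z V U. \<Union>g\<in>V. \<Union>f\<in>U. hcls A X Z (Cmp A X Y Z g f)),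
    Idt = (\<lambda>X. hcls A X X (Idt A X)),
    Shift = H0_shift A 1, Unshift = H0_shift A (-1),
    Tri = (\<lambda>_ _ _ _ _ _. False)\<rparr>"

definition H0 :: "('k, 'o, 'm, 'y) dgcat_scheme \<Rightarrow> ('k, 'o, 'm set) tricat" where
  "H0 A = (H0_base A)\<lparr>Tri := (\<lambda>X' Y' Z' f' g' h'. \<exists>X Y Z f i s p q.
    is_cone A X Y f Z i s p q \<and>
    tri_iso (H0_base A) X Y Z (hcls A X Y f) (hcls A Y Z i)
      (hcls A Z (sh_ob A 1 X) (Cmp A Z X (sh_ob A 1 X) (sh_to A 1 X) p))
      X' Y' Z' f' g' h')\<rparr>"


section \<open>Dg enhancements, dg lifts and functorial cones\<close>

definition dg_functor :: "'k ring \<Rightarrow> ('k, 'o, 'm, 'y) dgcat_scheme \<Rightarrow>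
    ('k, 'p, 'n, 'w) dgcat_scheme \<Rightarrow> ('o, 'm, 'p, 'n) cfun \<Rightarrow> bool" where
  "dg_functor K A B F \<longleftrightarrow> linear_functor K A B F \<and>
    (\<forall>X\<in>Ob A. \<forall>Y\<in>Ob A. \<forall>n. \<forall>f\<in>Gr A X Y n. onMor F X Y f \<in> Gr B (onOb F X) (onOb F Y) n) \<and>
    (\<forall>X\<in>Ob A. \<forall>Y\<in>Ob A. \<forall>f\<in>arr A X Y.
      onMor F X Y (Dif A X Y f) = Dif B (onOb F X) (onOb F Y) (onMor F X Y f))"

definition dg_trans :: "('k, 'o, 'm, 'y) dgcat_scheme \<Rightarrow> ('k, 'p, 'n, 'w) dgcat_scheme \<Rightarrow> int \<Rightarrow>
    ('o, 'm, 'p, 'n) cfun \<Rightarrow> ('o, 'm, 'p, 'n) cfun \<Rightarrow> ('o \<Rightarrow> 'n) \<Rightarrow> bool" where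
  "dg_trans A B k F G \<alpha> \<longleftrightarrow>
    (\<forall>X\<in>Ob A. \<alpha> X \<in> Gr B (onOb F X) (onOb G X) k) \<and>
    (\<forall>X\<in>Ob A. \<forall>Y\<in>Ob A. \<forall>n. \<forall>f\<in>Gr A X Y n.
      Cmp B (onOb F X) (onOb F Y) (onOb G Y) (\<alpha> Y) (onMor F X Y f)
      = signed (Mor B (onOb F X) (onOb G Y)) (k * n)
          (Cmp B (onOb F X) (onOb G X) (onOb G Y) (onMor G X Y f) (\<alpha> X)))"

definition H0_fun :: "('k, 'p, 'n, 'w) dgcat_scheme \<Rightarrow> ('o, 'm, 'p, 'n) cfun \<Rightarrow>
    ('o, 'm set, 'p, 'n set) cfun" where
  "H0_fun B F = \<lparr>onOb = onOb F,
    onMor = (\<lambda>X Y U. \<Union>f\<in>U. hcls B (onOb F X) (onOb F Y) (onMor F X Y f))\<rparr>"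

definition dg_enhancement :: "'k ring \<Rightarrow> ('k, 'o, 'm, 'y) dgcat_scheme \<Rightarrow>
    ('k, 'p, 'n, 'w) tricat_scheme \<Rightarrow> ('o, 'm set, 'p, 'n) cfun \<Rightarrow> bool" where
  "dg_enhancement K A T E \<longleftrightarrow> pretriangulated_dg_category K A \<and> exact_equivalence K (H0 A) T E"

text \<open>\<open>dg_lift K A E1 B T2 E2 \<Phi> F \<pi>\<close>: for enhancements \<open>E1 : H0 A \<rightarrow> T1\<close> and
  \<open>E2 : H0 B \<rightarrow> T2\<close>, the dg functor \<open>F : A \<rightarrow> B\<close> lifts \<open>\<Phi> : T1 \<rightarrow> T2\<close>, as witnessed by the natural
  isomorphism \<open>\<pi>\<close> from \<open>E2 H0(F)\<close> to \<open>\<Phi> E1\<close>.\<close>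

definition dg_lift :: "'k ring \<Rightarrow>
    ('k, 'oa, 'ma, 'ya) dgcat_scheme \<Rightarrow> ('oa, 'ma set, 'o, 'm) cfun \<Rightarrow>
    ('k, 'ob, 'mb, 'yb) dgcat_scheme \<Rightarrow> ('k, 'p, 'n, 'w) tricat_scheme \<Rightarrow> ('ob, 'mb set, 'p, 'n) cfun \<Rightarrow>
    ('o, 'm, 'p, 'n) cfun \<Rightarrow> ('oa, 'ma, 'ob, 'mb) cfun \<Rightarrow> ('oa \<Rightarrow> 'n) \<Rightarrow> bool" where
  "dg_lift K A E1 B T2 E2 \<Phi> F \<pi> \<longleftrightarrow> dg_functor K A B F \<and>
    nat_iso (H0 A) T2 (E2 \<circ>\<^sub>F H0_fun B F) (\<Phi> \<circ>\<^sub>F E1) \<pi>"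

definition has_dg_lift :: "'k ring \<Rightarrow>
    ('k, 'oa, 'ma, 'ya) dgcat_scheme \<Rightarrow> ('oa, 'ma set, 'o, 'm) cfun \<Rightarrow>
    ('k, 'ob, 'mb, 'yb) dgcat_scheme \<Rightarrow> ('k, 'p, 'n, 'w) tricat_scheme \<Rightarrow> ('ob, 'mb set, 'p, 'n) cfun \<Rightarrow>
    ('o, 'm, 'p, 'n) cfun \<Rightarrow> bool" where
  "has_dg_lift K A E1 B T2 E2 \<Phi> \<longleftrightarrow> (\<exists>F \<pi>. dg_lift K A E1 B T2 E2 \<Phi> F \<pi>)"

text \<open>
  \<open>\<Theta>\<close> is a cone of the natural transformation \<open>\<alpha> : \<Phi> \<rightarrow> \<Psi>\<close>: there are dg lifts \<open>F\<close>, \<open>G\<close> of \<open>\<Phi>\<close>,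
  \<open>\<Psi>\<close> and a closed degree \<open>0\<close> dg transformation \<open>a : F \<rightarrow> G\<close> inducing \<open>\<alpha>\<close>, and \<open>\<Theta>\<close> is lifted by a
  dg functor \<open>H\<close> representing the cone of \<open>a\<close>.  The latter means that there is a closed morphism
  from the cone of \<open>a\<close> to \<open>H\<close>, with components \<open>s\<close> (dg natural of degree \<open>-1\<close>) and \<open>i\<close> (dg natural of
  degree \<open>0\<close>), that is a homotopy equivalence at each object.  The lifts of
  \<open>\<Phi>\<close> and \<open>\<Psi>\<close> are arbitrary; in particular, the identity functor may be lifted by a dg functor
  other than the identity (e.g. a bar resolution).
\<close>

definition functorial_cone :: "'k ring \<Rightarrow>
    ('k, 'oa, 'ma, 'ya) dgcat_scheme \<Rightarrow> ('oa, 'ma set, 'o, 'm) cfun \<Rightarrow>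
    ('k, 'ob, 'mb, 'yb) dgcat_scheme \<Rightarrow> ('k, 'p, 'n, 'w) tricat_scheme \<Rightarrow> ('ob, 'mb set, 'p, 'n) cfun \<Rightarrow>
    ('o, 'm, 'p, 'n) cfun \<Rightarrow> ('o, 'm, 'p, 'n) cfun \<Rightarrow> ('o \<Rightarrow> 'n) \<Rightarrow> ('o, 'm, 'p, 'n) cfun \<Rightarrow> bool" where
  "functorial_cone K A E1 B T2 E2 \<Phi> \<Psi> \<alpha> \<Theta> \<longleftrightarrow>
    (\<exists>F \<pi> G \<rho> H \<theta> a i s.
      dg_lift K A E1 B T2 E2 \<Phi> F \<pi> \<and> dg_lift K A E1 B T2 E2 \<Psi> G \<rho> \<and>
      dg_lift K A E1 B T2 E2 \<Theta> H \<theta> \<and>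
      dg_trans A B 0 F G a \<and>
      (\<forall>X\<in>Ob A. Dif B (onOb F X) (onOb G X) (a X) = \<zero>\<^bsub>Mor B (onOb F X) (onOb G X)\<^esub>) \<and>
      (\<forall>X\<in>Ob A.
        Cmp T2 (onOb E2 (onOb F X)) (onOb E2 (onOb G X)) (onOb \<Psi> (onOb E1 X))
          (\<rho> X) (onMor E2 (onOb F X) (onOb G X) (hcls B (onOb F X) (onOb G X) (a X)))
        = Cmp T2 (onOb E2 (onOb F X)) (onOb \<Phi> (onOb E1 X)) (onOb \<Psi> (onOb E1 X))
          (\<alpha> (onOb E1 X)) (\<pi> X)) \<and>
      dg_trans A B 0 G H i \<and> dg_trans A B (-1) F H s \<and>
      (\<forall>X\<in>Ob A. \<exists>p q. is_cone B (onOb F X) (onOb G X) (a X) (onOb H X) (i X) (s X) p q))"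


section \<open>Spherical functors\<close>

text \<open>
  \<open>C\<close> and \<open>D\<close> are enhanced by \<open>EC : H0 A \<rightarrow> C\<close> and \<open>ED : H0 B \<rightarrow> D\<close>; \<open>T\<close> and \<open>W\<close> are the twist
  and cotwist functors.  The exact functors under consideration are those with dg lifts between the
  enhancements; exactness of the adjoints is automatic but stated.  For a functor \<open>\<Phi>\<close>, the shifted functor \<open>\<Phi>[n]\<close> is \<open>\<Phi>\<close> followed by \<open>[n]\<close>.
\<close>

locale spherical_functor =
  fixes K :: "'k ring"
    and A :: "('k, 'oa, 'ma) dgcat" and C :: "('k, 'oc, 'mc) tricat"
    and EC :: "('oa, 'ma set, 'oc, 'mc) cfun"
    and B :: "('k, 'ob, 'mb) dgcat" and D :: "('k, 'od, 'md) tricat"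
    and ED :: "('ob, 'mb set, 'od, 'md) cfun"
    and S :: "('oc, 'mc, 'od, 'md) cfun"
    and R L :: "('od, 'md, 'oc, 'mc) cfun"
    and \<eta> :: "'oc \<Rightarrow> 'mc" and \<epsilon> :: "'od \<Rightarrow> 'md"
    and T :: "('od, 'md, 'od, 'md) cfun" and W :: "('oc, 'mc, 'oc, 'mc) cfun"
  assumes exact_S: "exact_functor K C D S"
    and exact_R: "exact_functor K D C R"
    and exact_L: "exact_functor K D C L"
    and lift_S: "has_dg_lift K A EC B D ED S"
    and lift_R: "has_dg_lift K B ED A C EC R"
    and lift_L: "has_dg_lift K B ED A C EC L"
    and lift_T: "has_dg_lift K B ED B D ED T"
    and lift_W: "has_dg_lift K A EC A C EC W"
    and right_adjoint: "adjunction K C D S R \<eta> \<epsilon>"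
    and left_adjoint: "\<exists>\<eta>' \<epsilon>'. adjunction K D C L S \<eta>' \<epsilon>'"
    and twist: "functorial_cone K B ED B D ED (S \<circ>\<^sub>F R) idfun \<epsilon> T"
    and twist_autoequivalence: "exact_equivalence K D D T"
    and cotwist: "\<exists>V. functorial_cone K A EC A C EC idfun (R \<circ>\<^sub>F S) \<eta> V \<and>
      fun_iso C C W (shift_by C (-1) \<circ>\<^sub>F V)"
    and cotwist_autoequivalence: "exact_equivalence K C C W"
    and R_iso_L_twist: "fun_iso D C R (shift_by C (-1) \<circ>\<^sub>F (L \<circ>\<^sub>F T))"
    and R_iso_cotwist_L: "fun_iso D C R (shift_by C 1 \<circ>\<^sub>F (W \<circ>\<^sub>F L))"

end

theory Submission
  imports Defs "HOL-Real_Asymp.Real_Asymp"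
begin

text \<open>
  The isomorphisms \<open>R \<cong> L T[-1]\<close> and \<open>R \<cong> W L[1]\<close> give \<open>R T \<cong> W[2] R\<close>, where \<open>T\<close> is the twist and \<open>W\<close>
  the cotwist.  The defining triangle of the twist at \<open>T\<^sup>n G\<close> therefore exhibits \<open>T\<^sup>n\<^sup>+\<^sup>1 G\<close> as an
  extension of \<open>S (W[2])\<^sup>n R G [1]\<close> by \<open>T\<^sup>n G\<close>.  Complexity is subadditive along extensions,
  submultiplicative, and does not increase under exact functors, so for split-generators \<open>G\<close> of \<open>D\<close>
  and \<open>G'\<close> of \<open>C\<close> the complexity of \<open>T\<^sup>n G\<close> is at most a constant plus a constant multiple of the sum of
  the complexities of \<open>(W[2])\<^sup>k G'\<close> over \<open>k < n\<close>; such a sum grows at rate at most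
  \<open>max 0 (h\<^sub>t(W[2]))\<close>.  The argument uses only the existence of triangles between given
  objects, not their maps.
\<close>

section \<open>Linear categories\<close>

text \<open>A generation sequence only reaches F plus an unspecified complement, so every estimate
  has to survive passage to summands. The proof carries retracts instead of complements: retracts
  compose and are preserved by functors without any bookkeeping, and in a triangulated category a
  retract is the same thing as a direct summand. The delicate point is to enlarge the middle term of
  a triangle when its outer terms are retracts of larger objects, because the maps supplied by TR3
  are not functorial. A second obstacle is that \<open>entropy\<close> is a definite description: it
  carries no information until the limit is known to exist for every split-generator and not to
  depend on it. Both facts come from submultiplicativity of the complexity. The bound 0 in the
  theorem has its origin in the summation: even if the complexities of the cotwist powers decay, the
  initial term, the complexity of G with respect to itself, remains as an additive constant, whose
  growth rate is 0.\<close>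

definition retract :: "('k, 'o, 'm, 'y) lincat_scheme \<Rightarrow> 'o \<Rightarrow> 'o \<Rightarrow> bool" where
  "retract C X P \<longleftrightarrow> X \<in> Ob C \<and> P \<in> Ob C \<and>
    (\<exists>i\<in>arr C X P. \<exists>p\<in>arr C P X. Cmp C X P X p i = Idt C X)"

context linear_category
begin

lemma abelian_group_Mor: "\<lbrakk>X \<in> Ob C; Y \<in> Ob C\<rbrakk> \<Longrightarrow> abelian_group (Mor C X Y)"
  using module_Mor module.axioms(2) by blast

lemma zero_closed: "\<lbrakk>X \<in> Ob C; Y \<in> Ob C\<rbrakk> \<Longrightarrow> \<zero>\<^bsub>Mor C X Y\<^esub> \<in> arr C X Y"
  by (meson abelian_group_Mor abelian_group.axioms(1) abelian_monoid.zero_closed)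

lemma minus_closed: "\<lbrakk>X \<in> Ob C; Y \<in> Ob C; f \<in> arr C X Y\<rbrakk> \<Longrightarrow> \<ominus>\<^bsub>Mor C X Y\<^esub> f \<in> arr C X Y"
  by (meson abelian_group_Mor abelian_group.a_inv_closed)

lemma Cmp_zero_right:
  assumes "X \<in> Ob C" "Y \<in> Ob C" "Z \<in> Ob C" "g \<in> arr C Y Z"
  shows "Cmp C X Y Z g \<zero>\<^bsub>Mor C X Y\<^esub> = \<zero>\<^bsub>Mor C X Z\<^esub>"
proof -
  interpret XY: abelian_group "Mor C X Y" using assms abelian_group_Mor by blast
  interpret XZ: abelian_group "Mor C X Z" using assms abelian_group_Mor by blast
  have "Cmp C X Y Z g \<zero>\<^bsub>Mor C X Y\<^esub> = Cmp C X Y Z g \<zero>\<^bsub>Mor C X Y\<^esub> \<oplus>\<^bsub>Mor C X Z\<^esub> Cmp C X Y Z g \<zero>\<^bsub>Mor C X Y\<^esub>"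
    using Cmp_add_right[OF assms(1-3) XY.zero_closed XY.zero_closed assms(4)] by simp
  then show ?thesis using assms by (simp add: Cmp_closed XZ.add.l_cancel_one')
qed

lemma Cmp_zero_left:
  assumes "X \<in> Ob C" "Y \<in> Ob C" "Z \<in> Ob C" "f \<in> arr C X Y"
  shows "Cmp C X Y Z \<zero>\<^bsub>Mor C Y Z\<^esub> f = \<zero>\<^bsub>Mor C X Z\<^esub>"
proof -
  interpret YZ: abelian_group "Mor C Y Z" using assms abelian_group_Mor by blast
  interpret XZ: abelian_group "Mor C X Z" using assms abelian_group_Mor by blast
  have "Cmp C X Y Z \<zero>\<^bsub>Mor C Y Z\<^esub> f = Cmp C X Y Z \<zero>\<^bsub>Mor C Y Z\<^esub> f \<oplus>\<^bsub>Mor C X Z\<^esub> Cmp C X Y Z \<zero>\<^bsub>Mor C Y Z\<^esub> f"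
    using Cmp_add_left[OF assms(1-4) YZ.zero_closed YZ.zero_closed] by simp
  then show ?thesis using assms by (simp add: Cmp_closed XZ.add.l_cancel_one')
qed

lemma Cmp_minus_right:
  assumes "X \<in> Ob C" "Y \<in> Ob C" "Z \<in> Ob C" "f \<in> arr C X Y" "g \<in> arr C Y Z"
  shows "Cmp C X Y Z g (\<ominus>\<^bsub>Mor C X Y\<^esub> f) = \<ominus>\<^bsub>Mor C X Z\<^esub> Cmp C X Y Z g f"
proof -
  interpret XY: abelian_group "Mor C X Y" using assms abelian_group_Mor by blast
  interpret XZ: abelian_group "Mor C X Z" using assms abelian_group_Mor by blast
  have "Cmp C X Y Z g (\<ominus>\<^bsub>Mor C X Y\<^esub> f) \<oplus>\<^bsub>Mor C X Z\<^esub> Cmp C X Y Z g f = \<zero>\<^bsub>Mor C X Z\<^esub>"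
    using Cmp_add_right[OF assms(1-3) _ assms(4,5), of "\<ominus>\<^bsub>Mor C X Y\<^esub> f"] assms
    by (simp add: XY.l_neg Cmp_zero_right)
  then show ?thesis using assms XZ.minus_equality by (simp add: Cmp_closed)
qed

lemma Cmp_minus_left:
  assumes "X \<in> Ob C" "Y \<in> Ob C" "Z \<in> Ob C" "f \<in> arr C X Y" "g \<in> arr C Y Z"
  shows "Cmp C X Y Z (\<ominus>\<^bsub>Mor C Y Z\<^esub> g) f = \<ominus>\<^bsub>Mor C X Z\<^esub> Cmp C X Y Z g f"
proof -
  interpret YZ: abelian_group "Mor C Y Z" using assms abelian_group_Mor by blast
  interpret XZ: abelian_group "Mor C X Z" using assms abelian_group_Mor by blast
  have "Cmp C X Y Z (\<ominus>\<^bsub>Mor C Y Z\<^esub> g) f \<oplus>\<^bsub>Mor C X Z\<^esub> Cmp C X Y Z g f = \<zero>\<^bsub>Mor C X Z\<^esub>"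
    using Cmp_add_left[OF assms(1-4) _ assms(5), of "\<ominus>\<^bsub>Mor C Y Z\<^esub> g"] assms
    by (simp add: YZ.l_neg Cmp_zero_left)
  then show ?thesis using assms XZ.minus_equality by (simp add: Cmp_closed)
qed

text \<open>Rebracketing the fourfold composite lets q and j meet and cancel. Split pairs and
  inverse isomorphisms are both composed in this shape.\<close>

lemma Cmp_cancel_middle:
  assumes "W \<in> Ob C" "X \<in> Ob C" "Y \<in> Ob C" "Z \<in> Ob C"
    "i \<in> arr C W X" "j \<in> arr C X Y" "q \<in> arr C Y X" "p \<in> arr C X Z" "Cmp C X Y X q j = Idt C X"
  shows "Cmp C W Y Z (Cmp C Y X Z p q) (Cmp C W X Y j i) = Cmp C W X Z p i"
proof -
  have "Cmp C W Y Z (Cmp C Y X Z p q) (Cmp C W X Y j i) = Cmp C W X Z (Cmp C X Y Z (Cmp C Y X Z p q) j) i"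
    using assms(1-8) by (simp add: Cmp_assoc Cmp_closed)
  also have "Cmp C X Y Z (Cmp C Y X Z p q) j = p"
    using assms by (simp add: Cmp_Idt_right flip: Cmp_assoc)
  finally show ?thesis .
qed

section \<open>Isomorphisms, retracts and zero objects\<close>

lemma is_iso_Idt: "X \<in> Ob C \<Longrightarrow> is_iso C X X (Idt C X)"
  unfolding is_iso_def by (auto intro!: bexI[of _ "Idt C X"] simp: Idt_closed Cmp_Idt_left)

lemma retract_trans:
  assumes "retract C X Y" "retract C Y Z"
  shows "retract C X Z"
proof -
  obtain i p j q where *: "X \<in> Ob C" "Y \<in> Ob C" "Z \<in> Ob C"
    "i \<in> arr C X Y" "p \<in> arr C Y X" "Cmp C X Y X p i = Idt C X"
    "j \<in> arr C Y Z" "q \<in> arr C Z Y" "Cmp C Y Z Y q j = Idt C Y"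
    using assms unfolding retract_def by blast
  have "Cmp C X Z X (Cmp C Z Y X p q) (Cmp C X Y Z j i) = Idt C X"
    using * by (simp add: Cmp_cancel_middle)
  then show ?thesis unfolding retract_def using * Cmp_closed by metis
qed

lemma is_iso_inverse:
  assumes "is_iso C X Y f" "X \<in> Ob C" "Y \<in> Ob C"
  obtains g where "is_iso C Y X g" "g \<in> arr C Y X" "f \<in> arr C X Y"
    "Cmp C X Y X g f = Idt C X" "Cmp C Y X Y f g = Idt C Y"
  using assms unfolding is_iso_def by blast

lemma is_iso_Cmp:
  assumes "is_iso C X Y f" "is_iso C Y Z g" "X \<in> Ob C" "Y \<in> Ob C" "Z \<in> Ob C"
  shows "is_iso C X Z (Cmp C X Y Z g f)"
proof -
  obtain f' where f: "f' \<in> arr C Y X" "f \<in> arr C X Y" "Cmp C X Y X f' f = Idt C X" "Cmp C Y X Y f f' = Idt C Y"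
    using is_iso_inverse[OF assms(1)] assms by metis
  obtain g' where g: "g' \<in> arr C Z Y" "g \<in> arr C Y Z" "Cmp C Y Z Y g' g = Idt C Y" "Cmp C Z Y Z g g' = Idt C Z"
    using is_iso_inverse[OF assms(2)] assms by metis
  have "Cmp C X Z X (Cmp C Z Y X f' g') (Cmp C X Y Z g f) = Idt C X"
    "Cmp C Z X Z (Cmp C X Y Z g f) (Cmp C Z Y X f' g') = Idt C Z"
    using f g assms by (simp_all add: Cmp_cancel_middle)
  then show ?thesis unfolding is_iso_def using f g assms
    by (auto simp: Cmp_closed Cmp_Idt_left intro!: bexI[of _ "Cmp C Z Y X f' g'"])
qed

lemma iso_refl: "X \<in> Ob C \<Longrightarrow> iso_objects C X X"
  unfolding iso_objects_def using is_iso_Idt by blast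

lemma iso_sym: "iso_objects C X Y \<Longrightarrow> iso_objects C Y X"
  unfolding iso_objects_def using is_iso_inverse by metis

lemma iso_trans: "\<lbrakk>iso_objects C X Y; iso_objects C Y Z\<rbrakk> \<Longrightarrow> iso_objects C X Z"
  unfolding iso_objects_def using is_iso_Cmp by metis

lemma iso_retract: "iso_objects C X Y \<Longrightarrow> retract C X Y"
  unfolding iso_objects_def retract_def by (metis is_iso_inverse)

lemma retract_refl: "X \<in> Ob C \<Longrightarrow> retract C X X"
  by (simp add: iso_refl iso_retract)

text \<open>Every map into or out of Z factors through the identity of Z. The criterion is a single
  equation, so additive functors visibly preserve it.\<close>

lemma is_zero_iff: "is_zero C Z \<longleftrightarrow> Z \<in> Ob C \<and> Idt C Z = \<zero>\<^bsub>Mor C Z Z\<^esub>"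
proof (intro iffI conjI)
  assume "is_zero C Z" then show "Z \<in> Ob C" by (simp add: is_zero_def)
  with \<open>is_zero C Z\<close> show "Idt C Z = \<zero>\<^bsub>Mor C Z Z\<^esub>"
    unfolding is_zero_def using Idt_closed by blast
next
  assume *: "Z \<in> Ob C \<and> Idt C Z = \<zero>\<^bsub>Mor C Z Z\<^esub>"
  have "f = \<zero>\<^bsub>Mor C X Z\<^esub>" if "X \<in> Ob C" "f \<in> arr C X Z" for X f
    using Cmp_Idt_left[of X Z f] Cmp_zero_left[of X Z Z f] that * by simp
  moreover have "f = \<zero>\<^bsub>Mor C Z X\<^esub>" if "X \<in> Ob C" "f \<in> arr C Z X" for X f
    using Cmp_Idt_right[of Z X f] Cmp_zero_right[of Z Z X f] that * by simp
  ultimately show "is_zero C Z" unfolding is_zero_def using * zero_closed by blast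
qed

lemma is_zero_retract:
  assumes "retract C X Z" "is_zero C Z"
  shows "is_zero C X"
proof -
  obtain i p where *: "X \<in> Ob C" "Z \<in> Ob C"
    "i \<in> arr C X Z" "p \<in> arr C Z X" "Cmp C X Z X p i = Idt C X"
    using assms unfolding retract_def by blast
  then have "i = \<zero>\<^bsub>Mor C X Z\<^esub>" using assms(2) unfolding is_zero_def by blast
  then show ?thesis using * Cmp_zero_right is_zero_iff by metis
qed

lemma is_zero_iso_cong: "\<lbrakk>iso_objects C X Z; is_zero C Z\<rbrakk> \<Longrightarrow> is_zero C X"
  using is_zero_retract iso_retract by blast

lemma zero_arr_eq:
  assumes "is_zero C Z" "X \<in> Ob C"
  shows "f \<in> arr C X Z \<Longrightarrow> f = \<zero>\<^bsub>Mor C X Z\<^esub>" "f \<in> arr C Z X \<Longrightarrow> f = \<zero>\<^bsub>Mor C Z X\<^esub>"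
  using assms unfolding is_zero_def by blast+

text \<open>With e = 1 + x and x^2 = 0, the left inverse is 1 - x.\<close>

lemma unipotent_left_inverse:
  assumes X: "X \<in> Ob C" and e: "e \<in> arr C X X"
    and sq: "Cmp C X X X (e \<ominus>\<^bsub>Mor C X X\<^esub> Idt C X) (e \<ominus>\<^bsub>Mor C X X\<^esub> Idt C X) = \<zero>\<^bsub>Mor C X X\<^esub>"
  shows "\<exists>e'\<in>arr C X X. Cmp C X X X e' e = Idt C X"
proof -
  interpret M: abelian_group "Mor C X X" using X abelian_group_Mor by blast
  define x where "x = e \<ominus>\<^bsub>Mor C X X\<^esub> Idt C X"
  have id: "Idt C X \<in> arr C X X" using X by (rule Idt_closed)
  have x: "x \<in> arr C X X" using e id by (simp add: x_def)
  have ex: "e = Idt C X \<oplus>\<^bsub>Mor C X X\<^esub> x"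
    using e id by (simp add: x_def M.minus_eq M.r_neg1 M.a_lcomm M.r_neg)
  have xe: "Cmp C X X X x e = x"
    using X x id sq[folded x_def] by (simp add: ex Cmp_add_right Cmp_Idt_right)
  have "Cmp C X X X (Idt C X \<ominus>\<^bsub>Mor C X X\<^esub> x) e = e \<oplus>\<^bsub>Mor C X X\<^esub> \<ominus>\<^bsub>Mor C X X\<^esub> x"
    using X x id e by (simp add: M.minus_eq Cmp_add_left Cmp_minus_left Cmp_Idt_left xe)
  also have "\<dots> = Idt C X" using x id by (simp add: ex M.a_assoc M.r_neg)
  finally show ?thesis using x id M.minus_closed by blast
qed

end

lemma (in linear_functor) is_iso_onMor:
  assumes "is_iso C X Y f" "X \<in> Ob C" "Y \<in> Ob C"
  shows "is_iso D (onOb F X) (onOb F Y) (onMor F X Y f)"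
proof -
  obtain g where g: "f \<in> arr C X Y" "g \<in> arr C Y X" "Cmp C X Y X g f = Idt C X" "Cmp C Y X Y f g = Idt C Y"
    using assms(1) unfolding is_iso_def by blast
  then have "Cmp D (onOb F X) (onOb F Y) (onOb F X) (onMor F Y X g) (onMor F X Y f) = Idt D (onOb F X)"
    "Cmp D (onOb F Y) (onOb F X) (onOb F Y) (onMor F X Y f) (onMor F Y X g) = Idt D (onOb F Y)"
    using assms by (metis onMor_Cmp onMor_Idt)+
  then show ?thesis unfolding is_iso_def using g assms by (auto simp: onMor_closed)
qed

lemma (in linear_functor) iso_objects_onOb:
  "iso_objects C X Y \<Longrightarrow> iso_objects D (onOb F X) (onOb F Y)"
  unfolding iso_objects_def using is_iso_onMor onOb_closed by blast

lemma (in linear_functor) retract_onOb: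
  assumes "retract C X Y" shows "retract D (onOb F X) (onOb F Y)"
proof -
  obtain i p where *: "X \<in> Ob C" "Y \<in> Ob C"
    "i \<in> arr C X Y" "p \<in> arr C Y X" "Cmp C X Y X p i = Idt C X"
    using assms unfolding retract_def by blast
  then have "Cmp D (onOb F X) (onOb F Y) (onOb F X) (onMor F Y X p) (onMor F X Y i) = Idt D (onOb F X)"
    by (metis onMor_Cmp onMor_Idt)
  then show ?thesis unfolding retract_def using * by (auto simp: onOb_closed intro!: bexI onMor_closed)
qed

lemma linear_functor_zero:
  assumes "linear_category K C" "linear_category K D" "linear_functor K C D F"
    and X: "X \<in> Ob C" "Y \<in> Ob C"
  shows "onMor F X Y \<zero>\<^bsub>Mor C X Y\<^esub> = \<zero>\<^bsub>Mor D (onOb F X) (onOb F Y)\<^esub>"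
proof -
  interpret C: linear_category K C by fact
  interpret D: linear_category K D by fact
  interpret F: linear_functor K C D F by fact
  interpret M: abelian_group "Mor C X Y" using X by (rule C.abelian_group_Mor)
  interpret N: abelian_group "Mor D (onOb F X) (onOb F Y)" using X F.onOb_closed D.abelian_group_Mor by blast
  have "onMor F X Y \<zero>\<^bsub>Mor C X Y\<^esub> = onMor F X Y \<zero>\<^bsub>Mor C X Y\<^esub> \<oplus>\<^bsub>Mor D (onOb F X) (onOb F Y)\<^esub> onMor F X Y \<zero>\<^bsub>Mor C X Y\<^esub>"
    using F.onMor_add[OF X M.zero_closed M.zero_closed] by simp
  then show ?thesis using X by (simp add: F.onMor_closed N.add.l_cancel_one')
qed

lemma linear_functor_is_zero:
  assumes "linear_category K C" "linear_category K D" "linear_functor K C D F" "is_zero C Z"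
  shows "is_zero D (onOb F Z)"
  using linear_functor_zero[OF assms(1-3), of Z Z] assms
  by (metis linear_category.is_zero_iff linear_functor.onMor_Idt linear_functor.onOb_closed)

section \<open>Equivalences are full and faithful\<close>

context linear_category
begin

lemma iso_cancel_left:
  assumes "is_iso C Y Z g" "X \<in> Ob C" "Y \<in> Ob C" "Z \<in> Ob C" "f \<in> arr C X Y" "f' \<in> arr C X Y"
    "Cmp C X Y Z g f = Cmp C X Y Z g f'"
  shows "f = f'"
proof -
  obtain k where k: "k \<in> arr C Z Y" "g \<in> arr C Y Z" "Cmp C Y Z Y k g = Idt C Y"
    using is_iso_inverse[OF assms(1)] assms by metis
  then have "Cmp C X Z Y k (Cmp C X Y Z g a) = a" if "a \<in> arr C X Y" for a
    using that assms by (simp add: Cmp_assoc Cmp_Idt_left)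
  with assms(5-) show ?thesis by metis
qed

lemma iso_cancel_right:
  assumes "is_iso C X Y g" "X \<in> Ob C" "Y \<in> Ob C" "Z \<in> Ob C" "f \<in> arr C Y Z" "f' \<in> arr C Y Z"
    "Cmp C X Y Z f g = Cmp C X Y Z f' g"
  shows "f = f'"
proof -
  obtain k where k: "k \<in> arr C Y X" "g \<in> arr C X Y" "Cmp C Y X Y g k = Idt C Y"
    using is_iso_inverse[OF assms(1)] assms by metis
  then have "Cmp C Y X Z (Cmp C X Y Z a g) k = a" if "a \<in> arr C Y Z" for a
    using that assms by (simp add: Cmp_Idt_right flip: Cmp_assoc)
  with assms(5-) show ?thesis by metis
qed

end

lemma idfun_simps [simp]: "onOb idfun X = X" "onMor idfun X Y f = f"
  by (simp_all add: idfun_def)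

lemma fcomp_simps [simp]: "onOb (G \<circ>\<^sub>F F) X = onOb G (onOb F X)"
  "onMor (G \<circ>\<^sub>F F) X Y f = onMor G (onOb F X) (onOb F Y) (onMor F X Y f)"
  by (simp_all add: fcomp_def)

text \<open>Naturality writes f after \<open>\<alpha> X\<close> as \<open>\<alpha> Y\<close> after
  GF(f), which depends only on F(f); the isomorphism \<open>\<alpha> X\<close> then cancels.\<close>

lemma faithful_of_left_inverse:
  assumes "linear_category K C" "linear_functor K C D F" "linear_functor K D C G"
    and GF: "fun_iso C C (G \<circ>\<^sub>F F) idfun" and X: "X \<in> Ob C" "Y \<in> Ob C" "f \<in> arr C X Y" "f' \<in> arr C X Y"
    and eq: "onMor F X Y f = onMor F X Y f'"
  shows "f = f'"
proof -
  interpret C: linear_category K C by fact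
  interpret F: linear_functor K C D F by fact
  interpret G: linear_functor K D C G by fact
  obtain \<alpha> where \<alpha>: "nat_iso C C (G \<circ>\<^sub>F F) idfun \<alpha>" using GF unfolding fun_iso_def by blast
  have "Cmp C (onOb G (onOb F X)) X Y f (\<alpha> X) = Cmp C (onOb G (onOb F X)) X Y f' (\<alpha> X)"
    using \<alpha> X eq unfolding nat_iso_def nat_trans_def by (simp, metis)
  moreover have "is_iso C (onOb G (onOb F X)) X (\<alpha> X)"
    using \<alpha> X unfolding nat_iso_def by simp
  ultimately show ?thesis using C.iso_cancel_right X F.onOb_closed G.onOb_closed by metis
qed

lemma full_of_inverse:
  assumes "linear_category K C" "linear_category K D" "linear_functor K C D F" "linear_functor K D C G"
    and GF: "fun_iso C C (G \<circ>\<^sub>F F) idfun" and FG: "fun_iso D D (F \<circ>\<^sub>F G) idfun"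
    and X: "X \<in> Ob C" "Y \<in> Ob C" and m: "m \<in> arr D (onOb F X) (onOb F Y)"
  shows "\<exists>f\<in>arr C X Y. onMor F X Y f = m"
proof -
  interpret C: linear_category K C by fact
  interpret D: linear_category K D by fact
  interpret F: linear_functor K C D F by fact
  interpret G: linear_functor K D C G by fact
  let ?GF = "\<lambda>X. onOb G (onOb F X)"
  obtain \<alpha> where \<alpha>: "nat_iso C C (G \<circ>\<^sub>F F) idfun \<alpha>" using GF unfolding fun_iso_def by blast
  have ob: "?GF X \<in> Ob C" "?GF Y \<in> Ob C" "onOb F X \<in> Ob D" "onOb F Y \<in> Ob D"
    using X F.onOb_closed G.onOb_closed by auto
  have iso: "is_iso C (?GF X) X (\<alpha> X)" "is_iso C (?GF Y) Y (\<alpha> Y)"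
    using \<alpha> X unfolding nat_iso_def by simp_all
  then have arr: "\<alpha> X \<in> arr C (?GF X) X" "\<alpha> Y \<in> arr C (?GF Y) Y" by (auto simp: is_iso_def)
  obtain b where b: "b \<in> arr C X (?GF X)" "Cmp C (?GF X) X (?GF X) b (\<alpha> X) = Idt C (?GF X)"
    using C.is_iso_inverse[OF iso(1)] X ob by metis
  have Gm: "onMor G (onOb F X) (onOb F Y) m \<in> arr C (?GF X) (?GF Y)"
    using G.onMor_closed ob m by blast
  \<comment> \<open>The only possible preimage: naturality of \<open>\<alpha>\<close> forces f to be
    G(m) conjugated by \<open>\<alpha>\<close>. That F(f) equals m is then checked after applying G,
    which is faithful because FG is isomorphic to the identity.\<close>
  define f where "f = Cmp C X (?GF X) Y (Cmp C (?GF X) (?GF Y) Y (\<alpha> Y) (onMor G (onOb F X) (onOb F Y) m)) b"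
  have f: "f \<in> arr C X Y" unfolding f_def using X ob arr b Gm C.Cmp_closed by metis
  have "Cmp C (?GF X) X Y f (\<alpha> X) = Cmp C (?GF X) (?GF Y) Y (\<alpha> Y) (onMor G (onOb F X) (onOb F Y) m)"
    unfolding f_def using X ob arr b Gm
    by (simp add: C.Cmp_closed C.Cmp_Idt_right flip: C.Cmp_assoc)
  moreover have "Cmp C (?GF X) (?GF Y) Y (\<alpha> Y) (onMor G (onOb F X) (onOb F Y) (onMor F X Y f))
    = Cmp C (?GF X) X Y f (\<alpha> X)"
    using \<alpha> X f unfolding nat_iso_def nat_trans_def by simp
  ultimately have "onMor G (onOb F X) (onOb F Y) (onMor F X Y f) = onMor G (onOb F X) (onOb F Y) m"
    using C.iso_cancel_left[OF iso(2)] Gm X ob f by (simp add: F.onMor_closed G.onMor_closed)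
  then have "onMor F X Y f = m"
    using faithful_of_left_inverse[OF assms(2,4,3) FG ob(3,4) F.onMor_closed[OF X f] m] by simp
  with f show ?thesis by blast
qed

section \<open>Triangulated categories\<close>

text \<open>Forgetting the maps hides the signs of rotation and lets each vertex be replaced by an
  isomorphic object independently of the other two.\<close>

definition tri3 :: "('k, 'o, 'm, 'y) tricat_scheme \<Rightarrow> 'o \<Rightarrow> 'o \<Rightarrow> 'o \<Rightarrow> bool" where
  "tri3 T X Y Z \<longleftrightarrow> (\<exists>f g h. Tri T X Y Z f g h)"

abbreviation unsh :: "('k, 'o, 'm, 'y) tricat_scheme \<Rightarrow> 'o \<Rightarrow> 'o" where
  "unsh T X \<equiv> onOb (Unshift T) X"

context triangulated_category
begin

sublocale Sh: linear_functor K T T "Shift T" by (rule linear_Shift)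
sublocale Un: linear_functor K T T "Unshift T" by (rule linear_Unshift)

section \<open>The shift and its quasi-inverse\<close>

lemma unsh_sh: "X \<in> Ob T \<Longrightarrow> iso_objects T (unsh T (sh T X)) X"
  using Unshift_Shift Sh.onOb_closed Un.onOb_closed
  unfolding fun_iso_def nat_iso_def iso_objects_def by auto

lemma sh_unsh: "X \<in> Ob T \<Longrightarrow> iso_objects T (sh T (unsh T X)) X"
  using Shift_Unshift Sh.onOb_closed Un.onOb_closed
  unfolding fun_iso_def nat_iso_def iso_objects_def by auto

lemma sh_iso_cancel: "\<lbrakk>iso_objects T (sh T X) (sh T Y); X \<in> Ob T; Y \<in> Ob T\<rbrakk> \<Longrightarrow> iso_objects T X Y"
  by (meson Un.iso_objects_onOb iso_sym iso_trans unsh_sh)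

lemma sh_retract_cancel:
  assumes "retract T (sh T X) (sh T Y)" "X \<in> Ob T" "Y \<in> Ob T"
  shows "retract T X Y"
proof -
  have "retract T (unsh T (sh T X)) (unsh T (sh T Y))" using assms Un.retract_onOb by blast
  then show ?thesis using assms by (meson iso_retract iso_sym retract_trans unsh_sh)
qed

lemma Shift_faithful:
  "\<lbrakk>X \<in> Ob T; Y \<in> Ob T; f \<in> arr T X Y; f' \<in> arr T X Y; onMor (Shift T) X Y f = onMor (Shift T) X Y f'\<rbrakk> \<Longrightarrow> f = f'"
  by (rule faithful_of_left_inverse[OF linear_category_axioms linear_Shift linear_Unshift Unshift_Shift])

lemma Shift_full:
  "\<lbrakk>X \<in> Ob T; Y \<in> Ob T; m \<in> arr T (sh T X) (sh T Y)\<rbrakk> \<Longrightarrow> \<exists>f\<in>arr T X Y. onMor (Shift T) X Y f = m"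
  by (rule full_of_inverse[OF linear_category_axioms linear_category_axioms linear_Shift linear_Unshift
    Unshift_Shift Shift_Unshift])

lemma is_zero_sh: "is_zero T Z \<Longrightarrow> is_zero T (sh T Z)"
  by (rule linear_functor_is_zero[OF linear_category_axioms linear_category_axioms linear_Shift])

lemma is_zero_unsh: "is_zero T Z \<Longrightarrow> is_zero T (unsh T Z)"
  by (rule linear_functor_is_zero[OF linear_category_axioms linear_category_axioms linear_Unshift])

lemma minus_cancel:
  assumes "X \<in> Ob T" "Y \<in> Ob T" "f \<in> arr T X Y" "g \<in> arr T X Y"
    "\<ominus>\<^bsub>Mor T X Y\<^esub> f = \<ominus>\<^bsub>Mor T X Y\<^esub> g"
  shows "f = g"
proof -
  interpret M: abelian_group "Mor T X Y" using assms abelian_group_Mor by blast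
  show ?thesis using assms by (metis M.minus_minus)
qed

lemma minus_minus:
  assumes "X \<in> Ob T" "Y \<in> Ob T" "f \<in> arr T X Y"
  shows "\<ominus>\<^bsub>Mor T X Y\<^esub> (\<ominus>\<^bsub>Mor T X Y\<^esub> f) = f"
proof -
  interpret M: abelian_group "Mor T X Y" using assms abelian_group_Mor by blast
  show ?thesis using assms by simp
qed

lemma minus_zero:
  assumes "X \<in> Ob T" "Y \<in> Ob T"
  shows "\<ominus>\<^bsub>Mor T X Y\<^esub> \<zero>\<^bsub>Mor T X Y\<^esub> = \<zero>\<^bsub>Mor T X Y\<^esub>"
proof -
  interpret M: abelian_group "Mor T X Y" using assms abelian_group_Mor by blast
  show ?thesis using assms by simp
qed

section \<open>Transport and rotation of triangles\<close>

lemma tri3_closed: "tri3 T X Y Z \<Longrightarrow> X \<in> Ob T \<and> Y \<in> Ob T \<and> Z \<in> Ob T"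
  unfolding tri3_def using Tri_closed by blast

lemma tri3_cong:
  assumes "tri3 T X Y Z" "iso_objects T X X'" "iso_objects T Y Y'" "iso_objects T Z Z'"
  shows "tri3 T X' Y' Z'"
proof -
  obtain f g h where tri: "Tri T X Y Z f g h" using assms unfolding tri3_def by blast
  obtain u v w where isos: "is_iso T X X' u" "is_iso T Y Y' v" "is_iso T Z Z' w"
    using assms unfolding iso_objects_def by blast
  have ob: "X' \<in> Ob T" "Y' \<in> Ob T" "Z' \<in> Ob T" using assms by (auto simp: iso_objects_def)
  note c = Tri_closed[OF tri]
  obtain u' where u: "u' \<in> arr T X' X" "u \<in> arr T X X'" "Cmp T X X' X u' u = Idt T X"
    using is_iso_inverse[OF isos(1)] c ob by metis
  obtain v' where v: "v' \<in> arr T Y' Y" "v \<in> arr T Y Y'" "Cmp T Y Y' Y v' v = Idt T Y"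
    using is_iso_inverse[OF isos(2)] c ob by metis
  obtain w' where w: "w' \<in> arr T Z' Z" "w \<in> arr T Z Z'" "Cmp T Z Z' Z w' w = Idt T Z"
    using is_iso_inverse[OF isos(3)] c ob by metis
  have ob': "X \<in> Ob T" "Y \<in> Ob T" "Z \<in> Ob T" "sh T X \<in> Ob T" "sh T X' \<in> Ob T"
    using c ob Sh.onOb_closed by auto
  have su: "onMor (Shift T) X X' u \<in> arr T (sh T X) (sh T X')"
    using u ob ob' Sh.onMor_closed by blast
  define f' where "f' = Cmp T X' X Y' (Cmp T X Y Y' v f) u'"
  define g' where "g' = Cmp T Y' Y Z' (Cmp T Y Z Z' w g) v'"
  define h' where "h' = Cmp T Z' Z (sh T X') (Cmp T Z (sh T X) (sh T X') (onMor (Shift T) X X' u) h) w'"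
  have f': "f' \<in> arr T X' Y'" and g': "g' \<in> arr T Y' Z'" and h': "h' \<in> arr T Z' (sh T X')"
    unfolding f'_def g'_def h'_def using c ob ob' u v w su by (simp_all add: Cmp_closed)
  have "Cmp T X Y Y' v f = Cmp T X X' Y' f' u"
    unfolding f'_def using c ob u v by (simp add: Cmp_closed Cmp_Idt_right flip: Cmp_assoc)
  moreover have "Cmp T Y Z Z' w g = Cmp T Y Y' Z' g' v"
    unfolding g'_def using c ob ob' v w by (simp add: Cmp_closed Cmp_Idt_right flip: Cmp_assoc)
  moreover have "Cmp T Z (sh T X) (sh T X') (onMor (Shift T) X X' u) h = Cmp T Z Z' (sh T X') h' w"
    unfolding h'_def using c ob ob' w su by (simp add: Cmp_closed Cmp_Idt_right flip: Cmp_assoc)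
  ultimately have "tri_iso T X Y Z f g h X' Y' Z' f' g' h'"
    unfolding tri_iso_def using c ob f' g' h' isos by blast
  then show ?thesis using TR1_iso tri unfolding tri3_def by blast
qed

lemma Tri_rotate:
  assumes "Tri T X Y Z f g h"
  shows "Tri T Y Z (sh T X) g h (\<ominus>\<^bsub>Mor T (sh T X) (sh T Y)\<^esub> onMor (Shift T) X Y f)"
  using assms Tri_closed[OF assms] TR2 by blast

lemma tri3_rotate: "tri3 T X Y Z \<Longrightarrow> tri3 T Y Z (sh T X)"
  unfolding tri3_def using Tri_rotate by blast

text \<open>TR2 rotates back only when the third map is minus a shifted map. As the shift is full,
  every k has this form.\<close>

lemma Tri_rotate_back:
  assumes "Tri T Y Z (sh T X) g h k" "X \<in> Ob T"
  shows "\<exists>f. Tri T X Y Z f g h"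
proof -
  have c: "Y \<in> Ob T" "Z \<in> Ob T" "sh T X \<in> Ob T" "sh T Y \<in> Ob T"
    "g \<in> arr T Y Z" "h \<in> arr T Z (sh T X)" "k \<in> arr T (sh T X) (sh T Y)"
    using Tri_closed[OF assms(1)] Sh.onOb_closed by auto
  obtain f where f: "f \<in> arr T X Y" "onMor (Shift T) X Y f = \<ominus>\<^bsub>Mor T (sh T X) (sh T Y)\<^esub> k"
    using Shift_full[of X Y] c assms minus_closed by metis
  then have "\<ominus>\<^bsub>Mor T (sh T X) (sh T Y)\<^esub> onMor (Shift T) X Y f = k" using c minus_minus by simp
  then show ?thesis using TR2[of X Y Z f g h] f c assms by auto
qed

lemma tri3_rotate_back: "\<lbrakk>tri3 T Y Z (sh T X); X \<in> Ob T\<rbrakk> \<Longrightarrow> tri3 T X Y Z"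
  unfolding tri3_def using Tri_rotate_back by blast

lemma tri3_sh: "tri3 T X Y Z \<Longrightarrow> tri3 T (sh T X) (sh T Y) (sh T Z)"
  by (rule tri3_rotate[OF tri3_rotate[OF tri3_rotate]])

lemma tri3_sh_cancel: 
  assumes "tri3 T (sh T X) (sh T Y) (sh T Z)" "X \<in> Ob T" "Y \<in> Ob T" "Z \<in> Ob T"
  shows "tri3 T X Y Z"
  by (rule tri3_rotate_back[OF tri3_rotate_back[OF tri3_rotate_back]]) (rule assms)+

lemma tri3_unsh:
  assumes "tri3 T X Y Z" shows "tri3 T (unsh T X) (unsh T Y) (unsh T Z)"
proof (rule tri3_sh_cancel)
  show "tri3 T (sh T (unsh T X)) (sh T (unsh T Y)) (sh T (unsh T Z))"
    using tri3_cong[OF assms] tri3_closed[OF assms] sh_unsh iso_sym by blast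
qed (use tri3_closed[OF assms] Un.onOb_closed in auto)

section \<open>Exactness of Hom along a triangle\<close>

lemma Tri_Cmp_zero:
  assumes "Tri T X Y Z f g h"
  shows "Cmp T X Y Z g f = \<zero>\<^bsub>Mor T X Z\<^esub>"
proof -
  note c = Tri_closed[OF assms]
  obtain O' where O': "is_zero T O'" using ex_zero by blast
  then have "O' \<in> Ob T" by (simp add: is_zero_def)
  \<comment> \<open>Compare the identity triangle of X with the given one by the maps 1 and f: the
    composite of f and g factors through a zero object.\<close>
  obtain w where "w \<in> arr T O' Z" "Cmp T X O' Z w \<zero>\<^bsub>Mor T X O'\<^esub> = Cmp T X Y Z g f"
    using TR3[OF TR1_id[OF _ O'] assms, of X "Idt T X" f] c by (auto simp: Idt_closed)
  then show ?thesis using Cmp_zero_right[of X O' Z w] c \<open>O' \<in> Ob T\<close> by simp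
qed

text \<open>The map g is a weak cokernel of f. TR3 is applied to the map from the given triangle to
  0 -> W -> W that has k in the middle; the third map is the factorization.\<close>

lemma Tri_cofactor:
  assumes tri: "Tri T X Y Z f g h" and W: "W \<in> Ob T" "k \<in> arr T Y W"
    and z: "Cmp T X Y W k f = \<zero>\<^bsub>Mor T X W\<^esub>"
  shows "\<exists>l\<in>arr T Z W. Cmp T Y Z W l g = k"
proof -
  note c = Tri_closed[OF tri]
  obtain O' where O': "is_zero T O'" using ex_zero by blast
  then have ob: "O' \<in> Ob T" "sh T O' \<in> Ob T" by (auto simp: is_zero_def Sh.onOb_closed)
  have "Tri T W W (sh T O') (Idt T W) \<zero>\<^bsub>Mor T W (sh T O')\<^esub> \<zero>\<^bsub>Mor T (sh T O') (sh T W)\<^esub>"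
    using TR1_id W is_zero_sh[OF O'] by blast
  then obtain a where a: "Tri T O' W W a (Idt T W) \<zero>\<^bsub>Mor T W (sh T O')\<^esub>"
    using Tri_rotate_back ob by blast
  have "a = \<zero>\<^bsub>Mor T O' W\<^esub>" using Tri_closed[OF a] zero_arr_eq[OF O'] by blast
  then have sq: "Cmp T X Y W k f = Cmp T X O' W a \<zero>\<^bsub>Mor T X O'\<^esub>" 
    using z c ob W by (simp add: Cmp_zero_left zero_closed)
  obtain l where "l \<in> arr T Z W" "Cmp T Y Z W l g = Cmp T Y W W (Idt T W) k"
    using TR3[OF tri a _ W(2) sq] c ob zero_closed by auto
  then show ?thesis using c W Cmp_Idt_left by auto
qed

text \<open>The map f is a weak kernel of g. TR3 only fills in third maps, so the comparison is made
  one rotation later, from W -> 0 -> W[1] to Y -> Z -> X[1]. The filler is desuspended by fullness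
  of the shift, and faithfulness recovers the equation once the rotation signs on both sides
  cancel.\<close>

lemma Tri_factor:
  assumes tri: "Tri T X Y Z f g h" and W: "W \<in> Ob T" "k \<in> arr T W Y"
    and z: "Cmp T W Y Z g k = \<zero>\<^bsub>Mor T W Z\<^esub>"
  shows "\<exists>l\<in>arr T W X. Cmp T W X Y f l = k"
proof -
  note c = Tri_closed[OF tri]
  obtain O' where O': "is_zero T O'" using ex_zero by blast
  have ob: "O' \<in> Ob T" "sh T W \<in> Ob T" "sh T X \<in> Ob T" "sh T Y \<in> Ob T" "X \<in> Ob T" "Y \<in> Ob T" "Z \<in> Ob T"
    using O' W c by (auto simp: is_zero_def Sh.onOb_closed)
  let ?m = "\<lambda>f. \<ominus>\<^bsub>Mor T (sh T W) (sh T Y)\<^esub> f"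
  let ?S = "onMor (Shift T)"
  have t1: "Tri T W O' (sh T W) \<zero>\<^bsub>Mor T W O'\<^esub> \<zero>\<^bsub>Mor T O' (sh T W)\<^esub> (\<ominus>\<^bsub>Mor T (sh T W) (sh T W)\<^esub> ?S W W (Idt T W))"
    using Tri_rotate[OF TR1_id[OF W(1) O']] .
  note t2 = Tri_rotate[OF tri]
  have sq: "Cmp T W O' Z \<zero>\<^bsub>Mor T O' Z\<^esub> \<zero>\<^bsub>Mor T W O'\<^esub> = Cmp T W Y Z g k"
    using z W ob by (simp add: Cmp_zero_left zero_closed)
  obtain w where w: "w \<in> arr T (sh T W) (sh T X)"
    and eq: "Cmp T (sh T W) (sh T W) (sh T Y) (?S W Y k) (\<ominus>\<^bsub>Mor T (sh T W) (sh T W)\<^esub> ?S W W (Idt T W))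
      = Cmp T (sh T W) (sh T X) (sh T Y) (\<ominus>\<^bsub>Mor T (sh T X) (sh T Y)\<^esub> ?S X Y f) w"
    using TR3[OF t1 t2 W(2) _ sq] c ob zero_closed by blast
  obtain l where l: "l \<in> arr T W X" "?S W X l = w" using Shift_full w W ob by blast
  have sc: "?S W Y k \<in> arr T (sh T W) (sh T Y)" "?S X Y f \<in> arr T (sh T X) (sh T Y)"
    using W c Sh.onMor_closed by blast+
  have "?m (?S W Y k) = ?m (Cmp T (sh T W) (sh T X) (sh T Y) (?S X Y f) w)"
    using eq W ob w sc by (simp add: Sh.onMor_Idt Cmp_minus_right Cmp_minus_left Idt_closed Cmp_Idt_right)
  then have "?S W Y k = Cmp T (sh T W) (sh T X) (sh T Y) (?S X Y f) w"
    using minus_cancel[of "sh T W" "sh T Y"] ob sc w by (simp add: Cmp_closed)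
  also have "\<dots> = ?S W Y (Cmp T W X Y f l)" using Sh.onMor_Cmp W c l by simp
  finally have "k = Cmp T W X Y f l" using Shift_faithful[of W Y] W c l Cmp_closed by simp
  with l show ?thesis by blast
qed

text \<open>Put x = e - 1. Since x f = 0, x factors as a g; since g x = 0, this gives x x = a g x =
  0.\<close>

lemma Tri_endo_left_inverse:
  assumes tri: "Tri T X Y Z f g h" and e: "e \<in> arr T Y Y" "Cmp T X Y Y e f = f" "Cmp T Y Y Z g e = g"
  shows "\<exists>e'\<in>arr T Y Y. Cmp T Y Y Y e' e = Idt T Y"
proof (rule unipotent_left_inverse)
  note c = Tri_closed[OF tri]
  then have Y: "Y \<in> Ob T" "X \<in> Ob T" "Z \<in> Ob T" "f \<in> arr T X Y" "g \<in> arr T Y Z" by auto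
  interpret YY: abelian_group "Mor T Y Y" using Y abelian_group_Mor by blast
  interpret XY: abelian_group "Mor T X Y" using Y abelian_group_Mor by blast
  interpret YZ: abelian_group "Mor T Y Z" using Y abelian_group_Mor by blast
  let ?x = "e \<ominus>\<^bsub>Mor T Y Y\<^esub> Idt T Y"
  have id: "Idt T Y \<in> arr T Y Y" using Y Idt_closed by blast
  have x: "?x \<in> arr T Y Y" using Y e id by simp
  have "Cmp T X Y Y ?x f = \<zero>\<^bsub>Mor T X Y\<^esub>"
    using Y e id by (simp add: YY.minus_eq Cmp_add_left Cmp_minus_left Cmp_Idt_left XY.r_neg)
  then obtain a where a: "a \<in> arr T Z Y" "Cmp T Y Z Y a g = ?x"
    using Tri_cofactor[OF tri Y(1) x] by blast
  have gx: "Cmp T Y Y Z g ?x = \<zero>\<^bsub>Mor T Y Z\<^esub>"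
    using Y e id by (simp add: YY.minus_eq Cmp_add_right Cmp_minus_right Cmp_Idt_right YZ.r_neg)
  have "Cmp T Y Y Y ?x ?x = Cmp T Y Y Y (Cmp T Y Z Y a g) ?x" using a by simp
  also have "\<dots> = Cmp T Y Z Y a (Cmp T Y Y Z g ?x)" using Y x a Cmp_assoc by metis
  also have "\<dots> = \<zero>\<^bsub>Mor T Y Y\<^esub>" using Y a by (simp add: gx Cmp_zero_right)
  finally show "Cmp T Y Y Y ?x ?x = \<zero>\<^bsub>Mor T Y Y\<^esub>" .
qed (use e Tri_closed[OF tri] in auto)

text \<open>Both maps adjacent to w in the rotated triangle vanish, so the weak cokernel property
  gives a left inverse and the weak kernel property a right inverse; the two agree by
  associativity.\<close>

lemma Tri_zero_first:
  assumes tri: "Tri T O' B C v w k" and O': "is_zero T O'"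
  shows "is_iso T B C w"
proof -
  note c = Tri_closed[OF tri]
  have ob: "O' \<in> Ob T" "B \<in> Ob T" "C \<in> Ob T" "sh T O' \<in> Ob T" "w \<in> arr T B C" using c Sh.onOb_closed by auto
  have "v = \<zero>\<^bsub>Mor T O' B\<^esub>" using c zero_arr_eq[OF O'] by blast
  then have "Cmp T O' B B (Idt T B) v = \<zero>\<^bsub>Mor T O' B\<^esub>"
    using ob by (simp add: Cmp_zero_right Idt_closed)
  then obtain l where l: "l \<in> arr T C B" "Cmp T B C B l w = Idt T B"
    using Tri_cofactor[OF tri ob(2) Idt_closed[OF ob(2)]] by blast
  have "k = \<zero>\<^bsub>Mor T C (sh T O')\<^esub>" using c zero_arr_eq[OF is_zero_sh[OF O']] by blast
  then have "Cmp T C C (sh T O') k (Idt T C) = \<zero>\<^bsub>Mor T C (sh T O')\<^esub>"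
    using ob by (simp add: Cmp_zero_left Idt_closed)
  then obtain l' where l': "l' \<in> arr T C B" "Cmp T C B C w l' = Idt T C"
    using Tri_factor[OF Tri_rotate[OF tri] ob(3) Idt_closed[OF ob(3)]] by blast
  have "l = Cmp T C C B l (Cmp T C B C w l')" using l l' ob by (simp add: Cmp_Idt_right)
  also have "\<dots> = Cmp T C B B (Cmp T B C B l w) l'" using l(1) l'(1) ob Cmp_assoc by metis
  also have "\<dots> = l'" using l l' ob by (simp add: Cmp_Idt_left)
  finally show ?thesis unfolding is_iso_def using l l' ob by blast
qed

lemma tri3_zero_first: "\<lbrakk>tri3 T O' B C; is_zero T O'\<rbrakk> \<Longrightarrow> iso_objects T B C"
  unfolding iso_objects_def using Tri_zero_first tri3_closed unfolding tri3_def by blast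

lemma tri3_zero_last:
  assumes "tri3 T A B O'" "is_zero T O'"
  shows "iso_objects T A B"
  using tri3_zero_first[OF tri3_rotate[OF tri3_rotate[OF assms(1)]] assms(2)]
    sh_iso_cancel tri3_closed[OF assms(1)] by blast

lemma tri3_id_zero: "\<lbrakk>X \<in> Ob T; is_zero T Z\<rbrakk> \<Longrightarrow> tri3 T X X Z"
  unfolding tri3_def using TR1_id by blast

lemma tri3_zero_id:
  assumes "X \<in> Ob T" "is_zero T Z"
  shows "tri3 T Z X X"
  using tri3_rotate_back[OF tri3_id_zero[OF assms(1) is_zero_sh[OF assms(2)]]] assms
  by (simp add: is_zero_def)

text \<open>TR3 only yields maps \<open>Z \<rightarrow> V \<rightarrow> Z\<close> whose composite need not be the identity; it is compatible with
  the identities of \<open>Y\<close> and \<open>X[1]\<close>, hence unipotent, which suffices for a left inverse.\<close>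

lemma tri3_retract_last:
  assumes "tri3 T X Y Z" "retract T X P" "retract T Y Q"
  shows "\<exists>V. tri3 T P Q V \<and> retract T Z V"
proof -
  obtain f g h where tri: "Tri T X Y Z f g h" using assms unfolding tri3_def by blast
  note c = Tri_closed[OF tri]
  obtain i p where P: "P \<in> Ob T" "i \<in> arr T X P" "p \<in> arr T P X" and pi: "Cmp T X P X p i = Idt T X"
    using assms(2) unfolding retract_def by blast
  obtain j q where Q: "Q \<in> Ob T" "j \<in> arr T Y Q" "q \<in> arr T Q Y" and qj: "Cmp T Y Q Y q j = Idt T Y"
    using assms(3) unfolding retract_def by blast
  \<comment> \<open>This choice makes the pair of inclusions (i, j) and the pair of projections (p,
    q) both compatible with f and f', so that TR3 applies in both directions.\<close>
  define f' where "f' = Cmp T P Y Q j (Cmp T P X Y f p)"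
  have f': "f' \<in> arr T P Q" unfolding f'_def using c P Q by (simp add: Cmp_closed)
  obtain V g' h' where tri': "Tri T P Q V f' g' h'" using TR1_cone[OF P(1) Q(1) f'] by blast
  note c' = Tri_closed[OF tri']
  have "Cmp T X P Q f' i = Cmp T X Y Q j (Cmp T X X Y f (Cmp T X P X p i))"
    unfolding f'_def using c P Q by (simp add: Cmp_closed flip: Cmp_assoc del: pi)
  then have sq1: "Cmp T X Y Q j f = Cmp T X P Q f' i"
    using c by (simp add: pi Cmp_Idt_right)
  have "Cmp T P Q Y q f' = Cmp T P Y Y (Cmp T Y Q Y q j) (Cmp T P X Y f p)"
    unfolding f'_def using c P Q by (simp add: Cmp_closed Cmp_assoc del: qj)
  then have sq2: "Cmp T P Q Y q f' = Cmp T P X Y f p"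
    using c P by (simp add: qj Cmp_Idt_left Cmp_closed)
  have ob: "X \<in> Ob T" "Y \<in> Ob T" "Z \<in> Ob T" "V \<in> Ob T" "sh T X \<in> Ob T" "sh T P \<in> Ob T" "sh T Y \<in> Ob T"
    and gh: "g \<in> arr T Y Z" "h \<in> arr T Z (sh T X)" "g' \<in> arr T Q V" "h' \<in> arr T V (sh T P)"
    using c c' Sh.onOb_closed by auto
  let ?S = "onMor (Shift T)"
  obtain w where w: "w \<in> arr T Z V" "Cmp T Y Z V w g = Cmp T Y Q V g' j"
    "Cmp T Z (sh T X) (sh T P) (?S X P i) h = Cmp T Z V (sh T P) h' w"
    using TR3[OF tri tri' P(2) Q(2) sq1] by blast
  obtain w' where w': "w' \<in> arr T V Z" "Cmp T Q V Z w' g' = Cmp T Q Y Z g q"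
    "Cmp T V (sh T P) (sh T X) (?S P X p) h' = Cmp T V Z (sh T X) h w'"
    using TR3[OF tri' tri P(3) Q(3) sq2] by blast
  have si: "?S X P i \<in> arr T (sh T X) (sh T P)" "?S P X p \<in> arr T (sh T P) (sh T X)"
    "Cmp T (sh T X) (sh T P) (sh T X) (?S P X p) (?S X P i) = Idt T (sh T X)"
    using P c Sh.onMor_closed Sh.onMor_Cmp[of X P X i p] Sh.onMor_Idt pi by simp_all
  let ?e = "Cmp T Z V Z w' w"
  have e: "?e \<in> arr T Z Z" using w w' ob Cmp_closed by blast
  have "Cmp T Y Z Z ?e g = Cmp T Y V Z w' (Cmp T Y Z V w g)"
    using w(1) w'(1) ob gh by (simp add: Cmp_assoc)
  also have "\<dots> = Cmp T Y Q Z (Cmp T Q V Z w' g') j"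
    using w(2) w'(1) ob gh Q by (simp add: Cmp_assoc)
  also have "\<dots> = Cmp T Y Y Z g (Cmp T Y Q Y q j)"
    using w'(2) ob gh Q(1-3) by (simp add: Cmp_assoc)
  finally have eg: "Cmp T Y Z Z ?e g = g" using qj ob gh by (simp add: Cmp_Idt_right)
  have "Cmp T Z Z (sh T X) h ?e = Cmp T Z V (sh T X) (Cmp T V Z (sh T X) h w') w"
    using w(1) w'(1) ob gh by (simp add: Cmp_assoc)
  also have "\<dots> = Cmp T Z (sh T P) (sh T X) (?S P X p) (Cmp T Z V (sh T P) h' w)"
    using w(1) si ob gh by (simp add: Cmp_assoc flip: w'(3))
  also have "\<dots> = Cmp T Z (sh T X) (sh T X) (Cmp T (sh T X) (sh T P) (sh T X) (?S P X p) (?S X P i)) h"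
    using si(1,2) ob gh by (simp add: Cmp_assoc flip: w(3))
  finally have he: "Cmp T Z Z (sh T X) h ?e = h" using si ob gh by (simp add: Cmp_Idt_left)
  obtain e' where e': "e' \<in> arr T Z Z" "Cmp T Z Z Z e' ?e = Idt T Z"
    using Tri_endo_left_inverse[OF Tri_rotate[OF tri] e eg he] by blast
  have "Cmp T Z V Z (Cmp T V Z Z e' w') w = Idt T Z"
    using e' w(1) w'(1) ob by (simp add: Cmp_assoc)
  then have "retract T Z V" unfolding retract_def using e' w(1) w'(1) ob Cmp_closed by blast
  then show ?thesis using tri' unfolding tri3_def by blast
qed

text \<open>Two rotations turn the middle vertex Y into the last vertex Y[1], where
  \<open>tri3_retract_last\<close> applies; the enlarged object is then desuspended. This is the
  form needed for filtrations, where the stage and the quotient are both known only up to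
  retracts.\<close>

lemma tri3_retract_middle:
  assumes "tri3 T X Y Z" "retract T X P" "retract T Z Q"
  shows "\<exists>V. tri3 T P V Q \<and> retract T Y V"
proof -
  have ob: "X \<in> Ob T" "Y \<in> Ob T" "Z \<in> Ob T" "P \<in> Ob T"
    using tri3_closed[OF assms(1)] assms(2) by (auto simp: retract_def)
  obtain V where V: "tri3 T Q (sh T P) V" "retract T (sh T Y) V"
    using tri3_retract_last[OF tri3_rotate[OF tri3_rotate[OF assms(1)]] assms(3) Sh.retract_onOb[OF assms(2)]]
    by blast
  have cl: "V \<in> Ob T" "Q \<in> Ob T" "sh T P \<in> Ob T" "unsh T V \<in> Ob T" using tri3_closed[OF V(1)] Un.onOb_closed by auto
  have iso: "iso_objects T V (sh T (unsh T V))" using cl sh_unsh iso_sym by blast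
  then have "tri3 T Q (sh T P) (sh T (unsh T V))" using tri3_cong[OF V(1)] iso_refl cl by blast
  then have "tri3 T P (unsh T V) Q" using tri3_rotate_back[OF tri3_rotate_back] ob cl by blast
  moreover have "retract T Y (unsh T V)"
    using sh_retract_cancel V(2) iso iso_retract retract_trans ob cl by blast
  ultimately show ?thesis by blast
qed

text \<open>Reassociation of extensions: Z is X extended by Y, and Y is Y' extended by E. The new
  stage Z' is the desuspended cone of the composite Z -> Y -> E, and TR4 relates it to X and
  Y'.\<close>

lemma tri3_octahedral:
  assumes "tri3 T X Z Y" "tri3 T Y' Y E"
  shows "\<exists>Z'. tri3 T X Z' Y' \<and> tri3 T Z' Z E"
proof -
  have ob: "X \<in> Ob T" "Y \<in> Ob T" "Z \<in> Ob T" "Y' \<in> Ob T" "E \<in> Ob T"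
    using assms tri3_closed by blast+
  obtain f c d where 1: "Tri T Z Y (sh T X) f c d"
    using tri3_rotate[OF assms(1)] unfolding tri3_def by blast
  obtain g e m where 2: "Tri T Y E (sh T Y') g e m"
    using tri3_rotate[OF assms(2)] unfolding tri3_def by blast
  have gf: "Cmp T Z Y E g f \<in> arr T Z E" using Tri_closed[OF 1] Tri_closed[OF 2] Cmp_closed by blast
  obtain Q p q where 3: "Tri T Z E Q (Cmp T Z Y E g f) p q" using TR1_cone[OF _ _ gf] ob by blast
  have Q: "Q \<in> Ob T" "unsh T Q \<in> Ob T" using Tri_closed[OF 3] Un.onOb_closed by auto
  have iso: "iso_objects T Q (sh T (unsh T Q))" using Q sh_unsh iso_sym by blast
  have "tri3 T (sh T X) Q (sh T Y')" using TR4[OF 1 2 3] unfolding tri3_def by blast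
  then have "tri3 T (sh T X) (sh T (unsh T Q)) (sh T Y')"
    using tri3_cong iso iso_refl ob Sh.onOb_closed by blast
  then have "tri3 T X (unsh T Q) Y'" using tri3_sh_cancel ob Q by blast
  moreover have "tri3 T Z E (sh T (unsh T Q))"
    using 3 tri3_cong[of Z E Q] iso iso_refl ob unfolding tri3_def by blast
  then have "tri3 T (unsh T Q) Z E" using tri3_rotate_back Q by blast
  ultimately show ?thesis by blast
qed

text \<open>The complement is the cone C of the split inclusion i. The connecting map h satisfies
  i[1] h = 0 and hence vanishes, because i[1] has a left inverse; therefore q has a section. It
  remains to correct the section and to show that the two projectors add up to the identity.\<close>

lemma retract_direct_sum:
  assumes "retract T X P"
  shows "\<exists>X'. is_direct_sum T X X' P"
proof -
  obtain i p where ob: "X \<in> Ob T" "P \<in> Ob T" and ip: "i \<in> arr T X P" "p \<in> arr T P X"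
    and pi: "Cmp T X P X p i = Idt T X"
    using assms unfolding retract_def by blast
  obtain C q h where tri: "Tri T X P C i q h" using TR1_cone ob ip by blast
  have c: "C \<in> Ob T" "q \<in> arr T P C" "h \<in> arr T C (sh T X)" "sh T X \<in> Ob T" "sh T P \<in> Ob T"
    using Tri_closed[OF tri] Sh.onOb_closed by auto
  let ?S = "onMor (Shift T)"
  have s: "?S X P i \<in> arr T (sh T X) (sh T P)" "?S P X p \<in> arr T (sh T P) (sh T X)"
    "Cmp T (sh T X) (sh T P) (sh T X) (?S P X p) (?S X P i) = Idt T (sh T X)"
    using ob ip Sh.onMor_closed Sh.onMor_Cmp[of X P X i p] Sh.onMor_Idt pi by simp_all
  have qi: "Cmp T X P C q i = \<zero>\<^bsub>Mor T X C\<^esub>" using Tri_Cmp_zero[OF tri] .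
  have "\<ominus>\<^bsub>Mor T C (sh T P)\<^esub> Cmp T C (sh T X) (sh T P) (?S X P i) h = \<zero>\<^bsub>Mor T C (sh T P)\<^esub>"
    using Tri_Cmp_zero[OF Tri_rotate[OF Tri_rotate[OF tri]]] c s by (simp add: Cmp_minus_left)
  then have z: "Cmp T C (sh T X) (sh T P) (?S X P i) h = \<zero>\<^bsub>Mor T C (sh T P)\<^esub>"
    using minus_zero[of C "sh T P"] minus_cancel[of C "sh T P"] c s Cmp_closed zero_closed by metis
  have "h = Cmp T C (sh T X) (sh T X) (Cmp T (sh T X) (sh T P) (sh T X) (?S P X p) (?S X P i)) h"
    using c s by (simp add: Cmp_Idt_left)
  also have "\<dots> = \<zero>\<^bsub>Mor T C (sh T X)\<^esub>"
    using c s(1,2) z by (simp add: Cmp_zero_right flip: Cmp_assoc)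
  finally have "h = \<zero>\<^bsub>Mor T C (sh T X)\<^esub>" .
  then have "Cmp T C C (sh T X) h (Idt T C) = \<zero>\<^bsub>Mor T C (sh T X)\<^esub>"
    using c by (simp add: Cmp_zero_left Idt_closed)
  then obtain j' where j': "j' \<in> arr T C P" "Cmp T C P C q j' = Idt T C"
    using Tri_factor[OF Tri_rotate[OF tri] c(1) Idt_closed[OF c(1)]] by blast
  interpret CP: abelian_group "Mor T C P" using ob c abelian_group_Mor by blast
  interpret CX: abelian_group "Mor T C X" using ob c abelian_group_Mor by blast
  interpret CC: abelian_group "Mor T C C" using ob c abelian_group_Mor by blast
  interpret PP: abelian_group "Mor T P P" using ob c abelian_group_Mor by blast
  interpret PX: abelian_group "Mor T P X" using ob c abelian_group_Mor by blast
  interpret PC: abelian_group "Mor T P C" using ob c abelian_group_Mor by blast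
  \<comment> \<open>The component of the section j' along X. Subtracting it leaves a section of q,
    as q i = 0, that p annihilates.\<close>
  define r where "r = Cmp T C X P i (Cmp T C P X p j')"
  have r: "r \<in> arr T C P" unfolding r_def using ob c ip j' by (simp add: Cmp_closed)
  have pr: "Cmp T C P X p r = Cmp T C P X p j'"
  proof -
    have "Cmp T C P X p r = Cmp T C X X (Cmp T X P X p i) (Cmp T C P X p j')"
      unfolding r_def using ob c ip j'(1) by (simp add: Cmp_assoc Cmp_closed)
    then show ?thesis using pi ob c ip j' by (simp add: Cmp_Idt_left Cmp_closed)
  qed
  have qr: "Cmp T C P C q r = \<zero>\<^bsub>Mor T C C\<^esub>"
  proof -
    have "Cmp T C P C q r = Cmp T C X C (Cmp T X P C q i) (Cmp T C P X p j')"
      unfolding r_def using ob c ip j'(1) by (simp add: Cmp_assoc Cmp_closed)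
    then show ?thesis using qi ob c ip j' by (simp add: Cmp_zero_left Cmp_closed)
  qed
  define j where "j = j' \<oplus>\<^bsub>Mor T C P\<^esub> \<ominus>\<^bsub>Mor T C P\<^esub> r"
  have j: "j \<in> arr T C P" unfolding j_def using j' r by simp
  have pj: "Cmp T C P X p j = \<zero>\<^bsub>Mor T C X\<^esub>"
    unfolding j_def using ob c ip j' r pr by (simp add: Cmp_add_right Cmp_minus_right Cmp_closed CX.r_neg)
  have qj: "Cmp T C P C q j = Idt T C"
    unfolding j_def using ob c ip j' r qr by (simp add: Cmp_add_right Cmp_minus_right Idt_closed)
  define s where "s = Cmp T P X P i p \<oplus>\<^bsub>Mor T P P\<^esub> Cmp T P C P j q"
  have ips: "Cmp T P X P i p \<in> arr T P P" "Cmp T P C P j q \<in> arr T P P"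
    using ob c ip j Cmp_closed by auto
  then have s': "s \<in> arr T P P" unfolding s_def by simp
  have id: "Idt T P \<in> arr T P P" using ob Idt_closed by blast
  have "Cmp T P P X p (Cmp T P X P i p) = p"
    using ob ip by (simp add: Cmp_assoc pi Cmp_Idt_left)
  moreover have "Cmp T P P X p (Cmp T P C P j q) = \<zero>\<^bsub>Mor T P X\<^esub>"
    using ob ip c j by (simp add: Cmp_assoc pj Cmp_zero_left)
  ultimately have ps: "Cmp T P P X p s = p"
    unfolding s_def using ob ip ips by (simp add: Cmp_add_right)
  have "Cmp T P P C q (Cmp T P X P i p) = \<zero>\<^bsub>Mor T P C\<^esub>"
    using ob ip c by (simp add: Cmp_assoc qi Cmp_zero_left)
  moreover have "Cmp T P P C q (Cmp T P C P j q) = q"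
    using ob ip c j by (simp add: Cmp_assoc qj Cmp_Idt_left)
  ultimately have qs: "Cmp T P P C q s = q"
    unfolding s_def using ob ip c ips by (simp add: Cmp_add_right)
  \<comment> \<open>The defect y is annihilated by p and by q. The second fact factors it as i b,
    and then b = p i b = p y = 0.\<close>
  define y where "y = Idt T P \<oplus>\<^bsub>Mor T P P\<^esub> \<ominus>\<^bsub>Mor T P P\<^esub> s"
  have y: "y \<in> arr T P P" unfolding y_def using id s' by simp
  have py: "Cmp T P P X p y = \<zero>\<^bsub>Mor T P X\<^esub>" unfolding y_def
    using ob ip id s' ps by (simp add: Cmp_add_right Cmp_minus_right Cmp_Idt_right PX.r_neg)
  have "Cmp T P P C q y = \<zero>\<^bsub>Mor T P C\<^esub>" unfolding y_def
    using ob c id s' qs by (simp add: Cmp_add_right Cmp_minus_right Cmp_Idt_right PC.r_neg)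
  then obtain b where b: "b \<in> arr T P X" "Cmp T P X P i b = y"
    using Tri_factor[OF tri ob(2) y] by blast
  have "b = Cmp T P X X (Cmp T X P X p i) b" using b ob by (simp add: pi Cmp_Idt_left)
  also have "\<dots> = \<zero>\<^bsub>Mor T P X\<^esub>" using b ob ip py by (simp flip: Cmp_assoc)
  finally have "y = \<zero>\<^bsub>Mor T P P\<^esub>" using b ob ip Cmp_zero_right by metis
  then have "s = Idt T P" using s' id unfolding y_def by (metis PP.minus_equality PP.minus_minus PP.a_inv_closed)
  then show ?thesis unfolding is_direct_sum_def s_def using ob c ip j pi pj qi qj by blast
qed

lemma retract_iff_direct_sum: "retract T X P \<longleftrightarrow> (\<exists>X'. is_direct_sum T X X' P)"
  using retract_direct_sum unfolding retract_def is_direct_sum_def by blast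

end

section \<open>Maps of objects induced by exact functors\<close>

text \<open>The shift itself becomes exact only with a sign in its comparison isomorphism. Keeping
  only the effect on objects avoids this sign and treats shifts, composites and powers of functors
  uniformly.\<close>

definition exact_on_objects :: "('k, 'o, 'm, 'y) tricat_scheme \<Rightarrow> ('k, 'p, 'n, 'w) tricat_scheme \<Rightarrow>
    ('o \<Rightarrow> 'p) \<Rightarrow> bool" where
  "exact_on_objects C D \<phi> \<longleftrightarrow>
    (\<forall>X\<in>Ob C. \<phi> X \<in> Ob D \<and> iso_objects D (\<phi> (sh C X)) (sh D (\<phi> X))) \<and>
    (\<forall>Z. is_zero C Z \<longrightarrow> is_zero D (\<phi> Z)) \<and>
    (\<forall>X Y. iso_objects C X Y \<longrightarrow> iso_objects D (\<phi> X) (\<phi> Y)) \<and>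
    (\<forall>X Y. retract C X Y \<longrightarrow> retract D (\<phi> X) (\<phi> Y)) \<and>
    (\<forall>X Y Z. tri3 C X Y Z \<longrightarrow> tri3 D (\<phi> X) (\<phi> Y) (\<phi> Z))"

lemma exact_on_objectsD:
  assumes "exact_on_objects C D \<phi>"
  shows "X \<in> Ob C \<Longrightarrow> \<phi> X \<in> Ob D" "X \<in> Ob C \<Longrightarrow> iso_objects D (\<phi> (sh C X)) (sh D (\<phi> X))"
    "is_zero C Z \<Longrightarrow> is_zero D (\<phi> Z)" "iso_objects C X Y \<Longrightarrow> iso_objects D (\<phi> X) (\<phi> Y)"
    "retract C X Y \<Longrightarrow> retract D (\<phi> X) (\<phi> Y)" "tri3 C X Y Z \<Longrightarrow> tri3 D (\<phi> X) (\<phi> Y) (\<phi> Z)"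
  using assms unfolding exact_on_objects_def by blast+

lemma exact_on_objects_id:
  assumes "triangulated_category K C" shows "exact_on_objects C C (\<lambda>X. X)"
proof -
  interpret triangulated_category K C by fact
  show ?thesis unfolding exact_on_objects_def using iso_refl Sh.onOb_closed by blast
qed

lemma exact_on_objects_comp:
  assumes E: "triangulated_category K E" and \<phi>: "exact_on_objects C D \<phi>" and \<psi>: "exact_on_objects D E \<psi>"
  shows "exact_on_objects C E (\<lambda>X. \<psi> (\<phi> X))"
proof -
  interpret E: triangulated_category K E by fact
  have "iso_objects E (\<psi> (\<phi> (sh C X))) (sh E (\<psi> (\<phi> X)))" if "X \<in> Ob C" for X
    using that exact_on_objectsD[OF \<phi>] exact_on_objectsD[OF \<psi>] E.iso_trans by meson
  then show ?thesis unfolding exact_on_objects_def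
    using exact_on_objectsD[OF \<phi>] exact_on_objectsD[OF \<psi>] by auto
qed

lemma exact_on_objects_funpow:
  assumes "triangulated_category K C" "exact_on_objects C C \<phi>"
  shows "exact_on_objects C C (\<phi> ^^ n)"
proof (induction n)
  case 0 then show ?case using exact_on_objects_id[OF assms(1)] by (simp add: id_def)
next
  case (Suc n) then show ?case using exact_on_objects_comp[OF assms(1) Suc assms(2)] by (simp add: comp_def)
qed

lemma exact_functor_exact_on_objects:
  assumes "triangulated_category K C" "triangulated_category K D" and F: "exact_functor K C D F"
  shows "exact_on_objects C D (onOb F)"
proof -
  interpret C: triangulated_category K C by fact
  interpret D: triangulated_category K D by fact
  interpret F: linear_functor K C D F using F unfolding exact_functor_def by blast
  obtain \<theta> where \<theta>: "nat_iso C D (F \<circ>\<^sub>F Shift C) (Shift D \<circ>\<^sub>F F) \<theta>"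
    and tri: "\<And>X Y Z f g h. Tri C X Y Z f g h \<Longrightarrow>
        Tri D (onOb F X) (onOb F Y) (onOb F Z) (onMor F X Y f) (onMor F Y Z g)
          (Cmp D (onOb F Z) (onOb F (sh C X)) (sh D (onOb F X)) (\<theta> X) (onMor F Z (sh C X) h))"
    using F unfolding exact_functor_def by blast
  have "iso_objects D (onOb F (sh C X)) (sh D (onOb F X))" if "X \<in> Ob C" for X
    using \<theta> that F.onOb_closed C.Sh.onOb_closed D.Sh.onOb_closed
    unfolding nat_iso_def iso_objects_def by auto
  moreover have "is_zero D (onOb F Z)" if "is_zero C Z" for Z
    using that by (rule linear_functor_is_zero[OF C.linear_category_axioms D.linear_category_axioms F.linear_functor_axioms])
  moreover have "tri3 D (onOb F X) (onOb F Y) (onOb F Z)" if "tri3 C X Y Z" for X Y Z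
    using that tri unfolding tri3_def by blast
  ultimately show ?thesis unfolding exact_on_objects_def
    using F.onOb_closed F.iso_objects_onOb F.retract_onOb by blast
qed

section \<open>Iterated shifts\<close>

abbreviation shn :: "('k, 'o, 'm, 'y) tricat_scheme \<Rightarrow> int \<Rightarrow> 'o \<Rightarrow> 'o" where
  "shn T n X \<equiv> onOb (shift_by T n) X"

lemma onOb_fcomp_funpow:
  fixes F :: "('o, 'm, 'o, 'm) cfun"
  shows "onOb ((fcomp F ^^ k) idfun) = (onOb F ^^ k)"
  by (induction k) (auto simp: fun_eq_iff)

lemma shn_eq: "shn T n = (if n \<ge> 0 then onOb (Shift T) ^^ nat n else onOb (Unshift T) ^^ nat (- n))"
  by (simp add: shift_by_def onOb_fcomp_funpow)

context triangulated_category
begin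

lemma exact_on_objects_sh: "exact_on_objects T T (onOb (Shift T))"
  unfolding exact_on_objects_def
  using Sh.onOb_closed iso_refl is_zero_sh Sh.iso_objects_onOb Sh.retract_onOb tri3_sh by blast

lemma exact_on_objects_unsh: "exact_on_objects T T (onOb (Unshift T))"
proof -
  have "iso_objects T (unsh T (sh T X)) (sh T (unsh T X))" if "X \<in> Ob T" for X
    using that unsh_sh sh_unsh iso_sym iso_trans by blast
  then show ?thesis unfolding exact_on_objects_def
    using Un.onOb_closed is_zero_unsh Un.iso_objects_onOb Un.retract_onOb tri3_unsh by blast
qed

lemma exact_on_objects_shn: "exact_on_objects T T (onOb (shift_by T n))"
  unfolding shn_eq
  using exact_on_objects_funpow[OF triangulated_category_axioms] exact_on_objects_sh exact_on_objects_unsh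
  by simp

lemmas shn_closed = exact_on_objectsD(1)[OF exact_on_objects_shn]

lemma shn_succ:
  assumes "X \<in> Ob T"
  shows "iso_objects T (shn T (n + 1) X) (sh T (shn T n X))"
proof (cases "n \<ge> 0")
  case True
  then have "nat (n + 1) = Suc (nat n)" by simp
  then have "shn T (n + 1) X = sh T (shn T n X)" using True by (simp add: shn_eq)
  then show ?thesis using assms shn_closed iso_refl by metis
next
  case False
  define m where "m = nat (- (n + 1))"
  have "nat (- n) = Suc m" using False by (simp add: m_def)
  then have n: "shn T n X = unsh T ((onOb (Unshift T) ^^ m) X)" using False by (simp add: shn_eq)
  have n1: "shn T (n + 1) X = (onOb (Unshift T) ^^ m) X"
  \<comment> \<open>For n = -1 the index n + 1 = 0 already belongs to the nonnegative branch of
    \<open>shift_by\<close>.\<close>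
  proof (cases "n = -1")
    case True then show ?thesis by (simp add: shn_eq m_def)
  next
    case neq: False then show ?thesis using False by (simp add: shn_eq m_def)
  qed
  then have "(onOb (Unshift T) ^^ m) X \<in> Ob T" using assms shn_closed by metis
  then show ?thesis unfolding n n1 using sh_unsh iso_sym by blast
qed

lemma shn_0 [simp]: "shn T 0 X = X" by (simp add: shn_eq)

text \<open>An integer-indexed family of objects in which each term is the shift of its predecessor
  is determined by its term at 0. Downward induction cancels a shift. This replaces sign case
  distinctions for sums of shifts and for commutation with exact functors.\<close>

lemma shn_unique:
  fixes n :: int
  assumes a: "\<And>n. a n \<in> Ob T" "\<And>n. iso_objects T (a (n + 1)) (sh T (a n))"
    and b: "\<And>n. b n \<in> Ob T" "\<And>n. iso_objects T (b (n + 1)) (sh T (b n))"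
    and 0: "iso_objects T (a 0) (b 0)"
  shows "iso_objects T (a n) (b n)"
proof (induction n rule: int_induct[of _ 0])
  case base show ?case by (rule 0)
next
  case (step1 i)
  then have "iso_objects T (sh T (a i)) (sh T (b i))" using Sh.iso_objects_onOb by blast
  then show ?case using a(2)[of i] b(2)[of i] iso_sym iso_trans by blast
next
  case (step2 i)
  have "iso_objects T (sh T (a (i - 1))) (a i)" "iso_objects T (b i) (sh T (b (i - 1)))"
    using a(2)[of "i - 1"] b(2)[of "i - 1"] iso_sym by auto
  then have "iso_objects T (sh T (a (i - 1))) (sh T (b (i - 1)))" using step2 iso_trans by blast
  then show ?case using a b sh_iso_cancel by blast
qed

lemma shn_add:
  assumes X: "X \<in> Ob T"
  shows "iso_objects T (shn T (m + n) X) (shn T m (shn T n X))"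
proof (rule shn_unique[where a = "\<lambda>m. shn T (m + n) X" and b = "\<lambda>m. shn T m (shn T n X)"])
  show "iso_objects T (shn T (m + 1 + n) X) (sh T (shn T (m + n) X))" for m
    using shn_succ[OF X, of "m + n"] by (simp add: algebra_simps)
qed (use X shn_closed shn_succ iso_refl in auto)

end

lemma exact_on_objects_shn_commute:
  assumes "triangulated_category K C" "triangulated_category K D" and \<phi>: "exact_on_objects C D \<phi>"
    and X: "X \<in> Ob C"
  shows "iso_objects D (\<phi> (shn C n X)) (shn D n (\<phi> X))"
proof -
  interpret C: triangulated_category K C by fact
  interpret D: triangulated_category K D by fact
  show ?thesis
  proof (rule D.shn_unique[where a = "\<lambda>n. \<phi> (shn C n X)" and b = "\<lambda>n. shn D n (\<phi> X)"])
    fix n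
    have "iso_objects D (\<phi> (shn C (n + 1) X)) (\<phi> (sh C (shn C n X)))"
      using C.shn_succ[OF X] exact_on_objectsD(4)[OF \<phi>] by blast
    then show "iso_objects D (\<phi> (shn C (n + 1) X)) (sh D (\<phi> (shn C n X)))"
      using exact_on_objectsD(2)[OF \<phi>] C.shn_closed[OF X] D.iso_trans by blast
  qed (use X exact_on_objectsD(1)[OF \<phi>] C.shn_closed D.shn_closed D.shn_succ D.iso_refl in auto)
qed

section \<open>Towers and complexity\<close>

text \<open>Of the filtration in a generation sequence only the top object is kept as an argument,
  so extension arguments become inductions on the last step.\<close>

inductive tower :: "('k, 'o, 'm, 'y) tricat_scheme \<Rightarrow> 'o \<Rightarrow> int list \<Rightarrow> 'o \<Rightarrow> bool" for T E where
  tower_Nil: "is_zero T Z \<Longrightarrow> tower T E [] Z"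
| tower_snoc: "\<lbrakk>tower T E ns Y; tri3 T Y X (shn T n E)\<rbrakk> \<Longrightarrow> tower T E (ns @ [n]) X"

lemma tower_imp_chain:
  "tower T E ns X \<Longrightarrow> \<exists>A. is_zero T (A 0) \<and> A (length ns) = X \<and>
    (\<forall>i<length ns. tri3 T (A i) (A (Suc i)) (shn T (ns ! i) E))"
proof (induction rule: tower.induct)
  case (tower_Nil Z) then show ?case by (auto intro: exI[of _ "\<lambda>_. Z"])
next
  case (tower_snoc ns Y X n)
  then obtain A where A: "is_zero T (A 0)" "A (length ns) = Y"
    "\<And>i. i < length ns \<Longrightarrow> tri3 T (A i) (A (Suc i)) (shn T (ns ! i) E)" by blast
  show ?case
    by (rule exI[of _ "A(Suc (length ns) := X)"])
      (use A tower_snoc(2) in \<open>auto simp: less_Suc_eq nth_append\<close>)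
qed

lemma chain_imp_tower:
  assumes A: "is_zero T (A 0)" "\<And>i. i < length ns \<Longrightarrow> tri3 T (A i) (A (Suc i)) (shn T (ns ! i) E)"
  shows "tower T E ns (A (length ns))"
proof -
  have "tower T E (take k ns) (A k)" if "k \<le> length ns" for k
    using that
  proof (induction k)
    case 0 then show ?case using A by (simp add: tower_Nil)
  next
    case (Suc k) then show ?case using A by (simp add: take_Suc_conv_app_nth tower_snoc)
  qed
  from this[of "length ns"] show ?thesis by simp
qed

lemma (in triangulated_category) generation_sequence_iff:
  "generation_sequence T E F ns \<longleftrightarrow> (\<exists>P. tower T E ns P \<and> retract T F P)"
proof
  assume "generation_sequence T E F ns"
  then obtain F' A where A: "is_zero T (A 0)" "is_direct_sum T F F' (A (length ns))"
    "\<And>i. i < length ns \<Longrightarrow> tri3 T (A i) (A (Suc i)) (shn T (ns ! i) E)"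
    unfolding generation_sequence_def tri3_def by blast
  then show "\<exists>P. tower T E ns P \<and> retract T F P"
    using chain_imp_tower[of T A ns E] retract_iff_direct_sum by blast
next
  assume "\<exists>P. tower T E ns P \<and> retract T F P"
  then obtain P F' where "tower T E ns P" "is_direct_sum T F F' P" using retract_iff_direct_sum by blast
  then show "generation_sequence T E F ns"
    using tower_imp_chain unfolding generation_sequence_def tri3_def by metis
qed

section \<open>Concatenation of towers\<close>

context triangulated_category
begin

lemma tower_iso:
  assumes "tower T E ns X" and iso: "iso_objects T X X'"
  shows "tower T E ns X'"
  using assms(1)
proof (cases rule: tower.cases)
  case tower_Nil
  then show ?thesis using is_zero_iso_cong[OF iso_sym[OF iso]] by (simp add: tower.tower_Nil)
next
  case (tower_snoc ns' Y n)
  have "tri3 T Y X' (shn T n E)"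
    using tri3_cong[OF tower_snoc(3)] iso tri3_closed[OF tower_snoc(3)] iso_refl by blast
  with tower_snoc(1,2) show ?thesis by (simp add: tower.tower_snoc)
qed

text \<open>The filtration of the quotient Y lifts to objects between X and Z: the octahedral axiom
  peels off the last step of Y and leaves an extension of X by the previous stage.\<close>

lemma tower_append:
  assumes "tower T E ms Y" "tower T E ns X" "tri3 T X Z Y"
  shows "tower T E (ns @ ms) Z"
  using assms(1,3)
proof (induction arbitrary: Z rule: tower.induct)
  case (tower_Nil O')
  then show ?case using tri3_zero_last tower_iso assms(2) by auto
next
  case (tower_snoc ms Y' Y m)
  then obtain Z' where "tri3 T X Z' Y'" "tri3 T Z' Z (shn T m E)" using tri3_octahedral by blast
  then show ?case using tower_snoc(3) tower.tower_snoc[of T E "ns @ ms" Z' Z m] by simp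
qed

lemma tower_unshift:
  assumes "tower T (shn T m E) ns X" "E \<in> Ob T"
  shows "tower T E (map ((+) m) ns) X"
  using assms(1)
proof (induction rule: tower.induct)
  case (tower_Nil Z) then show ?case by (simp add: tower.tower_Nil)
next
  case (tower_snoc ns Y X n)
  have "iso_objects T (shn T n (shn T m E)) (shn T (m + n) E)"
    using iso_sym[OF shn_add[OF assms(2), of n m]] by (simp add: add.commute)
  then have "tri3 T Y X (shn T (m + n) E)"
    using tri3_cong[OF tower_snoc(2)] tri3_closed[OF tower_snoc(2)] iso_refl by blast
  then show ?case using tower_snoc(3) tower.tower_snoc[of T E "map ((+) m) ns" Y X "m + n"] by simp
qed

end

lemma tower_exact:
  assumes "triangulated_category K C" "triangulated_category K D" and \<phi>: "exact_on_objects C D \<phi>"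
    and E: "E \<in> Ob C" and t: "tower C E ns X"
  shows "tower D (\<phi> E) ns (\<phi> X)"
  using t
proof (induction rule: tower.induct)
  case (tower_Nil Z) then show ?case by (intro tower.tower_Nil exact_on_objectsD(3)[OF \<phi>])
next
  case (tower_snoc ns Y X n)
  interpret C: triangulated_category K C by fact
  interpret D: triangulated_category K D by fact
  have "tri3 D (\<phi> Y) (\<phi> X) (shn D n (\<phi> E))"
    using D.tri3_cong[OF exact_on_objectsD(6)[OF \<phi> tower_snoc(2)]] D.iso_refl
      exact_on_objects_shn_commute[OF assms(1-4)] exact_on_objectsD(1)[OF \<phi>]
      C.tri3_closed[OF tower_snoc(2)] by blast
  with tower_snoc(3) show ?case by (rule tower.tower_snoc)
qed

section \<open>Transitivity of generation\<close>

context triangulated_category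
begin

lemma tower_shn:
  assumes "tower T E ns X" "E \<in> Ob T"
  shows "tower T E (map ((+) m) ns) (shn T m X)"
  using tower_unshift[OF tower_exact[OF triangulated_category_axioms triangulated_category_axioms
    exact_on_objects_shn assms(2,1)] assms(2)] .

text \<open>Each step F[m] is a retract of P[m], which is filtered by the E[m + n]. Replacing F[m]
  by P[m] enlarges the stage built so far, which is why the result contains Q only as a
  retract.\<close>

lemma tower_refine:
  assumes F: "tower T E ns P" "retract T F P" and E: "E \<in> Ob T" and "tower T F ms Q"
  shows "\<exists>Q'. tower T E (concat (map (\<lambda>m. map ((+) m) ns) ms)) Q' \<and> retract T Q Q'"
  using assms(4)
proof (induction rule: tower.induct)
  case (tower_Nil Z)
  then show ?case using tower.tower_Nil[OF tower_Nil, of E] retract_refl[of Z] by (auto simp: is_zero_def)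
next
  case (tower_snoc ms Y X m)
  then obtain Y' where Y': "tower T E (concat (map (\<lambda>m. map ((+) m) ns) ms)) Y'" "retract T Y Y'" by blast
  have "retract T (shn T m F) (shn T m P)" using exact_on_objectsD(5)[OF exact_on_objects_shn F(2)] .
  then obtain V where V: "tri3 T Y' V (shn T m P)" "retract T X V"
    using tri3_retract_middle[OF tower_snoc(2) Y'(2)] by blast
  then show ?case using tower_append[OF tower_shn[OF F(1) E] Y'(1) V(1)] by auto
qed

lemma generation_sequence_trans:
  assumes "generation_sequence T E F ns" "generation_sequence T F G ms" "E \<in> Ob T"
  shows "generation_sequence T E G (concat (map (\<lambda>m. map ((+) m) ns) ms))"
  using assms tower_refine retract_trans unfolding generation_sequence_iff by meson

lemma generation_sequence_extension:
  assumes "generation_sequence T E X ns" "generation_sequence T E Y ms" "tri3 T X Z Y"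
  shows "generation_sequence T E Z (ns @ ms)"
proof -
  obtain P Q where "tower T E ns P" "retract T X P" "tower T E ms Q" "retract T Y Q"
    using assms unfolding generation_sequence_iff by blast
  moreover then obtain V where "tri3 T P V Q" "retract T Z V"
    using tri3_retract_middle assms(3) by blast
  ultimately show ?thesis unfolding generation_sequence_iff using tower_append by blast
qed

lemma generation_sequence_retract:
  "\<lbrakk>generation_sequence T E F ns; retract T F' F\<rbrakk> \<Longrightarrow> generation_sequence T E F' ns"
  unfolding generation_sequence_iff using retract_trans by blast

lemma generation_sequence_refl:
  assumes "E \<in> Ob T" shows "generation_sequence T E E [0]"
proof -
  obtain Z where Z: "is_zero T Z" using ex_zero by blast
  then have "tower T E ([] @ [0]) E"
    by (intro tower_snoc[of T E "[]" Z] tower_Nil) (simp_all add: tri3_zero_id assms)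
  then show ?thesis unfolding generation_sequence_iff using retract_refl assms by auto
qed

lemma generation_sequence_zero: "is_zero T Z \<Longrightarrow> generation_sequence T E Z []"
  unfolding generation_sequence_iff using tower_Nil retract_refl is_zero_def by metis

lemma generation_sequence_shn:
  assumes "generation_sequence T E F ns" "E \<in> Ob T"
  shows "generation_sequence T E (shn T m F) (map ((+) m) ns)"
  using assms tower_shn exact_on_objectsD(5)[OF exact_on_objects_shn] unfolding generation_sequence_iff by meson

text \<open>The objects that admit a generation sequence from G form a thick set containing G, hence
  are all objects.\<close>

lemma generation_sequence_exists:
  assumes G: "split_generator T G" and F: "F \<in> Ob T"
  shows "\<exists>ns. generation_sequence T G F ns"
proof -
  let ?U = "{F \<in> Ob T. \<exists>ns. generation_sequence T G F ns}"
  have G': "G \<in> Ob T" using G by (simp add: split_generator_def)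
  have sh: "sh T X \<in> ?U" if "X \<in> ?U" for X
  proof -
    from that obtain ns where "generation_sequence T G X ns" by blast
    from generation_sequence_shn[OF this G', of "1"]
    have "\<exists>ns. generation_sequence T G (shn T 1 X) ns" by blast
    then show ?thesis using that Sh.onOb_closed by (auto simp: shn_eq)
  qed
  have unsh: "unsh T X \<in> ?U" if "X \<in> ?U" for X
  proof -
    from that obtain ns where "generation_sequence T G X ns" by blast
    from generation_sequence_shn[OF this G', of "-1"]
    have "\<exists>ns. generation_sequence T G (shn T (-1) X) ns" by blast
    then show ?thesis using that Un.onOb_closed by (auto simp: shn_eq)
  qed
  have "thick T ?U" unfolding thick_def
  proof (intro conjI allI ballI impI subsetI, goal_cases)
    case (2 Z) then show ?case using generation_sequence_zero by (auto simp: is_zero_def)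
  next
    \<comment> \<open>The third vertex Z is an extension of X[1] by Y, so closure under cones
      reduces to closure under shifts and extensions.\<close>
    case (5 X Y Z f g h)
    then have "tri3 T Y Z (sh T X)" using tri3_rotate unfolding tri3_def by blast
    moreover have "sh T X \<in> ?U" using sh 5 by blast
    ultimately show ?case using 5 generation_sequence_extension tri3_closed by blast
  next
    case (6 X X' W)
    then have ret: "retract T X W" using retract_iff_direct_sum by blast
    then have "X \<in> Ob T" by (simp add: retract_def)
    then show ?case using generation_sequence_retract[OF _ ret] 6 by blast
  qed (use sh unsh in auto)
  moreover have "G \<in> ?U" using generation_sequence_refl G' by blast
  ultimately have "F \<in> ?U" using G F unfolding split_generator_def by blast
  then show ?thesis by blast
qed

end

lemma generation_sequence_exact:
  assumes "triangulated_category K C" "triangulated_category K D" and \<phi>: "exact_on_objects C D \<phi>"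
    and E: "E \<in> Ob C" and t: "generation_sequence C E F ns"
  shows "generation_sequence D (\<phi> E) (\<phi> F) ns"
  using t tower_exact[OF assms(1-4)] exact_on_objectsD(5)[OF \<phi>]
  unfolding triangulated_category.generation_sequence_iff[OF assms(1)]
    triangulated_category.generation_sequence_iff[OF assms(2)] by blast

section \<open>Weights and estimates for the complexity\<close>

definition weight :: "real \<Rightarrow> int list \<Rightarrow> real" where
  "weight t ns = (\<Sum>n\<leftarrow>ns. exp (real_of_int n * t))"

lemma weight_append: "weight t (ns @ ms) = weight t ns + weight t ms"
  by (simp add: weight_def)

lemma weight_nonneg: "weight t ns \<ge> 0"
  unfolding weight_def by (rule sum_list_nonneg) auto

lemma weight_shift: "weight t (map ((+) m) ns) = exp (real_of_int m * t) * weight t ns"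
  by (induction ns) (simp_all add: weight_def exp_add algebra_simps)

text \<open>The double sum of exp ((m + n) t) factors. Together with
  \<open>generation_sequence_trans\<close> this is the source of submultiplicativity.\<close>

lemma weight_concat: "weight t (concat (map (\<lambda>m. map ((+) m) ns) ms)) = weight t ns * weight t ms"
proof (induction ms)
  case (Cons m ms) then show ?case
    by (simp add: weight_append weight_shift) (simp add: weight_def algebra_simps)
qed (simp add: weight_def)

context triangulated_category
begin

text \<open>The case distinction in \<open>complexity\<close> is redundant: the empty sequence generates a zero object.\<close>

lemma complexity_eq: "complexity T t E F = (INF ns\<in>{ns. generation_sequence T E F ns}. ennreal (weight t ns))"
proof (cases "is_zero T F")
  case True
  then have "(INF ns\<in>{ns. generation_sequence T E F ns}. ennreal (weight t ns)) \<le> ennreal (weight t [])"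
    using generation_sequence_zero by (intro INF_lower) simp
  then show ?thesis using True by (simp add: complexity_def weight_def)
qed (simp add: complexity_def weight_def)

lemma complexity_le: "generation_sequence T E F ns \<Longrightarrow> complexity T t E F \<le> ennreal (weight t ns)"
  unfolding complexity_eq by (rule INF_lower) simp

lemma complexity_less_iff:
  "complexity T t E F < c \<longleftrightarrow> (\<exists>ns. generation_sequence T E F ns \<and> ennreal (weight t ns) < c)"
  unfolding complexity_eq INF_less_iff by auto

lemma complexity_finite: "\<lbrakk>split_generator T G; F \<in> Ob T\<rbrakk> \<Longrightarrow> complexity T t G F < \<infinity>"
  unfolding complexity_less_iff using generation_sequence_exists by auto

lemma complexity_retract:
  "retract T F' F \<Longrightarrow> complexity T t E F' \<le> complexity T t E F"
  unfolding complexity_eq by (rule INF_superset_mono) (auto intro: generation_sequence_retract)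

lemma complexity_iso: "iso_objects T F F' \<Longrightarrow> complexity T t E F = complexity T t E F'"
  by (meson antisym complexity_retract iso_retract iso_sym)

text \<open>Without finiteness this fails for \<open>F\<close> zero and \<open>G\<close> nonzero, where the right-hand side is
  \<open>0 * \<infinity> = 0\<close>.\<close>

lemma complexity_submult:
  assumes fin: "complexity T t E F < \<infinity>" "complexity T t F G < \<infinity>" and E: "E \<in> Ob T"
  shows "complexity T t E G \<le> complexity T t E F * complexity T t F G"
proof -
  obtain a b where ab: "complexity T t E F = ennreal a" "a \<ge> 0" "complexity T t F G = ennreal b" "b \<ge> 0"
    using fin by (cases "complexity T t E F"; cases "complexity T t F G") (auto simp: infinity_ennreal_def)
  \<comment> \<open>The infima need not be attained, so both factors get slack e, which is removed
    by letting e tend to 0 from the right.\<close>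
  have le: "complexity T t E G \<le> ennreal ((a + e) * (b + e))" if "e > 0" for e
  proof -
    have "complexity T t E F < ennreal (a + e)" "complexity T t F G < ennreal (b + e)"
      using ab that by (simp_all add: ennreal_less_iff)
    then obtain ns ms where *: "generation_sequence T E F ns" "ennreal (weight t ns) < ennreal (a + e)"
      "generation_sequence T F G ms" "ennreal (weight t ms) < ennreal (b + e)"
      unfolding complexity_less_iff by blast
    then have "weight t ns \<le> a + e" "weight t ms \<le> b + e"
      using ennreal_less_iff[OF weight_nonneg] less_imp_le by blast+
    then have "weight t ns * weight t ms \<le> (a + e) * (b + e)"
      using weight_nonneg ab(2,4) that by (intro mult_mono) auto
    then have "ennreal (weight t (concat (map (\<lambda>m. map ((+) m) ns) ms))) \<le> ennreal ((a + e) * (b + e))"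
      by (simp add: weight_concat ennreal_leI)
    then show ?thesis using complexity_le[OF generation_sequence_trans[OF *(1,3) E]] order_trans by blast
  qed
  have "((\<lambda>e. (a + e) * (b + e)) \<longlongrightarrow> (a + 0) * (b + 0)) (at_right 0)"
    by (intro tendsto_intros)
  then have "((\<lambda>e. ennreal ((a + e) * (b + e))) \<longlongrightarrow> ennreal ((a + 0) * (b + 0))) (at_right 0)"
    by (rule tendsto_ennrealI)
  moreover have "\<forall>\<^sub>F e in at_right 0. complexity T t E G \<le> ennreal ((a + e) * (b + e))"
    using le eventually_at_right_less[of 0] by (auto elim: eventually_mono)
  ultimately have "complexity T t E G \<le> ennreal ((a + 0) * (b + 0))"
    using tendsto_lowerbound trivial_limit_at_right_real by blast
  then show ?thesis using ab by (simp add: ennreal_mult)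
qed

text \<open>Sequences for X and Y within e / 2 of their infima concatenate to a sequence for
  Z.\<close>

lemma complexity_extension:
  assumes "tri3 T X Z Y"
  shows "complexity T t E Z \<le> complexity T t E X + complexity T t E Y"
proof (rule ennreal_le_epsilon)
  fix e :: real assume fin: "complexity T t E X + complexity T t E Y < Orderings.top_class.top" and e: "e > 0"
  obtain a b where ab: "complexity T t E X = ennreal a" "a \<ge> 0" "complexity T t E Y = ennreal b" "b \<ge> 0"
    using fin by (cases "complexity T t E X"; cases "complexity T t E Y") (auto simp: infinity_ennreal_def)
  have "complexity T t E X < ennreal (a + e / 2)" "complexity T t E Y < ennreal (b + e / 2)"
    using ab e by (simp_all add: ennreal_less_iff)
  then obtain ns ms where *: "generation_sequence T E X ns" "ennreal (weight t ns) < ennreal (a + e / 2)"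
    "generation_sequence T E Y ms" "ennreal (weight t ms) < ennreal (b + e / 2)"
    unfolding complexity_less_iff by blast
  have "complexity T t E Z \<le> ennreal (weight t (ns @ ms))"
    using complexity_le generation_sequence_extension[OF *(1,3) assms] by blast
  also have "\<dots> \<le> ennreal (a + b + e)"
    using *(2,4) weight_nonneg[of t] by (intro ennreal_leI) (auto simp: weight_append ennreal_less_iff)
  also have "\<dots> = complexity T t E X + complexity T t E Y + ennreal e" using ab e by simp
  finally show "complexity T t E Z \<le> complexity T t E X + complexity T t E Y + ennreal e" .
qed

end

text \<open>An exact functor carries a generation sequence to one with the same integers, so the
  infimum on the left runs over a larger set.\<close>

lemma complexity_exact:
  assumes "triangulated_category K C" "triangulated_category K D" and \<phi>: "exact_on_objects C D \<phi>"
    and E: "E \<in> Ob C"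
  shows "complexity D t (\<phi> E) (\<phi> F) \<le> complexity C t E F"
  unfolding triangulated_category.complexity_eq[OF assms(1)] triangulated_category.complexity_eq[OF assms(2)]
  by (rule INF_superset_mono) (auto intro: generation_sequence_exact[OF assms])

section \<open>Exponential growth rates\<close>

lemma eln_le: "\<lbrakk>a \<le> ennreal r; r > 0\<rbrakk> \<Longrightarrow> eln a \<le> ereal (ln r)"
  by (cases a) (auto simp: eln_def ennreal_le_iff ln_mono top_unique)

lemma subadditive_mult_le:
  fixes x :: "nat \<Rightarrow> real"
  assumes "\<And>m n. x (m + n) \<le> x m + x n"
  shows "x (q * m + r) \<le> real q * x m + x r"
proof (induction q)
  case (Suc q)
  have "x (Suc q * m + r) \<le> x m + x (q * m + r)" using assms[of m "q * m + r"] by (simp add: ac_simps)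
  then show ?case using Suc by (simp add: algebra_simps)
qed simp

text \<open>Fekete's lemma, stated in the extended reals because the infimum may be minus
  infinity.\<close>

lemma subadditive_tendsto_INF:
  fixes x :: "nat \<Rightarrow> real"
  assumes sub: "\<And>m n. x (m + n) \<le> x m + x n"
  shows "(\<lambda>n. ereal (x n / real n)) \<longlonglongrightarrow> (INF n\<in>{1..}. ereal (x n / real n))"
proof (rule order_tendstoI)
  fix l assume "l < (INF n\<in>{1..}. ereal (x n / real n))"
  from less_INF_D[OF this] have "l < ereal (x n / real n)" if "n \<ge> 1" for n using that by simp
  then show "\<forall>\<^sub>F n in sequentially. l < ereal (x n / real n)"
    unfolding eventually_sequentially by blast
next
  fix u assume "(INF n\<in>{1..}. ereal (x n / real n)) < u"
  then obtain m where m: "m \<ge> 1" "ereal (x m / real m) < u" unfolding INF_less_iff by auto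
  then obtain v where v: "x m / real m < v" "ereal v < u" using ereal_dense2 ereal_less by (metis less_ereal.simps(1))
  \<comment> \<open>After division with remainder by m, the first summand bounds the error of
    replacing n div m by n / m, and the second bounds the value of x at the remainder.\<close>
  define M where "M = \<bar>x m\<bar> + (\<Sum>r<m. \<bar>x r\<bar>)"
  have bound: "x n / real n \<le> x m / real m + M / real n" if n: "n \<ge> 1" for n
  proof -
    have "x n \<le> real (n div m) * x m + x (n mod m)"
      using subadditive_mult_le[of x, OF sub, of "n div m" m "n mod m"] by simp
    moreover have "x (n mod m) \<le> (\<Sum>r<m. \<bar>x r\<bar>)"
      using member_le_sum[of "n mod m" "{..<m}" "\<lambda>r. \<bar>x r\<bar>"] m by simp
    moreover have "real (n div m) * x m \<le> real n * (x m / real m) + \<bar>x m\<bar>"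
    proof -
      have "real n / real m - real (n div m) = real (n mod m) / real m"
        using m by (simp add: real_of_nat_div field_simps flip: of_nat_mult of_nat_add)
      then have "\<bar>real (n div m) - real n / real m\<bar> \<le> 1" using m by (simp add: field_simps)
      then have "\<bar>real (n div m) - real n / real m\<bar> * \<bar>x m\<bar> \<le> 1 * \<bar>x m\<bar>" by (rule mult_right_mono) simp
      then have "(real (n div m) - real n / real m) * x m \<le> \<bar>x m\<bar>" by (simp add: abs_mult[symmetric])
      then show ?thesis by (simp add: algebra_simps)
    qed
    ultimately have "x n \<le> real n * (x m / real m) + M" by (simp add: M_def)
    then show ?thesis using n by (simp add: field_simps)
  qed
  have "(\<lambda>n. x m / real m + M / real n) \<longlonglongrightarrow> x m / real m + 0"
    by (intro tendsto_add tendsto_const lim_const_over_n)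
  then have "\<forall>\<^sub>F n in sequentially. x m / real m + M / real n < v"
    using v(1) by (intro order_tendstoD(2)) simp_all
  then show "\<forall>\<^sub>F n in sequentially. ereal (x n / real n) < u"
    using eventually_ge_at_top[of 1]
  proof eventually_elim
    case (elim n)
    then have "x n / real n < v" using bound[of n] by simp
    then have "ereal (x n / real n) < ereal v" by simp
    then show ?case using v(2) by (rule less_trans)
  qed
qed

text \<open>Fekete's lemma applied to logarithms. A zero value is treated separately:
  submultiplicativity propagates it to all later indices and the limit is minus infinity.\<close>

lemma submultiplicative_eln_convergent:
  assumes sub: "\<And>m n. a (m + n) \<le> a m * a n" and fin: "\<And>n. a n < \<infinity>"
  shows "\<exists>h. (\<lambda>n. eln (a n) / ereal (real n)) \<longlonglongrightarrow> h"
proof (cases "\<exists>m. a m = 0")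
  case True
  then obtain m where "a m = 0" by blast
  then have z: "a n = 0" if "n \<ge> m" for n using sub[of m "n - m"] that by simp
  have "\<forall>\<^sub>F n in sequentially. eln (a n) / ereal (real n) = -\<infinity>"
    using eventually_ge_at_top[of "Suc m"] by eventually_elim (simp add: z eln_def)
  then have "(\<lambda>n. eln (a n) / ereal (real n)) \<longlonglongrightarrow> -\<infinity>" by (rule tendsto_eventually)
  then show ?thesis by blast
next
  case False
  define x where "x n = ln (enn2real (a n))" for n
  have a: "enn2real (a n) > 0" for n using False fin[of n] by (simp add: enn2real_positive_iff zero_less_iff_neq_zero)
  have "x (m + n) \<le> x m + x n" for m n
  proof -
    have "enn2real (a (m + n)) \<le> enn2real (a m * a n)"
      using sub fin by (intro enn2real_mono) (auto simp: ennreal_mult_less_top)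
    then have "ln (enn2real (a (m + n))) \<le> ln (enn2real (a m) * enn2real (a n))"
      using a by (simp add: enn2real_mult)
    then show ?thesis using less_imp_neq[OF a, symmetric] by (simp add: x_def ln_mult)
  qed
  then have "(\<lambda>n. ereal (x n / real n)) \<longlonglongrightarrow> (INF n\<in>{1..}. ereal (x n / real n))"
    by (rule subadditive_tendsto_INF)
  moreover have "\<forall>\<^sub>F n in sequentially. ereal (x n / real n) = eln (a n) / ereal (real n)"
    using eventually_ge_at_top[of 1]
  proof eventually_elim
    case (elim n)
    have "a n \<noteq> 0" "a n \<noteq> \<infinity>" using False fin[of n] by auto
    then show ?case using elim by (simp add: eln_def x_def)
  qed
  ultimately have "(\<lambda>n. eln (a n) / ereal (real n)) \<longlonglongrightarrow> (INF n\<in>{1..}. ereal (x n / real n))"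
    by (rule Lim_transform_eventually)
  then show ?thesis by blast
qed

text \<open>Polynomial factors disappear after taking logarithms and dividing by n. The factor n + 1
  leaves room for a sum of n terms.\<close>

lemma eln_limit_le:
  assumes lim: "(\<lambda>n. eln (a n) / ereal (real n)) \<longlonglongrightarrow> h" and M: "M > 0"
    and le: "\<forall>\<^sub>F n in sequentially. a n \<le> ennreal (M * (real n + 1) * exp (r * real n))"
  shows "h \<le> ereal r"
proof (rule tendsto_le[OF _ _ lim])
  show "sequentially \<noteq> bot" by simp
  have "(\<lambda>n. (ln M + ln (real n + 1) + r * real n) / real n) \<longlonglongrightarrow> r" by real_asymp
  then show "(\<lambda>n. ereal ((ln M + ln (real n + 1) + r * real n) / real n)) \<longlonglongrightarrow> ereal r"
    by (rule tendsto_ereal)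
  show "\<forall>\<^sub>F n in sequentially. eln (a n) / ereal (real n) \<le> ereal ((ln M + ln (real n + 1) + r * real n) / real n)"
    using le eventually_ge_at_top[of 1]
  proof eventually_elim
    case (elim n)
    have "eln (a n) \<le> ereal (ln (M * (real n + 1) * exp (r * real n)))"
      using elim M by (intro eln_le) auto
    also have "ln (M * (real n + 1) * exp (r * real n)) = ln M + ln (real n + 1) + r * real n"
      using M by (simp add: ln_mult)
    finally have "eln (a n) / ereal (real n) \<le> ereal (ln M + ln (real n + 1) + r * real n) / ereal (real n)"
      using elim by (intro ereal_divide_right_mono) auto
    then show ?case using elim by simp
  qed
qed

lemma eventually_le_exp_of_eln_limit:
  assumes lim: "(\<lambda>n. eln (b n) / ereal (real n)) \<longlonglongrightarrow> h" and r: "h < ereal r"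
  shows "\<forall>\<^sub>F n in sequentially. b n \<le> ennreal (exp (r * real n))"
  using order_tendstoD(2)[OF lim r] eventually_ge_at_top[of 1]
proof eventually_elim
  case (elim n)
  show ?case
  proof (cases "b n = 0 \<or> b n = \<infinity>")
    case True then show ?thesis using elim by (auto simp: eln_def)
  next
    case False
    then obtain x where x: "b n = ennreal x" "x > 0" by (cases "b n") (auto simp: less_le)
    then have "ln x / real n < r" using elim False by (simp add: eln_def)
    then have "ln x < r * real n" using elim by (simp add: field_simps)
    then have "x \<le> exp (r * real n)" using x(2) by (metis exp_le_cancel_iff exp_ln less_imp_le)
    then show ?thesis using x by (simp add: ennreal_leI)
  qed
qed

lemma eln_limit_mono:
  assumes a: "(\<lambda>n. eln (a n) / ereal (real n)) \<longlonglongrightarrow> h" and b: "(\<lambda>n. eln (b n) / ereal (real n)) \<longlonglongrightarrow> h'"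
    and le: "\<And>n. a n \<le> c * b n" and c: "c < \<infinity>"
  shows "h \<le> h'"
proof (rule ccontr)
  assume "\<not> h \<le> h'"
  then obtain r where r: "h' < ereal r" "ereal r < h" using ereal_dense2[of h' h] by (auto simp: not_le)
  obtain c' where c': "c = ennreal c'" "c' \<ge> 0" using c by (cases c) auto
  \<comment> \<open>The summand 1 in c' + 1 gives the positive constant that
    \<open>eln_limit_le\<close> requires even if c' = 0; the factor n + 1 is slack matching its
    form.\<close>
  have "\<forall>\<^sub>F n in sequentially. a n \<le> ennreal ((c' + 1) * (real n + 1) * exp (r * real n))"
    using eventually_le_exp_of_eln_limit[OF b r(1)]
  proof eventually_elim
    case (elim n)
    have "a n \<le> ennreal c' * ennreal (exp (r * real n))"
      using order_trans[OF le mult_left_mono[OF elim]] c' by simp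
    also have "\<dots> = ennreal (c' * 1 * exp (r * real n))" using c' by (simp add: ennreal_mult)
    also have "\<dots> \<le> ennreal ((c' + 1) * (real n + 1) * exp (r * real n))"
      using c' by (intro ennreal_leI mult_right_mono mult_mono) auto
    finally show ?case .
  qed
  from eln_limit_le[OF a _ this] have "h \<le> ereal r" using c' by simp
  then show False using r by simp
qed

text \<open>For a real rate r > \<open>max 0 h'\<close>, positivity of r makes exp (r k) increasing,
  so every term with k < n is at most a constant times exp (r n), and n such terms cost only a
  linear factor. The additive constant is absorbed in the same way.\<close>

lemma eln_limit_sum_le:
  assumes a: "(\<lambda>n. eln (a n) / ereal (real n)) \<longlonglongrightarrow> h" and b: "(\<lambda>n. eln (b n) / ereal (real n)) \<longlonglongrightarrow> h'"
    and le: "\<And>n. a n \<le> c\<^sub>0 + c * (\<Sum>k<n. b k)"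
    and c: "c\<^sub>0 < \<infinity>" "c < \<infinity>" and fin: "\<And>n. b n < \<infinity>"
  shows "h \<le> max 0 h'"
proof (rule ccontr)
  assume "\<not> h \<le> max 0 h'"
  then obtain r where r: "max 0 h' < ereal r" "ereal r < h" using ereal_dense2[of "max 0 h'" h] by (auto simp: not_le)
  then have r0: "r > 0" and r': "h' < ereal r" by (auto simp: zero_ereal_def)
  obtain c' where c': "c = ennreal c'" "c' \<ge> 0" using c by (cases c) auto
  obtain d where d: "c\<^sub>0 = ennreal d" "d \<ge> 0" using c by (cases c\<^sub>0) auto
  define x where "x n = enn2real (b n)" for n
  have x: "b n = ennreal (x n)" "x n \<ge> 0" for n using fin[of n] by (simp_all add: x_def)
  obtain N where N: "\<And>n. n \<ge> N \<Longrightarrow> x n \<le> exp (r * real n)"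
    using eventually_le_exp_of_eln_limit[OF b r'] x unfolding eventually_sequentially by auto
  define M where "M = 1 + (\<Sum>k<N. x k)"
  have M: "M \<ge> 1" using x by (simp add: M_def sum_nonneg)
  have bM: "x k \<le> M * exp (r * real n)" if "k \<le> n" for k n
  proof -
    have e: "exp (r * real k) \<le> exp (r * real n)" using r0 that by simp
    show ?thesis
    proof (cases "k \<ge> N")
      case True
      then have "x k \<le> 1 * exp (r * real n)" using order_trans[OF N e] by simp
      also have "\<dots> \<le> M * exp (r * real n)" using M by (intro mult_right_mono) auto
      finally show ?thesis .
    next
      case False
      then have "x k \<le> M * 1" using member_le_sum[of k "{..<N}" x] x by (simp add: M_def)
      also have "\<dots> \<le> M * exp (r * real n)" using M r0 by (intro mult_left_mono) auto
      finally show ?thesis .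
    qed
  qed
  have "a n \<le> ennreal ((d + c' * M + 1) * (real n + 1) * exp (r * real n))" for n
  proof -
    have s: "(\<Sum>k<n. x k) \<le> real n * (M * exp (r * real n))"
      using sum_bounded_above[of "{..<n}" x] bM[of _ n] by simp
    have "a n \<le> ennreal (d + c' * (\<Sum>k<n. x k))"
      using le[of n] c' d x by (simp add: ennreal_mult sum_nonneg sum_ennreal)
    also have "d + c' * (\<Sum>k<n. x k) \<le> d * 1 + c' * (real n * (M * exp (r * real n)))"
      using c' s by (intro add_mono mult_left_mono) auto
    also have "\<dots> \<le> d * ((real n + 1) * exp (r * real n)) + c' * M * ((real n + 1) * exp (r * real n))"
    proof (intro add_mono mult_left_mono)
      have "1 * 1 \<le> (real n + 1) * exp (r * real n)" using r0 by (intro mult_mono) auto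
      then show "1 \<le> (real n + 1) * exp (r * real n)" by simp
      have "real n * exp (r * real n) \<le> (real n + 1) * exp (r * real n)" by (intro mult_right_mono) auto
      then have "(c' * M) * (real n * exp (r * real n)) \<le> (c' * M) * ((real n + 1) * exp (r * real n))"
        using c' M by (intro mult_left_mono) auto
      then show "c' * (real n * (M * exp (r * real n))) \<le> c' * M * ((real n + 1) * exp (r * real n))"
        by (simp add: ac_simps)
    qed (use d in auto)
    also have "\<dots> \<le> (d + c' * M + 1) * (real n + 1) * exp (r * real n)" by (simp add: algebra_simps)
    finally show ?thesis by (simp add: ennreal_leI)
  qed
  moreover have "0 < d + c' * M + 1" using c' d M by (intro add_nonneg_pos add_nonneg_nonneg mult_nonneg_nonneg) auto
  ultimately have "h \<le> ereal r" using eln_limit_le[OF a, of "d + c' * M + 1" r] by simp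
  then show False using r by simp
qed

section \<open>Entropy\<close>

context triangulated_category
begin

text \<open>An exact map satisfies that the cost of reaching its (m + n)-th power from its m-th
  power is at most the cost of the n-th power, so the sequence is submultiplicative.\<close>

lemma complexity_power_limit:
  assumes \<phi>: "exact_on_objects T T \<phi>" and G: "split_generator T G"
  shows "\<exists>h. (\<lambda>n. eln (complexity T t G ((\<phi> ^^ n) G)) / ereal (real n)) \<longlonglongrightarrow> h"
proof (rule submultiplicative_eln_convergent)
  have G': "G \<in> Ob T" using G by (simp add: split_generator_def)
  note pow = exact_on_objects_funpow[OF triangulated_category_axioms \<phi>]
  have cl: "(\<phi> ^^ n) G \<in> Ob T" for n using exact_on_objectsD(1)[OF pow G'] .
  show fin: "complexity T t G ((\<phi> ^^ n) G) < \<infinity>" for n using complexity_finite[OF G cl] .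
  fix m n
  have le: "complexity T t ((\<phi> ^^ m) G) ((\<phi> ^^ (m + n)) G) \<le> complexity T t G ((\<phi> ^^ n) G)"
    unfolding funpow_add comp_def
    by (rule complexity_exact[OF triangulated_category_axioms triangulated_category_axioms pow G'])
  \<comment> \<open>The m-th power of G need not be a split-generator, so the second factor is
    finite by the comparison \<open>le\<close> and not by \<open>complexity_finite\<close>.\<close>
  then have "complexity T t G ((\<phi> ^^ (m + n)) G)
    \<le> complexity T t G ((\<phi> ^^ m) G) * complexity T t ((\<phi> ^^ m) G) ((\<phi> ^^ (m + n)) G)"
    using complexity_submult[OF fin _ G'] fin le_less_trans by blast
  also have "\<dots> \<le> complexity T t G ((\<phi> ^^ m) G) * complexity T t G ((\<phi> ^^ n) G)"
    using le by (rule mult_left_mono) simp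
  finally show "complexity T t G ((\<phi> ^^ (m + n)) G)
    \<le> complexity T t G ((\<phi> ^^ m) G) * complexity T t G ((\<phi> ^^ n) G)" .
qed

text \<open>Route the generation of the n-th power of G through G' and the n-th power of G'. The
  first and last legs are bounded independently of n. Exchanging G and G' gives the reverse
  inequality.\<close>

lemma complexity_power_limit_le:
  assumes \<phi>: "exact_on_objects T T \<phi>" and G: "split_generator T G" and G': "split_generator T G'"
    and h: "(\<lambda>n. eln (complexity T t G ((\<phi> ^^ n) G)) / ereal (real n)) \<longlonglongrightarrow> h"
    and h': "(\<lambda>n. eln (complexity T t G' ((\<phi> ^^ n) G')) / ereal (real n)) \<longlonglongrightarrow> h'"
  shows "h \<le> h'"
proof (rule eln_limit_mono[OF h h'])
  have ob: "G \<in> Ob T" "G' \<in> Ob T" using G G' by (auto simp: split_generator_def)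
  note pow = exact_on_objects_funpow[OF triangulated_category_axioms \<phi>]
  have cl: "(\<phi> ^^ n) G \<in> Ob T" "(\<phi> ^^ n) G' \<in> Ob T" for n using exact_on_objectsD(1)[OF pow] ob by auto
  note fin = complexity_finite[OF G] complexity_finite[OF G']
  show "complexity T t G G' * complexity T t G' G < \<infinity>"
    using fin ob by (simp add: ennreal_mult_less_top)
  fix n
  have le: "complexity T t ((\<phi> ^^ n) G') ((\<phi> ^^ n) G) \<le> complexity T t G' G"
    by (rule complexity_exact[OF triangulated_category_axioms triangulated_category_axioms pow ob(2)])
  have "complexity T t G ((\<phi> ^^ n) G) \<le> complexity T t G G' * complexity T t G' ((\<phi> ^^ n) G)"
    using fin cl ob by (intro complexity_submult) auto
  also have "\<dots> \<le> complexity T t G G' * (complexity T t G' ((\<phi> ^^ n) G') * complexity T t ((\<phi> ^^ n) G') ((\<phi> ^^ n) G))"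
    using fin cl ob le_less_trans[OF le] by (intro mult_left_mono complexity_submult) auto
  also have "\<dots> \<le> complexity T t G G' * (complexity T t G' ((\<phi> ^^ n) G') * complexity T t G' G)"
    using le by (intro mult_left_mono) auto
  finally show "complexity T t G ((\<phi> ^^ n) G) \<le> complexity T t G G' * complexity T t G' G * complexity T t G' ((\<phi> ^^ n) G')"
    by (simp add: ac_simps)
qed

text \<open>The definite description is well defined here: the limits for any two split-generators
  agree, and the given G excludes the vacuous case in which every value would qualify.\<close>

lemma entropy_tendsto:
  assumes \<phi>: "exact_on_objects T T (onOb \<Phi>)" and G: "split_generator T G"
  shows "(\<lambda>n. eln (complexity T t G ((onOb \<Phi> ^^ n) G)) / ereal (real n)) \<longlonglongrightarrow> entropy T t \<Phi>"
proof -
  obtain h where h: "(\<lambda>n. eln (complexity T t G ((onOb \<Phi> ^^ n) G)) / ereal (real n)) \<longlonglongrightarrow> h"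
    using complexity_power_limit[OF \<phi> G] by blast
  have all: "(\<lambda>n. eln (complexity T t G' ((onOb \<Phi> ^^ n) G')) / ereal (real n)) \<longlonglongrightarrow> h"
    if G': "split_generator T G'" for G'
  proof -
    obtain h' where h': "(\<lambda>n. eln (complexity T t G' ((onOb \<Phi> ^^ n) G')) / ereal (real n)) \<longlonglongrightarrow> h'"
      using complexity_power_limit[OF \<phi> G'] by blast
    have "h' = h"
      using complexity_power_limit_le[OF \<phi> G G' h h'] complexity_power_limit_le[OF \<phi> G' G h' h] by simp
    then show ?thesis using h' by simp
  qed
  have "entropy T t \<Phi> = h" unfolding entropy_def
  proof (rule the_equality)
    fix h' assume "\<forall>G. split_generator T G \<longrightarrow> (\<lambda>n. eln (complexity T t G ((onOb \<Phi> ^^ n) G)) / ereal (real n)) \<longlonglongrightarrow> h'"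
    then show "h' = h" using h G LIMSEQ_unique by blast
  qed (use all in blast)
  then show ?thesis using h by simp
qed

end

section \<open>Triangles in homotopy categories\<close>

context dg_category
begin

section \<open>Graded pieces and the Leibniz rule\<close>

lemma Gr_arr: "\<lbrakk>X \<in> Ob A; Y \<in> Ob A; f \<in> Gr A X Y n\<rbrakk> \<Longrightarrow> f \<in> arr A X Y"
  using module.submoduleE(1)[OF module_Mor Gr_submodule] by blast

lemma Gr_add: "\<lbrakk>X \<in> Ob A; Y \<in> Ob A; f \<in> Gr A X Y n; g \<in> Gr A X Y n\<rbrakk> \<Longrightarrow> f \<oplus>\<^bsub>Mor A X Y\<^esub> g \<in> Gr A X Y n"
  using module.submoduleE(5)[OF module_Mor Gr_submodule] by blast

lemma Gr_minus: "\<lbrakk>X \<in> Ob A; Y \<in> Ob A; f \<in> Gr A X Y n\<rbrakk> \<Longrightarrow> \<ominus>\<^bsub>Mor A X Y\<^esub> f \<in> Gr A X Y n"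
  using module.submoduleE(3)[OF module_Mor Gr_submodule] by blast

lemma Dif_closed: "\<lbrakk>X \<in> Ob A; Y \<in> Ob A; f \<in> Gr A X Y n\<rbrakk> \<Longrightarrow> Dif A X Y f \<in> arr A X Y"
  using Dif_Gr Gr_arr by blast

lemma Dif_zero:
  assumes "X \<in> Ob A" "Y \<in> Ob A"
  shows "Dif A X Y \<zero>\<^bsub>Mor A X Y\<^esub> = \<zero>\<^bsub>Mor A X Y\<^esub>"
proof -
  interpret M: abelian_group "Mor A X Y" using assms abelian_group_Mor by blast
  obtain f where f: "f \<in> Gr A X Y 0"
    using module.submoduleE(2)[OF module_Mor[OF assms] Gr_submodule[OF assms]] by blast
  \<comment> \<open>The differential is known to stay in the morphism space only for homogeneous
    elements, so zero is first exhibited as one.\<close>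
  have "f \<oplus>\<^bsub>Mor A X Y\<^esub> \<ominus>\<^bsub>Mor A X Y\<^esub> f \<in> Gr A X Y 0"
    using assms f by (intro Gr_add Gr_minus) auto
  then have "\<zero>\<^bsub>Mor A X Y\<^esub> \<in> Gr A X Y 0" using Gr_arr[OF assms f] by (simp add: M.r_neg)
  then have "Dif A X Y \<zero>\<^bsub>Mor A X Y\<^esub> \<in> arr A X Y" using Dif_closed assms by blast
  moreover have "Dif A X Y \<zero>\<^bsub>Mor A X Y\<^esub> = Dif A X Y \<zero>\<^bsub>Mor A X Y\<^esub> \<oplus>\<^bsub>Mor A X Y\<^esub> Dif A X Y \<zero>\<^bsub>Mor A X Y\<^esub>"
    using Dif_add[OF assms M.zero_closed M.zero_closed] by simp
  ultimately show ?thesis by (simp add: M.add.l_cancel_one')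
qed

lemma Dif_minus:
  assumes "X \<in> Ob A" "Y \<in> Ob A" "f \<in> Gr A X Y n"
  shows "Dif A X Y (\<ominus>\<^bsub>Mor A X Y\<^esub> f) = \<ominus>\<^bsub>Mor A X Y\<^esub> Dif A X Y f"
proof -
  interpret M: abelian_group "Mor A X Y" using assms abelian_group_Mor by blast
  note f = Gr_arr[OF assms]
  have "Dif A X Y (\<ominus>\<^bsub>Mor A X Y\<^esub> f) \<oplus>\<^bsub>Mor A X Y\<^esub> Dif A X Y f = \<zero>\<^bsub>Mor A X Y\<^esub>"
    using Dif_add[OF assms(1,2) M.a_inv_closed[OF f] f] f Dif_zero[OF assms(1,2)] by (simp add: M.l_neg)
  then show ?thesis using M.minus_equality Dif_closed assms Gr_minus by (metis (no_types))
qed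

lemma cycD:
  assumes "f \<in> cyc A X Y n" "X \<in> Ob A" "Y \<in> Ob A"
  shows "f \<in> Gr A X Y n" "f \<in> arr A X Y" "Dif A X Y f = \<zero>\<^bsub>Mor A X Y\<^esub>"
  using assms Gr_arr by (auto simp: cyc_def)

lemma signed_zero: "\<lbrakk>X \<in> Ob A; Y \<in> Ob A\<rbrakk> \<Longrightarrow> signed (Mor A X Y) n \<zero>\<^bsub>Mor A X Y\<^esub> = \<zero>\<^bsub>Mor A X Y\<^esub>"
proof -
  assume "X \<in> Ob A" "Y \<in> Ob A"
  then interpret M: abelian_group "Mor A X Y" using abelian_group_Mor by blast
  show ?thesis by (simp add: signed_def)
qed

lemma Leibniz_closed_right:
  assumes "X \<in> Ob A" "Y \<in> Ob A" "Z \<in> Ob A" "f \<in> cyc A X Y m" "g \<in> Gr A Y Z n"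
  shows "Dif A X Z (Cmp A X Y Z g f) = Cmp A X Y Z (Dif A Y Z g) f"
proof -
  interpret M: abelian_group "Mor A X Z" using assms abelian_group_Mor by blast
  note f = cycD[OF assms(4,1,2)]
  have "Cmp A X Y Z (Dif A Y Z g) f \<in> arr A X Z" using assms f Cmp_closed Dif_closed by blast
  then show ?thesis using Leibniz[OF assms(1-3) f(2) assms(5)] assms Gr_arr[OF assms(2,3,5)] f
    by (simp add: Cmp_zero_right signed_zero)
qed

lemma Leibniz_closed_left:
  assumes "X \<in> Ob A" "Y \<in> Ob A" "Z \<in> Ob A" "f \<in> Gr A X Y m" "g \<in> cyc A Y Z n"
  shows "Dif A X Z (Cmp A X Y Z g f) = signed (Mor A X Z) n (Cmp A X Y Z g (Dif A X Y f))"
proof -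
  interpret M: abelian_group "Mor A X Z" using assms abelian_group_Mor by blast
  note g = cycD[OF assms(5,2,3)] and f = Gr_arr[OF assms(1,2,4)]
  have "Cmp A X Y Z g (Dif A X Y f) \<in> arr A X Z" using assms g Cmp_closed Dif_closed by blast
  then have "signed (Mor A X Z) n (Cmp A X Y Z g (Dif A X Y f)) \<in> arr A X Z" by (simp add: signed_def)
  then show ?thesis using Leibniz[OF assms(1-3) f g(1)] assms g f
    by (simp add: Cmp_zero_left)
qed

lemma cyc_Cmp:
  assumes "X \<in> Ob A" "Y \<in> Ob A" "Z \<in> Ob A" "f \<in> cyc A X Y m" "g \<in> cyc A Y Z n"
  shows "Cmp A X Y Z g f \<in> cyc A X Z (m + n)"
proof -
  have "Dif A X Z (Cmp A X Y Z g f) = \<zero>\<^bsub>Mor A X Z\<^esub>"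
    using Leibniz_closed_right[OF assms(1-4)] cycD[OF assms(5)] cycD[OF assms(4)] assms
    by (simp add: Cmp_zero_left)
  then show ?thesis using assms Cmp_Gr by (simp add: cyc_def)
qed

lemma cyc_Idt:
  assumes X: "X \<in> Ob A" shows "Idt A X \<in> cyc A X X 0"
proof -
  interpret M: abelian_group "Mor A X X" using X abelian_group_Mor by blast
  note id = Idt_Gr[OF X] Idt_closed[OF X]
  have d: "Dif A X X (Idt A X) \<in> arr A X X" using Dif_closed id X by blast
  \<comment> \<open>The Leibniz rule for the product of the identity with itself, in even
    degree.\<close>
  have "Dif A X X (Idt A X) = Dif A X X (Idt A X) \<oplus>\<^bsub>Mor A X X\<^esub> Dif A X X (Idt A X)"
    using Leibniz[OF X X X id(2) id(1)] X id d by (simp add: Cmp_Idt_left Cmp_Idt_right signed_def)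
  then have "Dif A X X (Idt A X) = \<zero>\<^bsub>Mor A X X\<^esub>" using d by (simp add: M.add.l_cancel_one')
  then show ?thesis using id by (simp add: cyc_def)
qed

section \<open>Cohomology classes and their composition\<close>

lemma hcls_refl:
  assumes "X \<in> Ob A" "Y \<in> Ob A" "f \<in> cyc A X Y 0"
  shows "f \<in> hcls A X Y f"
proof -
  interpret M: abelian_group "Mor A X Y" using assms abelian_group_Mor by blast
  obtain h where h: "h \<in> Gr A X Y (-1)"
    using module.submoduleE(2)[OF module_Mor[OF assms(1,2)] Gr_submodule[OF assms(1,2)]] by blast
  have "h \<oplus>\<^bsub>Mor A X Y\<^esub> \<ominus>\<^bsub>Mor A X Y\<^esub> h \<in> Gr A X Y (-1)"
    using assms h by (intro Gr_add Gr_minus) auto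
  then have "\<zero>\<^bsub>Mor A X Y\<^esub> \<in> Gr A X Y (-1)" using Gr_arr[OF assms(1,2) h] by (simp add: M.r_neg)
  moreover have "f = f \<oplus>\<^bsub>Mor A X Y\<^esub> Dif A X Y \<zero>\<^bsub>Mor A X Y\<^esub>"
    using assms cycD[OF assms(3)] by (simp add: Dif_zero)
  ultimately show ?thesis using assms unfolding hcls_def by blast
qed

lemma hcls_subset:
  assumes XY: "X \<in> Ob A" "Y \<in> Ob A" and f: "f \<in> cyc A X Y 0" and g: "g \<in> hcls A X Y f"
  shows "hcls A X Y g \<subseteq> hcls A X Y f"
proof
  interpret M: abelian_group "Mor A X Y" using XY abelian_group_Mor by blast
  obtain h where h: "h \<in> Gr A X Y (-1)" "g = f \<oplus>\<^bsub>Mor A X Y\<^esub> Dif A X Y h"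
    using g unfolding hcls_def by blast
  fix k assume "k \<in> hcls A X Y g"
  then obtain h' where k: "k \<in> cyc A X Y 0" and h': "h' \<in> Gr A X Y (-1)" "k = g \<oplus>\<^bsub>Mor A X Y\<^esub> Dif A X Y h'"
    unfolding hcls_def by blast
  have "k = f \<oplus>\<^bsub>Mor A X Y\<^esub> Dif A X Y (h \<oplus>\<^bsub>Mor A X Y\<^esub> h')"
    using h h' XY cycD[OF f XY] Gr_arr[OF XY] Dif_closed[OF XY] by (simp add: Dif_add M.a_assoc)
  then show "k \<in> hcls A X Y f" using k Gr_add[OF XY h(1) h'(1)] unfolding hcls_def by blast
qed

lemma hcls_eq:
  assumes XY: "X \<in> Ob A" "Y \<in> Ob A" and f: "f \<in> cyc A X Y 0" and g: "g \<in> hcls A X Y f"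
  shows "hcls A X Y g = hcls A X Y f"
proof
  interpret M: abelian_group "Mor A X Y" using XY abelian_group_Mor by blast
  obtain h where h: "h \<in> Gr A X Y (-1)" "g = f \<oplus>\<^bsub>Mor A X Y\<^esub> Dif A X Y h" and g': "g \<in> cyc A X Y 0"
    using g unfolding hcls_def by blast
  have d: "Dif A X Y h \<in> arr A X Y" using XY h Dif_closed by blast
  have "f = g \<oplus>\<^bsub>Mor A X Y\<^esub> Dif A X Y (\<ominus>\<^bsub>Mor A X Y\<^esub> h)"
    using h d XY cycD[OF f XY] by (simp add: Dif_minus M.a_assoc M.r_neg)
  then have "f \<in> hcls A X Y g" unfolding hcls_def using f Gr_minus[OF XY h(1)] by blast
  then show "hcls A X Y f \<subseteq> hcls A X Y g" by (rule hcls_subset[OF XY g'])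
qed (rule hcls_subset[OF assms])

text \<open>The homotopy is k f. Opposite degrees n and -n are allowed because the shift on classes
  composes with maps to and from the shifted object that have such degrees.\<close>

lemma hcls_Cmp_left:
  assumes ob: "X \<in> Ob A" "Y \<in> Ob A" "Z \<in> Ob A" and f: "f \<in> cyc A X Y n"
    and g: "g \<in> cyc A Y Z (-n)" and k: "k \<in> Gr A Y Z (-n - 1)"
  shows "hcls A X Z (Cmp A X Y Z (g \<oplus>\<^bsub>Mor A Y Z\<^esub> Dif A Y Z k) f) = hcls A X Z (Cmp A X Y Z g f)"
proof (rule hcls_eq[OF ob(1,3)])
  show gf: "Cmp A X Y Z g f \<in> cyc A X Z 0" using cyc_Cmp[OF ob f g] by simp
  have d: "Dif A Y Z k \<in> cyc A Y Z (-n)"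
    using Dif_Gr[OF ob(2,3) k] Dif_Dif[OF ob(2,3) Gr_arr[OF ob(2,3) k]] by (simp add: cyc_def)
  have eq: "Cmp A X Y Z (g \<oplus>\<^bsub>Mor A Y Z\<^esub> Dif A Y Z k) f
      = Cmp A X Y Z g f \<oplus>\<^bsub>Mor A X Z\<^esub> Dif A X Z (Cmp A X Y Z k f)"
    using ob cycD[OF f] cycD[OF g] cycD[OF d] Leibniz_closed_right[OF ob f k] by (simp add: Cmp_add_left)
  have kf: "Cmp A X Y Z k f \<in> Gr A X Z (-1)" using Cmp_Gr[OF ob cycD(1)[OF f ob(1,2)] k] by simp
  have "g \<oplus>\<^bsub>Mor A Y Z\<^esub> Dif A Y Z k \<in> cyc A Y Z (-n)"
    using ob cycD[OF g ob(2,3)] cycD[OF d ob(2,3)] zero_closed[OF ob(2,3)]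
      abelian_monoid.r_zero[OF abelian_group.axioms(1)[OF abelian_group_Mor[OF ob(2,3)]]]
    by (simp add: cyc_def Gr_add Dif_add)
  then have "Cmp A X Y Z (g \<oplus>\<^bsub>Mor A Y Z\<^esub> Dif A Y Z k) f \<in> cyc A X Z 0"
    using cyc_Cmp[OF ob f] by fastforce
  then show "Cmp A X Y Z (g \<oplus>\<^bsub>Mor A Y Z\<^esub> Dif A Y Z k) f \<in> hcls A X Z (Cmp A X Y Z g f)"
    unfolding hcls_def using eq kf by blast
qed

lemma hcls_Cmp_right:
  assumes ob: "X \<in> Ob A" "Y \<in> Ob A" "Z \<in> Ob A" and f: "f \<in> cyc A X Y 0"
    and g: "g \<in> cyc A Y Z 0" and f': "f' \<in> hcls A X Y f"
  shows "hcls A X Z (Cmp A X Y Z g f') = hcls A X Z (Cmp A X Y Z g f)"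
proof (rule hcls_eq[OF ob(1,3)])
  show "Cmp A X Y Z g f \<in> cyc A X Z 0" using cyc_Cmp[OF ob f g] by simp
  obtain h where h: "h \<in> Gr A X Y (-1)" "f' = f \<oplus>\<^bsub>Mor A X Y\<^esub> Dif A X Y h" and f'': "f' \<in> cyc A X Y 0"
    using f' unfolding hcls_def by blast
  have "Cmp A X Y Z g f' = Cmp A X Y Z g f \<oplus>\<^bsub>Mor A X Z\<^esub> Dif A X Z (Cmp A X Y Z g h)"
    using h ob cycD[OF f] cycD[OF g] Dif_closed[OF ob(1,2) h(1)] Leibniz_closed_left[OF ob h(1) g]
    by (simp add: Cmp_add_right signed_def)
  moreover have "Cmp A X Y Z g h \<in> Gr A X Z (-1)" using Cmp_Gr[OF ob h(1) cycD(1)[OF g ob(2,3)]] by simp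
  moreover have "Cmp A X Y Z g f' \<in> cyc A X Z 0" using cyc_Cmp[OF ob f'' g] by simp
  ultimately show "Cmp A X Y Z g f' \<in> hcls A X Z (Cmp A X Y Z g f)" unfolding hcls_def by blast
qed

text \<open>The union over representatives is a nonempty union of one and the same class.\<close>

lemma Cmp_H0_base:
  assumes ob: "X \<in> Ob A" "Y \<in> Ob A" "Z \<in> Ob A" and f: "f \<in> cyc A X Y 0" and g: "g \<in> cyc A Y Z 0"
  shows "Cmp (H0_base A) X Y Z (hcls A Y Z g) (hcls A X Y f) = hcls A X Z (Cmp A X Y Z g f)"
proof -
  have eq: "hcls A X Z (Cmp A X Y Z g' f') = hcls A X Z (Cmp A X Y Z g f)"
    if g': "g' \<in> hcls A Y Z g" and f': "f' \<in> hcls A X Y f" for g' f'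
  proof -
    obtain k where k: "k \<in> Gr A Y Z (-1)" "g' = g \<oplus>\<^bsub>Mor A Y Z\<^esub> Dif A Y Z k"
      using g' unfolding hcls_def by blast
    have "f' \<in> cyc A X Y 0" using f' unfolding hcls_def by blast
    then have "hcls A X Z (Cmp A X Y Z g' f') = hcls A X Z (Cmp A X Y Z g f')"
      using hcls_Cmp_left[OF ob, of f' 0 g k] g k by simp
    then show ?thesis using hcls_Cmp_right[OF ob f g f'] by simp
  qed
  have "Cmp (H0_base A) X Y Z (hcls A Y Z g) (hcls A X Y f)
    = (\<Union>g'\<in>hcls A Y Z g. \<Union>f'\<in>hcls A X Y f. hcls A X Z (Cmp A X Y Z g' f'))"
    by (simp add: H0_base_def)
  also have "\<dots> = (\<Union>g'\<in>hcls A Y Z g. \<Union>f'\<in>hcls A X Y f. hcls A X Z (Cmp A X Y Z g f))"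
    by (intro SUP_cong refl eq)
  also have "\<dots> = hcls A X Z (Cmp A X Y Z g f)"
    using hcls_refl[OF ob(1,2) f] hcls_refl[OF ob(2,3) g] by auto
  finally show ?thesis .
qed

end

section \<open>Standard cone triangles\<close>

context pretriangulated_dg_category
begin

lemma is_shift_sh: "X \<in> Ob A \<Longrightarrow> is_shift A n X (sh_ob A n X) (sh_to A n X) (sh_from A n X)"
  using ex_shift[of X n] unfolding sh_ob_def sh_to_def sh_from_def shift_choice_def
  by (metis (mono_tags, lifting) case_prod_conv case_prod_unfold someI)

text \<open>Needed so that the identities form a morphism from a standard triangle to itself. For f
  homotopic to 1, the conjugate of f is homotopic to the composite of \<open>sh_from\<close> and
  \<open>sh_to\<close>, which is homotopic to 1.\<close>

lemma H0_shift_Idt: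
  assumes X: "X \<in> Ob A"
  shows "onMor (H0_shift A n) X X (hcls A X X (Idt A X)) = hcls A (sh_ob A n X) (sh_ob A n X) (Idt A (sh_ob A n X))"
proof -
  let ?Z = "sh_ob A n X" and ?\<sigma> = "sh_to A n X" and ?\<tau> = "sh_from A n X"
  have Z: "?Z \<in> Ob A" and \<sigma>: "?\<sigma> \<in> cyc A X ?Z (-n)" and \<tau>: "?\<tau> \<in> cyc A ?Z X n"
    and "\<exists>h\<in>Gr A ?Z ?Z (-1). Cmp A ?Z X ?Z ?\<sigma> ?\<tau> = Idt A ?Z \<oplus>\<^bsub>Mor A ?Z ?Z\<^esub> Dif A ?Z ?Z h"
    using is_shift_sh[OF X, of n] unfolding is_shift_def by auto
  moreover have "Cmp A ?Z X ?Z ?\<sigma> ?\<tau> \<in> cyc A ?Z ?Z 0" using cyc_Cmp[OF Z X Z \<tau> \<sigma>] by simp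
  ultimately have "Cmp A ?Z X ?Z ?\<sigma> ?\<tau> \<in> hcls A ?Z ?Z (Idt A ?Z)" unfolding hcls_def by blast
  then have st: "hcls A ?Z ?Z (Cmp A ?Z X ?Z ?\<sigma> ?\<tau>) = hcls A ?Z ?Z (Idt A ?Z)"
    using hcls_eq Z cyc_Idt by blast
  have eq: "hcls A ?Z ?Z (Cmp A ?Z X ?Z (Cmp A X X ?Z ?\<sigma> f) ?\<tau>) = hcls A ?Z ?Z (Idt A ?Z)"
    if f: "f \<in> hcls A X X (Idt A X)" for f
  proof -
    interpret M: abelian_group "Mor A X ?Z" using X Z abelian_group_Mor by blast
    obtain k where k: "k \<in> Gr A X X (-1)" "f = Idt A X \<oplus>\<^bsub>Mor A X X\<^esub> Dif A X X k"
      using f unfolding hcls_def by blast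
    \<comment> \<open>The sign cancels the one in the Leibniz rule for \<open>?\<sigma>\<close>,
      which has degree -n.\<close>
    define k' where "k' = (if even n then Cmp A X X ?Z ?\<sigma> k else \<ominus>\<^bsub>Mor A X ?Z\<^esub> Cmp A X X ?Z ?\<sigma> k)"
    have sk: "Cmp A X X ?Z ?\<sigma> k \<in> Gr A X ?Z (-n - 1)"
      using Cmp_Gr[OF X X Z k(1) cycD(1)[OF \<sigma> X Z]] by (simp only: add.commute[of "- 1"] diff_conv_add_uminus)
    then have k': "k' \<in> Gr A X ?Z (-n - 1)" unfolding k'_def using Gr_minus X Z by auto
    have dk: "Dif A X X k \<in> arr A X X" "Cmp A X X ?Z ?\<sigma> (Dif A X X k) \<in> arr A X ?Z"
      using Dif_closed[OF X X k(1)] X Z cycD[OF \<sigma>] Cmp_closed by auto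
    have "Dif A X ?Z k' = Cmp A X X ?Z ?\<sigma> (Dif A X X k)"
      unfolding k'_def using Leibniz_closed_left[OF X X Z k(1) \<sigma>] Dif_minus[OF X Z sk] dk
      by (simp add: signed_def)
    then have "Cmp A X X ?Z ?\<sigma> f = ?\<sigma> \<oplus>\<^bsub>Mor A X ?Z\<^esub> Dif A X ?Z k'"
      using k X Z cycD[OF \<sigma>] dk by (simp add: Cmp_add_right Idt_closed Cmp_Idt_right)
    then show ?thesis using hcls_Cmp_left[OF Z X Z \<tau> \<sigma> k'] st by simp
  qed
  have "onMor (H0_shift A n) X X (hcls A X X (Idt A X))
    = (\<Union>f\<in>hcls A X X (Idt A X). hcls A ?Z ?Z (Cmp A ?Z X ?Z (Cmp A X X ?Z ?\<sigma> f) ?\<tau>))"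
    by (simp add: H0_shift_def)
  also have "\<dots> = (\<Union>f\<in>hcls A X X (Idt A X). hcls A ?Z ?Z (Idt A ?Z))"
    by (intro SUP_cong refl eq)
  also have "\<dots> = hcls A ?Z ?Z (Idt A ?Z)" using hcls_refl[OF X X cyc_Idt[OF X]] by auto
  finally show ?thesis .
qed

text \<open>Exact triangles of \<open>H0 A\<close> are those isomorphic to a standard one, so
  reflexivity of \<open>tri_iso\<close> is what has to be shown. It is verified directly on
  cohomology classes with identity maps.\<close>

lemma H0_cone_triangle:
  assumes cone: "is_cone A X Y f Z i s p q"
  shows "tri3 (H0 A) X Y Z"
proof -
  have ob: "X \<in> Ob A" "Y \<in> Ob A" "Z \<in> Ob A" and f: "f \<in> cyc A X Y 0" and i: "i \<in> cyc A Y Z 0" and p: "p \<in> cyc A Z X 1"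
    using cone unfolding is_cone_def by auto
  let ?X1 = "sh_ob A 1 X" and ?p = "Cmp A Z X (sh_ob A 1 X) (sh_to A 1 X) p"
  have X1: "?X1 \<in> Ob A" and \<sigma>: "sh_to A 1 X \<in> cyc A X ?X1 (-1)"
    using is_shift_sh[OF ob(1), of 1] unfolding is_shift_def by auto
  have p1: "?p \<in> cyc A Z ?X1 0" using cyc_Cmp[OF ob(3,1) X1 p \<sigma>] by simp
  let ?H = "H0_base A"
  have sh: "sh ?H X = ?X1" "onMor (Shift ?H) = onMor (H0_shift A 1)"
    by (simp_all add: H0_base_def H0_shift_def)
  have arr: "hcls A X Y f \<in> arr ?H X Y" if "f \<in> cyc A X Y 0" for X Y f
    using that by (simp add: H0_base_def H0_Mor_def)
  have idt: "Idt ?H X = hcls A X X (Idt A X)" for X by (simp add: H0_base_def)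
  have id_left: "Cmp ?H X Y Y (Idt ?H Y) (hcls A X Y f) = hcls A X Y f"
    and id_right: "Cmp ?H X X Y (hcls A X Y f) (Idt ?H X) = hcls A X Y f"
    if "X \<in> Ob A" "Y \<in> Ob A" "f \<in> cyc A X Y 0" for X Y f
    using that cycD[OF that(3,1,2)] by (simp_all add: idt Cmp_H0_base cyc_Idt Cmp_Idt_left Cmp_Idt_right)
  have iso: "is_iso ?H X X (Idt ?H X)" if "X \<in> Ob A" for X
    unfolding is_iso_def
  proof (intro conjI bexI)
    show "Idt ?H X \<in> arr ?H X X" unfolding idt using that by (intro arr cyc_Idt)
    then show "Idt ?H X \<in> arr ?H X X" .
  qed (use id_left[OF that that cyc_Idt[OF that]] in \<open>simp_all add: idt\<close>)
  have "tri_iso ?H X Y Z (hcls A X Y f) (hcls A Y Z i) (hcls A Z ?X1 ?p)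
    X Y Z (hcls A X Y f) (hcls A Y Z i) (hcls A Z ?X1 ?p)"
    unfolding tri_iso_def sh
  proof (intro conjI exI)
    show "{X, Y, Z, X, Y, Z} \<subseteq> Ob ?H" using ob by (simp add: H0_base_def)
    show "Cmp ?H Z ?X1 ?X1 (onMor (H0_shift A 1) X X (Idt ?H X)) (hcls A Z ?X1 ?p)
      = Cmp ?H Z Z ?X1 (hcls A Z ?X1 ?p) (Idt ?H Z)"
      using H0_shift_Idt[OF ob(1), of 1] id_left[OF ob(3) X1 p1] id_right[OF ob(3) X1 p1] by (simp add: idt)
  qed (use ob f i p1 arr iso id_left id_right in auto)
  then have "Tri (H0 A) X Y Z (hcls A X Y f) (hcls A Y Z i) (hcls A Z ?X1 ?p)"
    unfolding H0_def using cone by (simp, intro exI conjI)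
  then show ?thesis unfolding tri3_def by blast
qed

end

section \<open>Transport along dg enhancements\<close>

lemma Ob_H0: "Ob (H0 A) = Ob A"
  by (simp add: H0_def H0_base_def)

lemma dg_lift_iso:
  assumes "dg_lift K A E1 B T2 E2 \<Phi> F \<pi>" "linear_functor K (H0 A) T1 E1" "linear_functor K (H0 B) T2 E2"
    "linear_functor K T1 T2 \<Phi>" and X: "X \<in> Ob A"
  shows "iso_objects T2 (onOb E2 (onOb F X)) (onOb \<Phi> (onOb E1 X))"
proof -
  have "onOb F X \<in> Ob (H0 B)"
    using assms(1) X unfolding dg_lift_def dg_functor_def by (auto simp: Ob_H0 intro: linear_functor.onOb_closed)
  moreover have "onOb E1 X \<in> Ob T1" using linear_functor.onOb_closed[OF assms(2)] X by (simp add: Ob_H0)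
  moreover have "is_iso T2 (onOb E2 (onOb F X)) (onOb \<Phi> (onOb E1 X)) (\<pi> X)"
    using assms(1) X unfolding dg_lift_def nat_iso_def by (simp add: Ob_H0 H0_fun_def)
  ultimately show ?thesis unfolding iso_objects_def
    using linear_functor.onOb_closed[OF assms(3)] linear_functor.onOb_closed[OF assms(4)] by blast
qed

text \<open>The cones are given only at objects of the enhancement. By essential surjectivity Y is
  isomorphic to some E1(X); the cone triangle at X is carried to \<open>T2\<close> by
  \<open>E2\<close> and its vertices are replaced through the isomorphisms of the three
  lifts.\<close>

lemma functorial_cone_triangle:
  assumes T2: "triangulated_category K T2" and e1: "dg_enhancement K A T1 E1" and e2: "dg_enhancement K B T2 E2"
    and cone: "functorial_cone K A E1 B T2 E2 \<Phi> \<Psi> \<alpha> \<Theta>"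
    and lin: "linear_functor K T1 T2 \<Phi>" "linear_functor K T1 T2 \<Psi>" "linear_functor K T1 T2 \<Theta>"
    and Y: "Y \<in> Ob T1"
  shows "tri3 T2 (onOb \<Phi> Y) (onOb \<Psi> Y) (onOb \<Theta> Y)"
proof -
  interpret T2: triangulated_category K T2 by fact
  interpret B: pretriangulated_dg_category K B using e2 unfolding dg_enhancement_def by blast
  have E1: "linear_functor K (H0 A) T1 E1" and E2: "linear_functor K (H0 B) T2 E2"
    using e1 e2 unfolding dg_enhancement_def exact_equivalence_def exact_functor_def by blast+
  obtain G \<beta> where G: "linear_functor K T1 (H0 A) G" and \<beta>: "nat_iso T1 T1 (E1 \<circ>\<^sub>F G) idfun \<beta>"
    using e1 unfolding dg_enhancement_def exact_equivalence_def equivalence_def fun_iso_def by blast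
  define X where "X = onOb G Y"
  have X: "X \<in> Ob A" using linear_functor.onOb_closed[OF G Y] by (simp add: X_def Ob_H0)
  have XY: "iso_objects T1 (onOb E1 X) Y"
    using \<beta> Y X linear_functor.onOb_closed[OF E1, of X] unfolding nat_iso_def iso_objects_def X_def
    by (auto simp: Ob_H0)
  obtain F \<pi> F' \<rho> H \<theta> a i s where F: "dg_lift K A E1 B T2 E2 \<Phi> F \<pi>" and F': "dg_lift K A E1 B T2 E2 \<Psi> F' \<rho>"
    and H: "dg_lift K A E1 B T2 E2 \<Theta> H \<theta>"
    and "\<And>X. X \<in> Ob A \<Longrightarrow> \<exists>p q. is_cone B (onOb F X) (onOb F' X) (a X) (onOb H X) (i X) (s X) p q"
    using cone unfolding functorial_cone_def by blast
  then have "tri3 (H0 B) (onOb F X) (onOb F' X) (onOb H X)" using X B.H0_cone_triangle by blast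
  then have "tri3 T2 (onOb E2 (onOb F X)) (onOb E2 (onOb F' X)) (onOb E2 (onOb H X))"
    using e2 unfolding dg_enhancement_def exact_equivalence_def exact_functor_def tri3_def by blast
  moreover have "iso_objects T2 (onOb E2 (onOb F X)) (onOb \<Phi> Y)"
    using T2.iso_trans[OF dg_lift_iso[OF F E1 E2 lin(1) X] linear_functor.iso_objects_onOb[OF lin(1) XY]] .
  moreover have "iso_objects T2 (onOb E2 (onOb F' X)) (onOb \<Psi> Y)"
    using T2.iso_trans[OF dg_lift_iso[OF F' E1 E2 lin(2) X] linear_functor.iso_objects_onOb[OF lin(2) XY]] .
  moreover have "iso_objects T2 (onOb E2 (onOb H X)) (onOb \<Theta> Y)"
    using T2.iso_trans[OF dg_lift_iso[OF H E1 E2 lin(3) X] linear_functor.iso_objects_onOb[OF lin(3) XY]] .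
  ultimately show ?thesis by (rule T2.tri3_cong)
qed

section \<open>Spherical twists\<close>

text \<open>The isomorphism of R with L T[-1] gives L T = R[1] up to isomorphism. Inserted into R =
  W L[1], evaluated at T Y, it yields R T = W L T[1] = W R[2].\<close>

lemma (in spherical_functor) right_adjoint_twist:
  assumes C: "triangulated_category K C" and D: "triangulated_category K D" and Y: "Y \<in> Ob D"
  shows "iso_objects C (onOb R (onOb T Y)) (onOb (shift_by C 2 \<circ>\<^sub>F W) (onOb R Y))"
proof -
  interpret C: triangulated_category K C by fact
  interpret D: triangulated_category K D by fact
  have T: "exact_on_objects D D (onOb T)" and W: "exact_on_objects C C (onOb W)"
    and R: "exact_on_objects D C (onOb R)" and L: "exact_on_objects D C (onOb L)"
    using exact_functor_exact_on_objects C D exact_R exact_L twist_autoequivalence cotwist_autoequivalence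
    unfolding exact_equivalence_def by blast+
  let ?LT = "onOb L (onOb T Y)" and ?WR = "onOb W (onOb R Y)"
  have TY: "onOb T Y \<in> Ob D" and ob: "onOb R Y \<in> Ob C" "onOb R (onOb T Y) \<in> Ob C" "?LT \<in> Ob C" "?WR \<in> Ob C"
    "onOb W (onOb L (onOb T Y)) \<in> Ob C"
    using Y exact_on_objectsD(1)[OF T] exact_on_objectsD(1)[OF R] exact_on_objectsD(1)[OF L]
      exact_on_objectsD(1)[OF W] by auto
  have "iso_objects C (onOb R Y) (shn C (-1) ?LT)"
    using R_iso_L_twist Y ob C.shn_closed unfolding fun_iso_def nat_iso_def iso_objects_def by auto
  then have "iso_objects C (shn C 1 (onOb R Y)) (shn C 1 (shn C (-1) ?LT))"
    using exact_on_objectsD(4)[OF C.exact_on_objects_shn] by blast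
  moreover have "iso_objects C (shn C 1 (shn C (-1) ?LT)) ?LT"
    using C.iso_sym[OF C.shn_add[OF ob(3), of 1 "-1"]] by simp
  ultimately have "iso_objects C ?LT (shn C 1 (onOb R Y))" using C.iso_trans C.iso_sym by blast
  then have "iso_objects C (onOb W ?LT) (onOb W (shn C 1 (onOb R Y)))" by (rule exact_on_objectsD(4)[OF W])
  then have "iso_objects C (onOb W ?LT) (shn C 1 ?WR)"
    using exact_on_objects_shn_commute[OF C C W ob(1)] by (rule C.iso_trans)
  then have "iso_objects C (shn C 1 (onOb W ?LT)) (shn C 1 (shn C 1 ?WR))"
    by (rule exact_on_objectsD(4)[OF C.exact_on_objects_shn])
  moreover have "iso_objects C (onOb R (onOb T Y)) (shn C 1 (onOb W ?LT))"
    using R_iso_cotwist_L TY ob C.shn_closed unfolding fun_iso_def nat_iso_def iso_objects_def by auto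
  moreover have "iso_objects C (shn C 1 (shn C 1 ?WR)) (shn C 2 ?WR)"
    using C.iso_sym[OF C.shn_add[OF ob(4), of 1 1]] by simp
  ultimately have "iso_objects C (onOb R (onOb T Y)) (shn C 2 ?WR)" using C.iso_trans by blast
  then show ?thesis by simp
qed

lemma (in spherical_functor) twist_triangle:
  assumes D: "triangulated_category K D" and "dg_enhancement K B D ED" and Y: "Y \<in> Ob D"
  shows "tri3 D (onOb S (onOb R Y)) Y (onOb T Y)"
proof -
  have adj: "linear_functor K C D S" "linear_functor K D C R"
    using right_adjoint unfolding adjunction_def by blast+
  have "linear_functor K D D (S \<circ>\<^sub>F R)"
    using adj unfolding linear_functor_def by simp
  moreover have "linear_functor K D D idfun" unfolding linear_functor_def by simp
  moreover have "linear_functor K D D T"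
    using twist_autoequivalence unfolding exact_equivalence_def exact_functor_def by blast
  ultimately show ?thesis
    using functorial_cone_triangle[OF D assms(2,2) twist _ _ _ Y] by simp
qed

lemma (in spherical_functor) entropy_twist_le:
  assumes C: "triangulated_category K C" and D: "triangulated_category K D"
    and ED: "dg_enhancement K B D ED"
    and G: "split_generator D G" and G': "split_generator C G'"
  shows "entropy D t T \<le> max 0 (entropy C t (shift_by C 2 \<circ>\<^sub>F W))"
proof -
  interpret C: triangulated_category K C by fact
  interpret D: triangulated_category K D by fact
  define \<Phi> where "\<Phi> = shift_by C 2 \<circ>\<^sub>F W"
  let ?\<tau> = "onOb T" and ?\<phi> = "onOb \<Phi>"
  have T: "exact_on_objects D D ?\<tau>" and W: "exact_on_objects C C (onOb W)"
    and R: "exact_on_objects D C (onOb R)" and S: "exact_on_objects C D (onOb S)"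
    using exact_functor_exact_on_objects C D exact_R exact_S twist_autoequivalence cotwist_autoequivalence
    unfolding exact_equivalence_def by blast+
  have \<Phi>: "exact_on_objects C C ?\<phi>"
    using exact_on_objects_comp[OF C W C.exact_on_objects_shn, of 2] by (simp add: \<Phi>_def fcomp_def)
  \<comment> \<open>The shift [1] is that of the rotated twist triangle, in which the third vertex
    is S R Y [1].\<close>
  define \<psi> where "\<psi> X = sh D (onOb S X)" for X
  have \<psi>: "exact_on_objects C D \<psi>"
    unfolding \<psi>_def using exact_on_objects_comp[OF D S D.exact_on_objects_sh] .
  note powT = exact_on_objects_funpow[OF D T] and pow = exact_on_objects_funpow[OF C \<Phi>]
  have ob: "G \<in> Ob D" "G' \<in> Ob C" "onOb R G \<in> Ob C"
    using G G' exact_on_objectsD(1)[OF R] by (auto simp: split_generator_def)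
  have cl: "(?\<tau> ^^ n) G \<in> Ob D" "(?\<phi> ^^ n) G' \<in> Ob C" "(?\<phi> ^^ n) (onOb R G) \<in> Ob C" for n
    using exact_on_objectsD(1)[OF powT] exact_on_objectsD(1)[OF pow] ob by auto
  define a where "a n = complexity D t G ((?\<tau> ^^ n) G)" for n
  define b where "b n = complexity C t G' ((?\<phi> ^^ n) G')" for n
  define c\<^sub>1 where "c\<^sub>1 = complexity D t G (\<psi> G')"
  define c\<^sub>2 where "c\<^sub>2 = complexity C t G' (onOb R G)"
  have fin: "a n < \<infinity>" "b n < \<infinity>" "c\<^sub>1 < \<infinity>" "c\<^sub>2 < \<infinity>" for n
    unfolding a_def b_def c\<^sub>1_def c\<^sub>2_def using D.complexity_finite[OF G] C.complexity_finite[OF G']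
      cl ob exact_on_objectsD(1)[OF \<psi>] by auto
  have RT: "iso_objects C (onOb R ((?\<tau> ^^ n) G)) ((?\<phi> ^^ n) (onOb R G))" for n
  proof (induction n)
    case 0 then show ?case using ob C.iso_refl by simp
  next
    case (Suc n)
    have "iso_objects C (onOb R (?\<tau> ((?\<tau> ^^ n) G))) (?\<phi> (onOb R ((?\<tau> ^^ n) G)))"
      unfolding \<Phi>_def using right_adjoint_twist[OF C D cl(1)] .
    then show ?case using C.iso_trans exact_on_objectsD(4)[OF \<Phi> Suc] by simp
  qed
  \<comment> \<open>The bound multiplies three costs: \<open>c\<^sub>1\<close> from G to
    \<open>\<psi> G'\<close>, then, transported by \<open>\<psi>\<close>, \<open>b n\<close> from G'
    to its n-th power and \<open>c\<^sub>2\<close> from that power to the n-th power of R G.\<close>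
  have step: "a (Suc n) \<le> a n + c\<^sub>1 * c\<^sub>2 * b n" for n
  proof -
    have le1: "complexity C t ((?\<phi> ^^ n) G') ((?\<phi> ^^ n) (onOb R G)) \<le> c\<^sub>2"
      unfolding c\<^sub>2_def by (rule complexity_exact[OF C C pow ob(2)])
    have "complexity C t G' ((?\<phi> ^^ n) (onOb R G))
      \<le> b n * complexity C t ((?\<phi> ^^ n) G') ((?\<phi> ^^ n) (onOb R G))"
      using fin(2)[of n] le_less_trans[OF le1 fin(4)] unfolding b_def
      by (intro C.complexity_submult ob) auto
    also have "\<dots> \<le> b n * c\<^sub>2" using le1 by (intro mult_left_mono) auto
    finally have le2: "complexity C t G' ((?\<phi> ^^ n) (onOb R G)) \<le> b n * c\<^sub>2" .
    have le3: "complexity D t (\<psi> G') (\<psi> ((?\<phi> ^^ n) (onOb R G))) \<le> b n * c\<^sub>2"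
      using order_trans[OF complexity_exact[OF C D \<psi> ob(2)] le2] .
    have "b n * c\<^sub>2 < \<infinity>" using fin by (simp add: ennreal_mult_less_top)
    then have "complexity D t G (\<psi> ((?\<phi> ^^ n) (onOb R G)))
      \<le> c\<^sub>1 * complexity D t (\<psi> G') (\<psi> ((?\<phi> ^^ n) (onOb R G)))"
      using fin(3) le_less_trans[OF le3] unfolding c\<^sub>1_def by (intro D.complexity_submult ob) auto
    also have "\<dots> \<le> c\<^sub>1 * (b n * c\<^sub>2)" using le3 by (intro mult_left_mono) auto
    finally have le4: "complexity D t G (\<psi> (onOb R ((?\<tau> ^^ n) G))) \<le> c\<^sub>1 * (b n * c\<^sub>2)"
      using D.complexity_iso[OF exact_on_objectsD(4)[OF \<psi> RT]] by metis
    have "tri3 D ((?\<tau> ^^ n) G) ((?\<tau> ^^ Suc n) G) (\<psi> (onOb R ((?\<tau> ^^ n) G)))"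
      unfolding \<psi>_def using D.tri3_rotate[OF twist_triangle[OF D ED cl(1)]] by simp
    then have "a (Suc n) \<le> a n + complexity D t G (\<psi> (onOb R ((?\<tau> ^^ n) G)))"
      unfolding a_def by (rule D.complexity_extension)
    also have "\<dots> \<le> a n + c\<^sub>1 * (b n * c\<^sub>2)" using le4 by (intro add_left_mono)
    finally show ?thesis by (simp add: ac_simps)
  qed
  have sum: "a n \<le> a 0 + c\<^sub>1 * c\<^sub>2 * (\<Sum>k<n. b k)" for n
  proof (induction n)
    case (Suc n)
    have "a (Suc n) \<le> a 0 + c\<^sub>1 * c\<^sub>2 * (\<Sum>k<n. b k) + c\<^sub>1 * c\<^sub>2 * b n"
      using order_trans[OF step add_right_mono[OF Suc]] .
    then show ?case by (simp add: distrib_left add.assoc)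
  qed simp
  have "c\<^sub>1 * c\<^sub>2 < \<infinity>" using fin by (simp add: ennreal_mult_less_top)
  then show ?thesis
    using eln_limit_sum_le[OF D.entropy_tendsto[OF T G, of t, folded a_def]
      C.entropy_tendsto[OF \<Phi> G', of t, folded b_def] sum fin(1) _ fin(2)]
    unfolding \<Phi>_def by blast
qed

theorem theorem1p6:
  fixes K :: "'k ring"
    and A :: "('k, 'oa, 'ma) dgcat" and C :: "('k, 'oc, 'mc) tricat"
    and EC :: "('oa, 'ma set, 'oc, 'mc) cfun"
    and B :: "('k, 'ob, 'mb) dgcat" and D :: "('k, 'od, 'md) tricat"
    and ED :: "('ob, 'mb set, 'od, 'md) cfun"
    and S :: "('oc, 'mc, 'od, 'md) cfun"
    and R L :: "('od, 'md, 'oc, 'mc) cfun"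
    and \<eta> :: "'oc \<Rightarrow> 'mc" and \<epsilon> :: "'od \<Rightarrow> 'md"
    and T\<^sub>S :: "('od, 'md, 'od, 'md) cfun" and C\<^sub>S :: "('oc, 'mc, 'oc, 'mc) cfun"
    and t :: real
  assumes "triangulated_category K C" and "triangulated_category K D"
    and "dg_enhancement K A C EC" and "dg_enhancement K B D ED"
    and "spherical_functor K A C EC B D ED S R L \<eta> \<epsilon> T\<^sub>S C\<^sub>S"
    and "\<exists>G. split_generator D G"
    and "\<exists>G\<in>ess_image D C R. split_generator C G"
  shows "(entropy C t (shift_by C 2 \<circ>\<^sub>F C\<^sub>S) \<le> 0 \<longrightarrow> entropy D t T\<^sub>S \<le> 0) \<and>
    (entropy C t (shift_by C 2 \<circ>\<^sub>F C\<^sub>S) \<ge> 0 \<longrightarrow>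
      entropy D t T\<^sub>S \<le> entropy C t (shift_by C 2 \<circ>\<^sub>F C\<^sub>S))"
proof -
  interpret spherical_functor K A C EC B D ED S R L \<eta> \<epsilon> T\<^sub>S C\<^sub>S by fact
  obtain G G' where "split_generator D G" "split_generator C G'" using assms by blast
  then have "entropy D t T\<^sub>S \<le> max 0 (entropy C t (shift_by C 2 \<circ>\<^sub>F C\<^sub>S))"
    using entropy_twist_le assms(1,2,4) by blast
  then show ?thesis by (auto simp: max_def split: if_splits)
qed

end
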